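(* Let $n\ge 1$, let $I,J\subset\mathbb{R}$ be bounded closed intervals with nonempty interior, $\Omega=I\times J$, let $a,b>0$ be real numbers, and let $H\in C^{3}(\Omega)$ be a real-valued function whose partial derivatives $H_x$ and $H_y$ never vanish in $\Omega$. Let $\mu$ be a probability measure on $\mathbb{R}^n$, absolutely continuous with respect to Lebesgue measure, with $\int_{\mathbb{R}^n}\|x\|^5\,d\mu<\infty$. Consider the statement (E) for all Borel measurable $f:\mathbb{R}^n\to I$ and $g:\mathbb{R}^n\to J$, $$\int_{\mathbb{R}^{n}} \operatorname*{ess\,sup}_{y\in\mathbb{R}^n} H\left(f\left(\tfrac{x-y}{a}\right),g\left(\tfrac{y}{b}\right)\right)d\mu(x)\ \ge\ H\left(\int_{\mathbb{R}^n} f\,d\mu,\int_{\mathbb{R}^n} g\,d\mu\right).$$ If (E) holds, then all of the following hold: (1) $\displaystyle a^{2}\frac{H_{xx}}{H_x^2}+(1-a^2-b^2)\frac{H_{xy}}{H_xH_y}+b^2\frac{H_{yy}}{H_y^2}\ge 0$ on $\Omega$; (2) $|1-a^2-b^2|\le 2ab$; (3) if $a+b>1$ then $\int_{\mathbb{R}^n}x\,d\mu=0$. Moreover, if $\mu$ is a Gaussian measure, then conditions (1), (2), (3) together are also sufficient for (E).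
   Context: The essential supremum is taken with respect to Lebesgue measure in $y$. Subscripts denote partial derivatives of $H=H(x,y)$. A Gaussian measure on $\mathbb{R}^n$ is a probability measure of the form $\exp(-xAx^{T}+\beta x^{T}+c)\,dx$ for some (symmetric) positive definite $n\times n$ matrix $A$, $\beta\in\mathbb{R}^n$ and $c\in\mathbb{R}$ (here $x$ is a row vector). *)

theory Defs
  imports "HOL-Probability.Probability"
begin

text \<open>The partial derivatives are taken within the intervals, hence they are one-sided on the
  boundary of the rectangle and do not depend on values of \<open>H\<close> outside it. On a nondegenerate
  interval the derivative is unique.\<close>

definition partial_x :: "real set \<Rightarrow> (real \<Rightarrow> real \<Rightarrow> real) \<Rightarrow> real \<Rightarrow> real \<Rightarrow> real" where
  "partial_x I H = (\<lambda>x y. vector_derivative (\<lambda>t. H t y) (at x within I))"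

definition partial_y :: "real set \<Rightarrow> (real \<Rightarrow> real \<Rightarrow> real) \<Rightarrow> real \<Rightarrow> real \<Rightarrow> real" where
  "partial_y J H = (\<lambda>x y. vector_derivative (\<lambda>t. H x t) (at y within J))"

primrec C_k_on :: "nat \<Rightarrow> real set \<Rightarrow> real set \<Rightarrow> (real \<Rightarrow> real \<Rightarrow> real) \<Rightarrow> bool" where
  "C_k_on 0 I J H \<longleftrightarrow> continuous_on (I \<times> J) (\<lambda>(x, y). H x y)"
| "C_k_on (Suc k) I J H \<longleftrightarrow>
     continuous_on (I \<times> J) (\<lambda>(x, y). H x y) \<and>
     (\<forall>x\<in>I. \<forall>y\<in>J. (\<lambda>t. H t y) differentiable (at x within I) \<and>
                   (\<lambda>t. H x t) differentiable (at y within J)) \<and>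
     C_k_on k I J (partial_x I H) \<and> C_k_on k I J (partial_y J H)"

definition gaussian_measure :: "(real ^ 'n) measure \<Rightarrow> bool" where
  "gaussian_measure M \<longleftrightarrow> prob_space M \<and>
     (\<exists>(A :: real ^ 'n ^ 'n) \<beta> c. transpose A = A \<and> (\<forall>x. x \<noteq> 0 \<longrightarrow> x \<bullet> (A *v x) > 0) \<and>
        M = density lborel (\<lambda>x. ennreal (exp (- (x \<bullet> (A *v x)) + \<beta> \<bullet> x + c))))"

text \<open>The library's \<open>esssup\<close> needs a complete order, so it is taken in \<open>ereal\<close>. For \<open>H\<close> continuous
  on the compact rectangle \<open>I \<times> J\<close>, the function of \<open>y\<close> below is bounded and Borel measurable;
  its essential supremum is then finite, and \<open>real_of_ereal\<close> loses nothing.\<close>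

definition esssup_inequality ::
  "real \<Rightarrow> real \<Rightarrow> real set \<Rightarrow> real set \<Rightarrow> (real \<Rightarrow> real \<Rightarrow> real) \<Rightarrow> (real ^ 'n) measure \<Rightarrow> bool" where
  "esssup_inequality a b I J H M \<longleftrightarrow>
     (\<forall>f \<in> borel_measurable borel. \<forall>g \<in> borel_measurable borel.
        (\<forall>x. f x \<in> I) \<and> (\<forall>x. g x \<in> J) \<longrightarrow>
        (\<integral>x. real_of_ereal (esssup lborel
                (\<lambda>y. ereal (H (f ((1 / a) *\<^sub>R (x - y))) (g ((1 / b) *\<^sub>R y))))) \<partial>M)
        \<ge> H (\<integral>x. f x \<partial>M) (\<integral>x. g x \<partial>M))"

definition differential_condition ::
  "real \<Rightarrow> real \<Rightarrow> real set \<Rightarrow> real set \<Rightarrow> (real \<Rightarrow> real \<Rightarrow> real) \<Rightarrow> bool" where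
  "differential_condition a b I J H \<longleftrightarrow>
     (\<forall>x\<in>I. \<forall>y\<in>J.
        a\<^sup>2 * (partial_x I (partial_x I H) x y / (partial_x I H x y)\<^sup>2)
        + (1 - a\<^sup>2 - b\<^sup>2) * (partial_y J (partial_x I H) x y / (partial_x I H x y * partial_y J H x y))
        + b\<^sup>2 * (partial_y J (partial_y J H) x y / (partial_y J H x y)\<^sup>2) \<ge> 0)"

end

theory Submission
  imports Defs
begin

text \<open>Along a line \<open>a u + b v = z\<close> the left-hand side takes the supremum of \<open>H (f u) (g v)\<close>. At a
critical point of this supremum the gradients of \<open>f\<close> and \<open>g\<close> are \<open>a /
H\<^sub>x\<close> and \<open>b / H\<^sub>y\<close> times one common vector \<open>e\<close>. Let \<open>X\<close> and
\<open>Y\<close> be centred random vectors such that \<open>X\<close>, \<open>Y\<close> and \<open>a X + b Y\<close>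
have the same second moments; then the correlation of \<open>e \<bullet> X\<close> and \<open>e \<bullet> Y\<close> is
\<open>(1 - a\<^sup>2 - b\<^sup>2) / (2 a b)\<close>, and the part of the second-order expansion of \<open>H (f (u +
X)) (g (v + Y))\<close> that involves second derivatives of \<open>H\<close> has expectation \<open>1 / 2\<close>
times the second moment of \<open>e \<bullet> X\<close> times the expression of the differential condition. The
inequality \<open>\<bar>1 - a\<^sup>2 - b\<^sup>2\<bar> \<le> 2 a b\<close> says that this correlation is possible, or
that there is a triangle with sides \<open>a\<close>, \<open>b\<close>, \<open>1\<close>.

\<^emph>\<open>Necessity.\<close> Put \<open>f\<close> and \<open>g\<close> equal to quadratic polynomials of
\<open>\<epsilon> (x \<bullet> e - m0)\<close> near an interior point \<open>(p, r)\<close>, with slopes in the ratio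
above, and to a constant that makes \<open>H\<close> small far away. With suitable second-order coefficients,
depending on a parameter \<open>\<kappa>\<close>, the supremum along a line is bounded by a cubic expression in
\<open>z\<close> (lemma \<open>test_functions\<close>), so both sides can be expanded in \<open>\<epsilon>\<close>.
The order \<open>\<epsilon>\<close> gives \<open>(a + b - 1) \<integral>x = 0\<close> (lemma
\<open>necessary_mean\<close>). The order \<open>\<epsilon>\<^sup>2\<close> gives \<open>0 \<le> \<kappa> (1 -
a\<^sup>2 - b\<^sup>2) + 2 \<bar>B - \<kappa> a b\<bar> + S\<close> for all real \<open>\<kappa>\<close> (lemma
\<open>necessary_second_order\<close>): letting \<open>\<kappa>\<close> tend to \<open>\<plusminus>\<infinity>\<close>
yields the triangle condition and \<open>\<kappa> = B / (a b)\<close> the differential condition.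

\<^emph>\<open>Sufficiency.\<close> The argument is a discrete version of the heat-flow proof of inequalities of this
type. If \<open>H (f u) (g v) \<le> q (a u + b v)\<close> for all \<open>u\<close>, \<open>v\<close>, then the same
holds after \<open>f\<close>, \<open>g\<close>, \<open>q\<close> are averaged over Gaussian noise of variance
\<open>h\<close>, up to an error of order \<open>h powr (3/2)\<close> (lemma \<open>one_step\<close>): the noises for
\<open>f\<close> and \<open>g\<close> are correlated as above, and a drift of order \<open>h\<close> in opposite
directions pays for the defect of the critical-point equation. Doing \<open>1 / h\<close> such steps leaves an error
of order \<open>sqrt h\<close>, which tends to \<open>0\<close> (lemma \<open>heat_flow_inequality\<close>). Since the
Gaussian law is stable under rotations of independent copies, the accumulated noise is again the given Gaussian.

This needs smooth functions and an inequality for all \<open>u\<close>, \<open>v\<close>, whereas an essential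
supremum of Borel functions only gives an inequality for almost all pairs. The passage replaces \<open>f u\<close> by
a value that \<open>f\<close> reaches (in the direction in which \<open>H\<close> grows) with probability at least
\<open>3 / 4\<close> after a small Gaussian displacement of \<open>u\<close>: its local mean, corrected by four times
its local oscillation (lemma \<open>typical_bounds_inequality\<close>). These values are Lipschitz in
\<open>u\<close>, satisfy the inequality everywhere, and tend to \<open>f\<close> in mean.\<close>

section \<open>Smooth functions on a rectangle\<close>

text \<open>The quantitative facts about \<open>H\<close>, with the partial derivatives as separate functions and a single
constant \<open>K\<close> for all bounds. The signs \<open>\<sigma>\<close> and \<open>\<tau>\<close> of
\<open>H\<^sub>x\<close> and \<open>H\<^sub>y\<close> are parameters, so the four possible directions of monotonicity
need no case distinction; \<open>away_from_0\<close> bounds \<open>1 / \<bar>H\<^sub>x\<bar>\<close> and \<open>1 /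
\<bar>H\<^sub>y\<bar>\<close> by \<open>K\<close>.\<close>

locale smooth_rectangle =
  fixes i0 i1 j0 j1 :: real
    and H Hx Hy Hxx Hxy Hyy :: "real \<Rightarrow> real \<Rightarrow> real"
    and K \<sigma> \<tau> :: real
  assumes i_less: "i0 < i1" and j_less: "j0 < j1"
    and K_ge_1: "1 \<le> K"
    and sgn_cases: "\<sigma> \<in> {-1, 1}" "\<tau> \<in> {-1, 1}"
    and cont_H: "continuous_on ({i0..i1} \<times> {j0..j1}) (\<lambda>(x, y). H x y)"
    and bounds: "\<And>x y. x \<in> {i0..i1} \<Longrightarrow> y \<in> {j0..j1} \<Longrightarrow>
      \<bar>Hx x y\<bar> \<le> K \<and> \<bar>Hy x y\<bar> \<le> K \<and> \<bar>Hxx x y\<bar> \<le> K \<and> \<bar>Hxy x y\<bar> \<le> K \<and> \<bar>Hyy x y\<bar> \<le> K"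
    and away_from_0: "\<And>x y. x \<in> {i0..i1} \<Longrightarrow> y \<in> {j0..j1} \<Longrightarrow>
      1 \<le> K * (\<sigma> * Hx x y) \<and> 1 \<le> K * (\<tau> * Hy x y)"
    and mono_x: "\<And>x x' y. x \<in> {i0..i1} \<Longrightarrow> x' \<in> {i0..i1} \<Longrightarrow> y \<in> {j0..j1} \<Longrightarrow>
      \<sigma> * x \<le> \<sigma> * x' \<Longrightarrow> H x y \<le> H x' y"
    and mono_y: "\<And>x y y'. x \<in> {i0..i1} \<Longrightarrow> y \<in> {j0..j1} \<Longrightarrow> y' \<in> {j0..j1} \<Longrightarrow>
      \<tau> * y \<le> \<tau> * y' \<Longrightarrow> H x y \<le> H x y'"
    and lipschitz: "\<And>x x' y y'. x \<in> {i0..i1} \<Longrightarrow> x' \<in> {i0..i1} \<Longrightarrow> y \<in> {j0..j1} \<Longrightarrow> y' \<in> {j0..j1} \<Longrightarrow>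
      \<bar>H x' y' - H x y\<bar> \<le> K * (\<bar>x' - x\<bar> + \<bar>y' - y\<bar>)"
    and taylor1: "\<And>x x' y y'. x \<in> {i0..i1} \<Longrightarrow> x' \<in> {i0..i1} \<Longrightarrow> y \<in> {j0..j1} \<Longrightarrow> y' \<in> {j0..j1} \<Longrightarrow>
      \<bar>H x' y' - H x y - Hx x y * (x' - x) - Hy x y * (y' - y)\<bar> \<le> K * (\<bar>x' - x\<bar> + \<bar>y' - y\<bar>)\<^sup>2"
    and taylor2: "\<And>x x' y y'. x \<in> {i0..i1} \<Longrightarrow> x' \<in> {i0..i1} \<Longrightarrow> y \<in> {j0..j1} \<Longrightarrow> y' \<in> {j0..j1} \<Longrightarrow>
      \<bar>H x' y' - H x y - Hx x y * (x' - x) - Hy x y * (y' - y)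
        - (Hxx x y * (x' - x)\<^sup>2 + 2 * Hxy x y * (x' - x) * (y' - y) + Hyy x y * (y' - y)\<^sup>2) / 2\<bar>
      \<le> K * (\<bar>x' - x\<bar> + \<bar>y' - y\<bar>) ^ 3"

lemma continuous_on_rectangle_bounded:
  fixes F :: "real \<Rightarrow> real \<Rightarrow> real"
  assumes "continuous_on ({i0..i1} \<times> {j0..j1}) (\<lambda>(x, y). F x y)"
  shows "\<exists>B\<ge>0. \<forall>x\<in>{i0..i1}. \<forall>y\<in>{j0..j1}. \<bar>F x y\<bar> \<le> B"
proof -
  have "compact ((\<lambda>(x, y). F x y) ` ({i0..i1} \<times> {j0..j1}))"
    by (intro compact_continuous_image assms compact_Times compact_Icc)
  then have "bounded ((\<lambda>(x, y). F x y) ` ({i0..i1} \<times> {j0..j1}))"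
    by (rule compact_imp_bounded)
  then obtain B where "B > 0" "\<forall>z\<in>(\<lambda>(x, y). F x y) ` ({i0..i1} \<times> {j0..j1}). norm z \<le> B"
    using bounded_pos by blast
  then show ?thesis by (intro exI[of _ B]) fastforce
qed

text \<open>The image of the rectangle is an interval that omits \<open>0\<close>, and \<open>1 / F\<close> is bounded by
compactness.\<close>

lemma nonvanishing_on_rectangle_sign:
  fixes F :: "real \<Rightarrow> real \<Rightarrow> real"
  assumes cont: "continuous_on ({i0..i1} \<times> {j0..j1}) (\<lambda>(x, y). F x y)"
    and nz: "\<And>x y. x \<in> {i0..i1} \<Longrightarrow> y \<in> {j0..j1} \<Longrightarrow> F x y \<noteq> 0"
  shows "\<exists>s\<in>{-1, 1}. \<exists>B>0. \<forall>x\<in>{i0..i1}. \<forall>y\<in>{j0..j1}. 1 \<le> B * (s * F x y)"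
proof -
  let ?R = "{i0..i1} \<times> {j0..j1}" and ?f = "\<lambda>(x, y). F x y"
  have "connected (?f ` ?R)"
    by (intro connected_continuous_image cont connected_Times connected_Icc)
  then have iv: "is_interval (?f ` ?R)"
    by (simp add: is_interval_connected_1)
  have "0 \<notin> ?f ` ?R" using nz by force
  have sgn: "(\<forall>z\<in>?f ` ?R. 0 < z) \<or> (\<forall>z\<in>?f ` ?R. z < 0)"
  proof (rule ccontr)
    assume "\<not> ?thesis"
    then obtain z w where "z \<in> ?f ` ?R" "w \<in> ?f ` ?R" "z \<le> 0" "0 \<le> w"
      by (meson not_le_imp_less)
    then have "0 \<in> ?f ` ?R" using iv unfolding is_interval_1 by blast
    with \<open>0 \<notin> ?f ` ?R\<close> show False ..
  qed
  then obtain s :: real where s: "s \<in> {-1, 1}" "\<And>x y. x \<in> {i0..i1} \<Longrightarrow> y \<in> {j0..j1} \<Longrightarrow> 0 < s * F x y"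
  proof
    assume "\<forall>z\<in>?f ` ?R. 0 < z" then show thesis by (intro that[of 1]) force+
  next
    assume "\<forall>z\<in>?f ` ?R. z < 0" then show thesis by (intro that[of "-1"]) force+
  qed
  have "continuous_on ?R (\<lambda>(x, y). 1 / F x y)"
    using cont nz by (auto simp: case_prod_unfold intro!: continuous_intros)
  from continuous_on_rectangle_bounded[OF this]
  obtain B where B: "B \<ge> 0" "\<And>x y. x \<in> {i0..i1} \<Longrightarrow> y \<in> {j0..j1} \<Longrightarrow> \<bar>1 / F x y\<bar> \<le> B"
    by blast
  have "1 \<le> (B + 1) * (s * F x y)" if "x \<in> {i0..i1}" "y \<in> {j0..j1}" for x y
  proof -
    have "\<bar>F x y\<bar> = s * F x y" using s(2)[OF that] s(1) by (auto simp: abs_if)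
    moreover have "1 \<le> B * \<bar>F x y\<bar>" using B(2)[OF that] nz[OF that] by (simp add: abs_divide field_simps)
    ultimately show ?thesis using s(2)[OF that] by (simp add: distrib_right)
  qed
  then show ?thesis using s(1) B(1) by (intro bexI[of _ s] exI[of _ "B + 1"]) auto
qed

lemma C_k_on_Suc_D:
  assumes "C_k_on (Suc k) I J F"
  shows "C_k_on k I J (partial_x I F)" "C_k_on k I J (partial_y J F)"
    and "\<And>x y. x \<in> I \<Longrightarrow> y \<in> J \<Longrightarrow> ((\<lambda>t. F t y) has_field_derivative partial_x I F x y) (at x within I)"
    and "\<And>x y. x \<in> I \<Longrightarrow> y \<in> J \<Longrightarrow> ((\<lambda>t. F x t) has_field_derivative partial_y J F x y) (at y within J)"
  using assms
  by (auto simp: partial_x_def partial_y_def has_real_derivative_iff_has_vector_derivative vector_derivative_works)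

lemma C_k_on_continuous: "C_k_on k I J F \<Longrightarrow> continuous_on (I \<times> J) (\<lambda>(x, y). F x y)"
  by (cases k) auto

lemma real_taylor_remainder:
  fixes f :: "nat \<Rightarrow> real \<Rightarrow> real"
  assumes f: "\<And>i x. x \<in> {l..u} \<Longrightarrow> i \<le> n \<Longrightarrow> (f i has_field_derivative f (Suc i) x) (at x within {l..u})"
    and B: "\<And>x. x \<in> {l..u} \<Longrightarrow> \<bar>f (Suc n) x\<bar> \<le> B" and w: "w \<in> {l..u}" and z: "z \<in> {l..u}"
  shows "\<bar>f 0 z - (\<Sum>i\<le>n. f i w * (z - w) ^ i / fact i)\<bar> \<le> B * \<bar>z - w\<bar> ^ Suc n / fact n"
  using field_Taylor[of "{l..u}" n f B w z] assms by (simp add: convex_real_interval)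

lemma mono_from_signed_derivative:
  fixes f f' :: "real \<Rightarrow> real"
  assumes d: "\<And>x. x \<in> {l..u} \<Longrightarrow> (f has_field_derivative f' x) (at x within {l..u})"
    and s: "s \<in> {-1, 1}" and pos: "\<And>x. x \<in> {l..u} \<Longrightarrow> 0 \<le> s * f' x"
    and xx: "x \<in> {l..u}" "x' \<in> {l..u}" "s * x \<le> s * x'"
  shows "f x \<le> f x'"
proof -
  have mvt: "\<exists>z\<in>{l..u}. f w - f v = f' z * (w - v)" if "v \<le> w" "v \<in> {l..u}" "w \<in> {l..u}" for v w
  proof -
    have "\<exists>z\<in>{v..w}. f w - f v = (*) (f' z) (w - v)"
      using that d
      by (intro mvt_very_simple) (auto simp: has_field_derivative_def intro!: has_derivative_subset[of _ _ _ "{l..u}" "{v..w}"])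
    then show ?thesis using that by fastforce
  qed
  show ?thesis
  proof (cases "s = 1")
    case True
    then show ?thesis using mvt[of x x'] xx pos by (smt (verit) mult_nonneg_nonneg mult_cancel_right1)
  next
    case False
    then have "s = -1" using s by simp
    then obtain z where "z \<in> {l..u}" "f x - f x' = f' z * (x - x')" using mvt[of x' x] xx by auto
    moreover have "f' z * (x - x') \<le> 0"
      using pos[of z] xx \<open>s = -1\<close> \<open>z \<in> {l..u}\<close> by (intro mult_nonpos_nonneg) auto
    ultimately show ?thesis by linarith
  qed
qed

text \<open>The derivatives are taken in one variable at a time and are one-sided at the boundary. So the increment is split into
a horizontal one at height \<open>y'\<close> and a vertical one at \<open>x\<close>, each expanded in one variable;
expanding the coefficients \<open>H\<^sub>x\<close> and \<open>H\<^sub>x\<^sub>x\<close> from \<open>y'\<close> back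
to \<open>y\<close> then produces the mixed derivative in the order \<open>partial_y (partial_x H)\<close> of the
differential condition.\<close>

lemma C3_rectangle_taylor:
  assumes C: "C_k_on 3 {i0..i1} {j0..j1} H"
  defines "I \<equiv> {i0..i1}" and "J \<equiv> {j0..j1}"
  shows "\<exists>B\<ge>0. \<forall>x\<in>I. \<forall>x'\<in>I. \<forall>y\<in>J. \<forall>y'\<in>J.
    \<bar>partial_x I H x y\<bar> \<le> B \<and> \<bar>partial_y J H x y\<bar> \<le> B \<and> \<bar>partial_x I (partial_x I H) x y\<bar> \<le> B \<and>
    \<bar>partial_y J (partial_x I H) x y\<bar> \<le> B \<and> \<bar>partial_y J (partial_y J H) x y\<bar> \<le> B \<and>
    \<bar>H x' y' - H x y - partial_x I H x y * (x' - x) - partial_y J H x y * (y' - y)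
        - (partial_x I (partial_x I H) x y * (x' - x)\<^sup>2 + 2 * partial_y J (partial_x I H) x y * (x' - x) * (y' - y)
           + partial_y J (partial_y J H) x y * (y' - y)\<^sup>2) / 2\<bar>
      \<le> B * (\<bar>x' - x\<bar> + \<bar>y' - y\<bar>) ^ 3"
proof -
  note IJ = I_def[symmetric] J_def[symmetric]
  define Hx where "Hx = partial_x I H"
  define Hy where "Hy = partial_y J H"
  define Hxx where "Hxx = partial_x I Hx"
  define Hxy where "Hxy = partial_y J Hx"
  define Hyy where "Hyy = partial_y J Hy"
  define Hxxx where "Hxxx = partial_x I Hxx"
  define Hxxy where "Hxxy = partial_y J Hxx"
  define Hxyy where "Hxyy = partial_y J Hxy"
  define Hyyy where "Hyyy = partial_y J Hyy"
  have C3: "C_k_on (Suc (Suc (Suc 0))) I J H" using C by (simp add: IJ numeral_3_eq_3)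
  note d1 = C_k_on_Suc_D[OF C3, folded Hx_def Hy_def]
  note d2 = C_k_on_Suc_D[OF d1(1), folded Hxx_def Hxy_def] C_k_on_Suc_D[OF d1(2), folded Hyy_def]
  note d3 = C_k_on_Suc_D[OF d2(1), folded Hxxx_def Hxxy_def] C_k_on_Suc_D[OF d2(2), folded Hxyy_def]
    C_k_on_Suc_D[OF d2(6), folded Hyyy_def]
  note cts = C_k_on_continuous[OF d1(1)] C_k_on_continuous[OF d1(2)] C_k_on_continuous[OF d2(1)]
    C_k_on_continuous[OF d2(2)] C_k_on_continuous[OF d2(6)] C_k_on_continuous[OF d3(1)]
    C_k_on_continuous[OF d3(2)] C_k_on_continuous[OF d3(6)] C_k_on_continuous[OF d3(10)]
  have "continuous_on ({i0..i1} \<times> {j0..j1}) (\<lambda>(x, y). \<bar>Hx x y\<bar> + \<bar>Hy x y\<bar> + \<bar>Hxx x y\<bar> + \<bar>Hxy x y\<bar> + \<bar>Hyy x y\<bar>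
      + \<bar>Hxxx x y\<bar> + \<bar>Hxxy x y\<bar> + \<bar>Hxyy x y\<bar> + \<bar>Hyyy x y\<bar>)"
    using cts unfolding I_def J_def case_prod_unfold by (intro continuous_intros)
  from continuous_on_rectangle_bounded[OF this, unfolded IJ] obtain B where B0: "0 \<le> B"
    and B: "\<And>x y. x \<in> I \<Longrightarrow> y \<in> J \<Longrightarrow> \<bar>Hx x y\<bar> + \<bar>Hy x y\<bar> + \<bar>Hxx x y\<bar> + \<bar>Hxy x y\<bar> + \<bar>Hyy x y\<bar>
      + \<bar>Hxxx x y\<bar> + \<bar>Hxxy x y\<bar> + \<bar>Hxyy x y\<bar> + \<bar>Hyyy x y\<bar> \<le> B"
    by (meson order_trans[OF abs_ge_self])
  have bnd: "\<bar>Hx x y\<bar> \<le> B" "\<bar>Hy x y\<bar> \<le> B" "\<bar>Hxx x y\<bar> \<le> B" "\<bar>Hxy x y\<bar> \<le> B" "\<bar>Hyy x y\<bar> \<le> B"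
    "\<bar>Hxxx x y\<bar> \<le> B" "\<bar>Hxxy x y\<bar> \<le> B" "\<bar>Hxyy x y\<bar> \<le> B" "\<bar>Hyyy x y\<bar> \<le> B" if "x \<in> I" "y \<in> J" for x y
    using B[OF that] abs_ge_zero[of "Hx x y"] abs_ge_zero[of "Hy x y"] abs_ge_zero[of "Hxx x y"] abs_ge_zero[of "Hxy x y"]
      abs_ge_zero[of "Hyy x y"] abs_ge_zero[of "Hxxx x y"] abs_ge_zero[of "Hxxy x y"] abs_ge_zero[of "Hxyy x y"] abs_ge_zero[of "Hyyy x y"]
    by linarith+
  have taylor: "\<bar>H x' y' - H x y - Hx x y * (x' - x) - Hy x y * (y' - y)
        - (Hxx x y * (x' - x)\<^sup>2 + 2 * Hxy x y * (x' - x) * (y' - y) + Hyy x y * (y' - y)\<^sup>2) / 2\<bar>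
      \<le> 2 * B * (\<bar>x' - x\<bar> + \<bar>y' - y\<bar>) ^ 3"
    if xy: "x \<in> I" "x' \<in> I" "y \<in> J" "y' \<in> J" for x x' y y'
  proof -
    define s where "s = x' - x"
    define t where "t = y' - y"
    let ?fx = "\<lambda>i z. if i = (0::nat) then H z y' else if i = 1 then Hx z y' else if i = 2 then Hxx z y' else Hxxx z y'"
    have dx: "(?fx i has_field_derivative ?fx (Suc i) z) (at z within {i0..i1})"
      if "z \<in> {i0..i1}" "i \<le> 2" for i z
    proof -
      have "i = 0 \<or> i = 1 \<or> i = 2" using that by linarith
      then show ?thesis using d1(3) d2(3) d3(3) that(1) xy(4) by (auto simp: IJ)
    qed
    have "\<bar>?fx 0 x' - (\<Sum>i\<le>2. ?fx i x * (x' - x) ^ i / fact i)\<bar> \<le> B * \<bar>x' - x\<bar> ^ Suc 2 / fact 2"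
      by (rule real_taylor_remainder[where f = ?fx, OF dx]) (use xy bnd in \<open>auto simp: I_def\<close>)
    then have e1: "\<bar>H x' y' - (H x y' + Hx x y' * s + Hxx x y' * s\<^sup>2 / 2)\<bar> \<le> B * \<bar>s\<bar> ^ 3 / 2"
      by (simp add: numeral_2_eq_2 s_def numeral_3_eq_3)
    let ?fy = "\<lambda>i z. if i = (0::nat) then H x z else if i = 1 then Hy x z else if i = 2 then Hyy x z else Hyyy x z"
    have dy: "(?fy i has_field_derivative ?fy (Suc i) z) (at z within {j0..j1})"
      if "z \<in> {j0..j1}" "i \<le> 2" for i z
    proof -
      have "i = 0 \<or> i = 1 \<or> i = 2" using that by linarith
      then show ?thesis using d1(4) d2(8) d3(12) that(1) xy(1) by (auto simp: IJ)
    qed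
    have "\<bar>?fy 0 y' - (\<Sum>i\<le>2. ?fy i y * (y' - y) ^ i / fact i)\<bar> \<le> B * \<bar>y' - y\<bar> ^ Suc 2 / fact 2"
      by (rule real_taylor_remainder[where f = ?fy, OF dy]) (use xy bnd in \<open>auto simp: J_def\<close>)
    then have e2: "\<bar>H x y' - (H x y + Hy x y * t + Hyy x y * t\<^sup>2 / 2)\<bar> \<le> B * \<bar>t\<bar> ^ 3 / 2"
      by (simp add: numeral_2_eq_2 t_def numeral_3_eq_3)
    let ?fm = "\<lambda>i z. if i = (0::nat) then Hx x z else if i = 1 then Hxy x z else Hxyy x z"
    have dm: "(?fm i has_field_derivative ?fm (Suc i) z) (at z within {j0..j1})"
      if "z \<in> {j0..j1}" "i \<le> 1" for i z
    proof -
      have "i = 0 \<or> i = 1" using that by linarith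
      then show ?thesis using d2(4) d3(8) that(1) xy(1) by (auto simp: IJ)
    qed
    have "\<bar>?fm 0 y' - (\<Sum>i\<le>1. ?fm i y * (y' - y) ^ i / fact i)\<bar> \<le> B * \<bar>y' - y\<bar> ^ Suc 1 / fact 1"
      by (rule real_taylor_remainder[where f = ?fm, OF dm]) (use xy bnd in \<open>auto simp: J_def\<close>)
    then have e3: "\<bar>Hx x y' - (Hx x y + Hxy x y * t)\<bar> \<le> B * \<bar>t\<bar>\<^sup>2"
      by (simp add: numeral_2_eq_2 t_def)
    let ?fn = "\<lambda>i z. if i = (0::nat) then Hxx x z else Hxxy x z"
    have "\<bar>?fn 0 y' - (\<Sum>i\<le>0. ?fn i y * (y' - y) ^ i / fact i)\<bar> \<le> B * \<bar>y' - y\<bar> ^ Suc 0 / fact 0"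
      by (rule real_taylor_remainder[where f = ?fn]) (use xy bnd d3(4) in \<open>auto simp: I_def J_def\<close>)
    then have e4: "\<bar>Hxx x y' - Hxx x y\<bar> \<le> B * \<bar>t\<bar>" by (simp add: t_def)
    have m3: "\<bar>(Hx x y' - (Hx x y + Hxy x y * t)) * s\<bar> \<le> B * \<bar>t\<bar>\<^sup>2 * \<bar>s\<bar>"
      unfolding abs_mult by (intro mult_right_mono e3) simp
    have m4: "\<bar>(Hxx x y' - Hxx x y) * (s\<^sup>2 / 2)\<bar> \<le> B * \<bar>t\<bar> * (\<bar>s\<bar>\<^sup>2 / 2)"
      unfolding abs_mult using e4 by (auto intro!: mult_mono)
    have "H x' y' - H x y - Hx x y * s - Hy x y * t - (Hxx x y * s\<^sup>2 + 2 * Hxy x y * s * t + Hyy x y * t\<^sup>2) / 2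
      = (H x' y' - (H x y' + Hx x y' * s + Hxx x y' * s\<^sup>2 / 2)) + (H x y' - (H x y + Hy x y * t + Hyy x y * t\<^sup>2 / 2))
        + (Hx x y' - (Hx x y + Hxy x y * t)) * s + (Hxx x y' - Hxx x y) * (s\<^sup>2 / 2)"
      by (simp add: field_simps)
    then have "\<bar>H x' y' - H x y - Hx x y * s - Hy x y * t - (Hxx x y * s\<^sup>2 + 2 * Hxy x y * s * t + Hyy x y * t\<^sup>2) / 2\<bar>
      \<le> B * \<bar>s\<bar> ^ 3 / 2 + B * \<bar>t\<bar> ^ 3 / 2 + B * \<bar>t\<bar>\<^sup>2 * \<bar>s\<bar> + B * \<bar>t\<bar> * (\<bar>s\<bar>\<^sup>2 / 2)"
      using e1 e2 m3 m4 by linarith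
    also have "\<dots> = B * (\<bar>s\<bar> ^ 3 / 2 + \<bar>t\<bar> ^ 3 / 2 + \<bar>t\<bar>\<^sup>2 * \<bar>s\<bar> + \<bar>t\<bar> * (\<bar>s\<bar>\<^sup>2 / 2))"
      by (simp add: algebra_simps)
    also have "\<dots> \<le> B * (2 * (\<bar>s\<bar> + \<bar>t\<bar>) ^ 3)"
    proof (intro mult_left_mono B0)
      have "(\<bar>s\<bar> + \<bar>t\<bar>) ^ 3 = \<bar>s\<bar> ^ 3 + 3 * \<bar>s\<bar>\<^sup>2 * \<bar>t\<bar> + 3 * \<bar>s\<bar> * \<bar>t\<bar>\<^sup>2 + \<bar>t\<bar> ^ 3"
        by (simp add: power3_eq_cube power2_eq_square algebra_simps del: abs_mult_self_eq)
      moreover have "0 \<le> \<bar>s\<bar> ^ 3" "0 \<le> \<bar>t\<bar> ^ 3" "0 \<le> \<bar>s\<bar>\<^sup>2 * \<bar>t\<bar>" "0 \<le> \<bar>s\<bar> * \<bar>t\<bar>\<^sup>2"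
        by (simp_all del: power2_abs)
      moreover have "\<bar>t\<bar> * (\<bar>s\<bar>\<^sup>2 / 2) = \<bar>s\<bar>\<^sup>2 * \<bar>t\<bar> / 2" "\<bar>t\<bar>\<^sup>2 * \<bar>s\<bar> = \<bar>s\<bar> * \<bar>t\<bar>\<^sup>2"
        by (simp_all only: mult.commute times_divide_eq_right)
      ultimately show "\<bar>s\<bar> ^ 3 / 2 + \<bar>t\<bar> ^ 3 / 2 + \<bar>t\<bar>\<^sup>2 * \<bar>s\<bar> + \<bar>t\<bar> * (\<bar>s\<bar>\<^sup>2 / 2) \<le> 2 * (\<bar>s\<bar> + \<bar>t\<bar>) ^ 3"
        by linarith
    qed
    finally show ?thesis by (simp add: s_def t_def)
  qed
  have "\<bar>Hx x y\<bar> \<le> 2 * B \<and> \<bar>Hy x y\<bar> \<le> 2 * B \<and> \<bar>Hxx x y\<bar> \<le> 2 * B \<and> \<bar>Hxy x y\<bar> \<le> 2 * B \<and> \<bar>Hyy x y\<bar> \<le> 2 * B"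
    if "x \<in> I" "y \<in> J" for x y
    using bnd[OF that] B0 by auto
  with taylor B0 show ?thesis
    unfolding Hxx_def[symmetric] Hx_def[symmetric] Hxy_def[symmetric] Hy_def[symmetric] Hyy_def[symmetric]
    by (intro exI[of _ "2 * B"] conjI ballI) (simp | blast)+
qed

lemma C3_imp_smooth_rectangle:
  assumes ij: "i0 < i1" "j0 < j1" and C: "C_k_on 3 {i0..i1} {j0..j1} H"
  defines "I \<equiv> {i0..i1}" and "J \<equiv> {j0..j1}"
  assumes nzx: "\<And>x y. x \<in> I \<Longrightarrow> y \<in> J \<Longrightarrow> partial_x I H x y \<noteq> 0"
    and nzy: "\<And>x y. x \<in> I \<Longrightarrow> y \<in> J \<Longrightarrow> partial_y J H x y \<noteq> 0"
  shows "\<exists>K \<sigma> \<tau>. smooth_rectangle i0 i1 j0 j1 H (partial_x I H) (partial_y J H) (partial_x I (partial_x I H))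
    (partial_y J (partial_x I H)) (partial_y J (partial_y J H)) K \<sigma> \<tau>"
proof -
  define Hx where "Hx = partial_x I H"
  define Hy where "Hy = partial_y J H"
  define Hxx where "Hxx = partial_x I Hx"
  define Hxy where "Hxy = partial_y J Hx"
  define Hyy where "Hyy = partial_y J Hy"
  have C3: "C_k_on (Suc (Suc (Suc 0))) I J H" using C by (simp add: I_def J_def numeral_3_eq_3)
  note d1 = C_k_on_Suc_D[OF C3, folded Hx_def Hy_def]
  obtain B where B0: "B \<ge> 0" and B: "\<forall>x\<in>I. \<forall>x'\<in>I. \<forall>y\<in>J. \<forall>y'\<in>J.
      \<bar>Hx x y\<bar> \<le> B \<and> \<bar>Hy x y\<bar> \<le> B \<and> \<bar>Hxx x y\<bar> \<le> B \<and> \<bar>Hxy x y\<bar> \<le> B \<and> \<bar>Hyy x y\<bar> \<le> B \<and>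
      \<bar>H x' y' - H x y - Hx x y * (x' - x) - Hy x y * (y' - y)
        - (Hxx x y * (x' - x)\<^sup>2 + 2 * Hxy x y * (x' - x) * (y' - y) + Hyy x y * (y' - y)\<^sup>2) / 2\<bar>
      \<le> B * (\<bar>x' - x\<bar> + \<bar>y' - y\<bar>) ^ 3"
    using C3_rectangle_taylor[OF C] unfolding I_def[symmetric] J_def[symmetric]
      Hx_def[symmetric] Hy_def[symmetric] Hxx_def[symmetric] Hxy_def[symmetric] Hyy_def[symmetric]
    by (elim exE conjE)
  have bnd: "\<bar>Hx x y\<bar> \<le> B \<and> \<bar>Hy x y\<bar> \<le> B \<and> \<bar>Hxx x y\<bar> \<le> B \<and> \<bar>Hxy x y\<bar> \<le> B \<and> \<bar>Hyy x y\<bar> \<le> B"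
    if "x \<in> I" "y \<in> J" for x y
    using bspec[OF bspec[OF bspec[OF bspec[OF B that(1)] that(1)] that(2)] that(2)] by (elim conjE) (intro conjI)
  have taylor: "\<bar>H x' y' - H x y - Hx x y * (x' - x) - Hy x y * (y' - y)
        - (Hxx x y * (x' - x)\<^sup>2 + 2 * Hxy x y * (x' - x) * (y' - y) + Hyy x y * (y' - y)\<^sup>2) / 2\<bar>
      \<le> B * (\<bar>x' - x\<bar> + \<bar>y' - y\<bar>) ^ 3"
    if "x \<in> I" "x' \<in> I" "y \<in> J" "y' \<in> J" for x x' y y'
    using bspec[OF bspec[OF bspec[OF bspec[OF B that(1)] that(2)] that(3)] that(4)] by (elim conjE)
  obtain \<sigma> Bx where sx: "\<sigma> \<in> {-1, 1}" "Bx > 0" "\<And>x y. x \<in> I \<Longrightarrow> y \<in> J \<Longrightarrow> 1 \<le> Bx * (\<sigma> * Hx x y)"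
    using nonvanishing_on_rectangle_sign[OF C_k_on_continuous[OF d1(1), unfolded I_def J_def] nzx[folded Hx_def, unfolded I_def J_def]]
    unfolding I_def J_def by blast
  obtain \<tau> By where sy: "\<tau> \<in> {-1, 1}" "By > 0" "\<And>x y. x \<in> I \<Longrightarrow> y \<in> J \<Longrightarrow> 1 \<le> By * (\<tau> * Hy x y)"
    using nonvanishing_on_rectangle_sign[OF C_k_on_continuous[OF d1(2), unfolded I_def J_def] nzy[folded Hy_def, unfolded I_def J_def]]
    unfolding I_def J_def by blast
  have posx: "0 < \<sigma> * Hx x y" and posy: "0 < \<tau> * Hy x y" if "x \<in> I" "y \<in> J" for x y
    using zero_less_mult_pos[OF order.strict_trans2[OF zero_less_one sx(3)[OF that]] sx(2)]
      zero_less_mult_pos[OF order.strict_trans2[OF zero_less_one sy(3)[OF that]] sy(2)] by simp_all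
  define W where "W = (i1 - i0) + (j1 - j0)"
  have W0: "0 \<le> W" using ij by (simp add: W_def)
  define K1 where "K1 = 2 * B + B * W"
  define K where "K = 1 + B + Bx + By + K1 + (B + K1 * W)"
  have K10: "0 \<le> K1" using B0 W0 by (simp add: K1_def)
  have pw: "0 \<le> B * W" "0 \<le> K1 * W" using B0 W0 K10 by simp_all
  have Kge: "1 \<le> K" "B \<le> K" "Bx \<le> K" "By \<le> K" "K1 \<le> K" "B + K1 * W \<le> K"
    unfolding K_def using B0 sx(2) sy(2) K10 pw by linarith+
  have t1: "\<bar>H x' y' - H x y - Hx x y * (x' - x) - Hy x y * (y' - y)\<bar> \<le> K1 * (\<bar>x' - x\<bar> + \<bar>y' - y\<bar>)\<^sup>2"
    and t0: "\<bar>H x' y' - H x y\<bar> \<le> (B + K1 * W) * (\<bar>x' - x\<bar> + \<bar>y' - y\<bar>)"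
    if xy: "x \<in> I" "x' \<in> I" "y \<in> J" "y' \<in> J" for x x' y y'
  proof -
    define s where "s = x' - x"
    define t where "t = y' - y"
    define w where "w = \<bar>s\<bar> + \<bar>t\<bar>"
    have w: "0 \<le> w" "w \<le> W" using xy by (auto simp: w_def W_def s_def t_def I_def J_def)
    note b = bnd[OF xy(1,3)]
    have "\<bar>Hxx x y * s\<^sup>2\<bar> \<le> B * s\<^sup>2" "\<bar>Hyy x y * t\<^sup>2\<bar> \<le> B * t\<^sup>2" "\<bar>Hxy x y * (s * t)\<bar> \<le> B * (\<bar>s\<bar> * \<bar>t\<bar>)"
      "\<bar>Hx x y * s\<bar> \<le> B * \<bar>s\<bar>" "\<bar>Hy x y * t\<bar> \<le> B * \<bar>t\<bar>"
      using b by (auto simp: abs_mult intro!: mult_right_mono)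
    note ab = this
    have w2: "w\<^sup>2 = s\<^sup>2 + 2 * (\<bar>s\<bar> * \<bar>t\<bar>) + t\<^sup>2" by (simp add: w_def power2_sum)
    have "\<bar>(Hxx x y * s\<^sup>2 + 2 * Hxy x y * s * t + Hyy x y * t\<^sup>2) / 2\<bar> \<le> (B * s\<^sup>2 + 2 * (B * (\<bar>s\<bar> * \<bar>t\<bar>)) + B * t\<^sup>2) / 2"
      using ab(1-3) by (simp add: mult.assoc)
    also have "\<dots> = B * w\<^sup>2 / 2" unfolding w2 by (simp add: algebra_simps)
    finally have q: "\<bar>(Hxx x y * s\<^sup>2 + 2 * Hxy x y * s * t + Hyy x y * t\<^sup>2) / 2\<bar> \<le> B * w\<^sup>2 / 2" .
    have "B * w ^ 3 = B * w * w\<^sup>2" by (simp add: power3_eq_cube power2_eq_square)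
    also have "\<dots> \<le> B * W * w\<^sup>2" using w B0 by (intro mult_right_mono mult_left_mono) auto
    finally have c: "B * w ^ 3 \<le> B * W * w\<^sup>2" .
    have bw: "0 \<le> B * w\<^sup>2" using B0 by simp
    show t: "\<bar>H x' y' - H x y - Hx x y * (x' - x) - Hy x y * (y' - y)\<bar> \<le> K1 * (\<bar>x' - x\<bar> + \<bar>y' - y\<bar>)\<^sup>2"
    proof -
      have "K1 * w\<^sup>2 = 2 * (B * w\<^sup>2) + B * W * w\<^sup>2" by (simp add: K1_def algebra_simps)
      then show ?thesis
        using taylor[OF xy] q c bw unfolding s_def[symmetric] t_def[symmetric] w_def[symmetric] by linarith
    qed
    have "K1 * w\<^sup>2 \<le> K1 * W * w" using w K10 by (auto simp: power2_eq_square mult.assoc intro!: mult_left_mono mult_right_mono)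
    moreover have "\<bar>Hx x y * s + Hy x y * t\<bar> \<le> B * w" using ab(4,5) by (simp add: w_def distrib_left)
    ultimately show "\<bar>H x' y' - H x y\<bar> \<le> (B + K1 * W) * (\<bar>x' - x\<bar> + \<bar>y' - y\<bar>)"
      using t unfolding s_def[symmetric] t_def[symmetric] w_def[symmetric] distrib_right by linarith
  qed
  have "smooth_rectangle i0 i1 j0 j1 H Hx Hy Hxx Hxy Hyy K \<sigma> \<tau>"
  proof (standard, fold I_def J_def)
    show "continuous_on (I \<times> J) (\<lambda>(x, y). H x y)" using C3 by (rule C_k_on_continuous)
    fix x y assume xy: "x \<in> I" "y \<in> J"
    show "\<bar>Hx x y\<bar> \<le> K \<and> \<bar>Hy x y\<bar> \<le> K \<and> \<bar>Hxx x y\<bar> \<le> K \<and> \<bar>Hxy x y\<bar> \<le> K \<and> \<bar>Hyy x y\<bar> \<le> K"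
      using bnd[OF xy] Kge(2) by auto
    have "Bx * (\<sigma> * Hx x y) \<le> K * (\<sigma> * Hx x y)" "By * (\<tau> * Hy x y) \<le> K * (\<tau> * Hy x y)"
      using Kge posx[OF xy] posy[OF xy] by (auto intro!: mult_right_mono)
    with sx(3)[OF xy] sy(3)[OF xy] show "1 \<le> K * (\<sigma> * Hx x y) \<and> 1 \<le> K * (\<tau> * Hy x y)" by linarith
  next
    fix x x' y assume "x \<in> I" "x' \<in> I" "y \<in> J" "\<sigma> * x \<le> \<sigma> * x'"
    then show "H x y \<le> H x' y"
      using d1(3) posx sx(1) unfolding I_def
      by (intro mono_from_signed_derivative[of i0 i1 "\<lambda>t. H t y" "\<lambda>t. Hx t y" \<sigma>]) (auto intro: less_imp_le)
  next
    fix x y y' assume "x \<in> I" "y \<in> J" "y' \<in> J" "\<tau> * y \<le> \<tau> * y'"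
    then show "H x y \<le> H x y'"
      using d1(4) posy sy(1) unfolding J_def
      by (intro mono_from_signed_derivative[of j0 j1 "\<lambda>t. H x t" "\<lambda>t. Hy x t" \<tau>]) (auto intro: less_imp_le)
  next
    fix x x' y y' assume xy: "x \<in> I" "x' \<in> I" "y \<in> J" "y' \<in> J"
    note le = order_trans[OF _ mult_right_mono]
    show "\<bar>H x' y' - H x y\<bar> \<le> K * (\<bar>x' - x\<bar> + \<bar>y' - y\<bar>)"
      by (rule le[OF t0[OF xy] Kge(6)]) simp
    show "\<bar>H x' y' - H x y - Hx x y * (x' - x) - Hy x y * (y' - y)\<bar> \<le> K * (\<bar>x' - x\<bar> + \<bar>y' - y\<bar>)\<^sup>2"
      by (rule le[OF t1[OF xy] Kge(5)]) simp
    show "\<bar>H x' y' - H x y - Hx x y * (x' - x) - Hy x y * (y' - y)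
        - (Hxx x y * (x' - x)\<^sup>2 + 2 * Hxy x y * (x' - x) * (y' - y) + Hyy x y * (y' - y)\<^sup>2) / 2\<bar>
      \<le> K * (\<bar>x' - x\<bar> + \<bar>y' - y\<bar>) ^ 3"
      by (rule le[OF taylor[OF xy] Kge(2)]) simp
  qed (use ij sx sy Kge in auto)
  then show ?thesis unfolding Hxx_def Hxy_def Hyy_def Hx_def Hy_def by blast
qed

section \<open>Test functions for necessity\<close>

text \<open>Away from the origin every error of lower order is absorbed into a cubic one.\<close>

lemma power_le_cube_div:
  fixes c t :: real
  assumes "0 < c" "c \<le> 1" "c \<le> t" "k \<le> 3"
  shows "t ^ k \<le> t ^ 3 / c ^ 3"
proof -
  have "t ^ k * c ^ 3 \<le> t ^ k * c ^ (3 - k)"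
    using assms by (intro mult_left_mono power_decreasing) auto
  also have "\<dots> \<le> t ^ k * t ^ (3 - k)"
    using assms by (intro mult_left_mono power_mono) auto
  also have "\<dots> = t ^ 3" using assms(4) by (simp flip: power_add)
  finally show ?thesis using assms(1) by (simp add: field_simps)
qed

lemma cube_sum_ge:
  fixes s t :: real
  assumes "0 \<le> s" "0 \<le> t"
  shows "s ^ 3 \<le> (s + t) ^ 3" "t ^ 3 \<le> (s + t) ^ 3" "s * t\<^sup>2 + t * s\<^sup>2 \<le> (s + t) ^ 3"
proof -
  have "(s + t) ^ 3 = s ^ 3 + t ^ 3 + 3 * (s * t\<^sup>2 + t * s\<^sup>2)"
    by (simp add: power3_eq_cube power2_eq_square algebra_simps)
  moreover have "0 \<le> s * t\<^sup>2" "0 \<le> t * s\<^sup>2" "0 \<le> s ^ 3" "0 \<le> t ^ 3" using assms by auto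
  ultimately show "s ^ 3 \<le> (s + t) ^ 3" "t ^ 3 \<le> (s + t) ^ 3" "s * t\<^sup>2 + t * s\<^sup>2 \<le> (s + t) ^ 3"
    by (simp_all add: algebra_simps)
qed

text \<open>The form \<open>\<kappa> (a s + b t)\<^sup>2\<close> minus the left-hand side has diagonal coefficients
\<open>m\<close> and off-diagonal coefficient \<open>\<kappa> a b - B\<close>; it dominates \<open>\<eta> (s\<^sup>2 +
t\<^sup>2)\<close> because \<open>m - \<eta>\<close> is the absolute value of the latter. For given
\<open>\<kappa>\<close> and \<open>B\<close> this is, up to \<open>\<eta>\<close>, the choice with the largest trace.\<close>

lemma quadratic_form_le:
  fixes a b \<kappa> B m s t :: real
  assumes "m = \<bar>B - \<kappa> * a * b\<bar> + \<eta>"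
  shows "(\<kappa> * a\<^sup>2 - m) * s\<^sup>2 + 2 * B * s * t + (\<kappa> * b\<^sup>2 - m) * t\<^sup>2
    \<le> \<kappa> * (a * s + b * t)\<^sup>2 - \<eta> * (s\<^sup>2 + t\<^sup>2)"
proof -
  have "2 * (B - \<kappa> * a * b) * (s * t) \<le> \<bar>B - \<kappa> * a * b\<bar> * (s\<^sup>2 + t\<^sup>2)"
  proof -
    have "2 * \<bar>s * t\<bar> \<le> s\<^sup>2 + t\<^sup>2"
      using sum_squares_bound[of "\<bar>s\<bar>" "\<bar>t\<bar>"] by (simp add: abs_mult)
    then have "\<bar>B - \<kappa> * a * b\<bar> * (2 * \<bar>s * t\<bar>) \<le> \<bar>B - \<kappa> * a * b\<bar> * (s\<^sup>2 + t\<^sup>2)"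
      by (rule mult_left_mono) simp
    moreover have "(B - \<kappa> * a * b) * (s * t) \<le> \<bar>B - \<kappa> * a * b\<bar> * \<bar>s * t\<bar>" by (metis abs_ge_self abs_mult)
    ultimately show ?thesis by linarith
  qed
  then show ?thesis unfolding assms by (simp add: algebra_simps power2_eq_square)
qed

context smooth_rectangle
begin

text \<open>Second-order expansion of \<open>H\<close> along the polynomial curves that the test functions follow near \<open>(p,
r)\<close>.\<close>

lemma near_bound:
  assumes pr: "p \<in> {i0..i1}" "r \<in> {j0..j1}" "p + P \<in> {i0..i1}" "r + R \<in> {j0..j1}"
    and P: "P = s1 * s + k1 * s\<^sup>2 / 2" and R: "R = s2 * t + k2 * t\<^sup>2 / 2"
    and st: "\<bar>s\<bar> \<le> 1" "\<bar>t\<bar> \<le> 1" and K1: "K1 = \<bar>s1\<bar> + \<bar>k1\<bar> + \<bar>s2\<bar> + \<bar>k2\<bar>"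
  shows "\<bar>H (p + P) (r + R) - H p r - (Hx p r * s1 * s + Hy p r * s2 * t)
    - ((Hx p r * k1 + Hxx p r * s1\<^sup>2) * s\<^sup>2 + 2 * (Hxy p r * s1 * s2) * s * t + (Hy p r * k2 + Hyy p r * s2\<^sup>2) * t\<^sup>2) / 2\<bar>
    \<le> (K * K1 ^ 3 + 3 * K * K1\<^sup>2) * (\<bar>s\<bar> + \<bar>t\<bar>) ^ 3"
proof -
  define w where "w = \<bar>s\<bar> + \<bar>t\<bar>"
  have w0: "0 \<le> w" by (simp add: w_def)
  have K0: "0 \<le> K" using K_ge_1 by simp
  have K10: "0 \<le> K1" by (simp add: K1)
  have small: "\<bar>c1 * u + c2 * u\<^sup>2 / 2\<bar> \<le> K1 * \<bar>u\<bar>" "\<bar>c2 * u\<^sup>2 / 2\<bar> \<le> K1 * u\<^sup>2 / 2"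
    if "\<bar>c1\<bar> + \<bar>c2\<bar> \<le> K1" "\<bar>u\<bar> \<le> 1" for c1 c2 u :: real
  proof -
    have u2: "u\<^sup>2 \<le> \<bar>u\<bar>" using that(2) mult_right_le_one_le[of "\<bar>u\<bar>" "\<bar>u\<bar>"] by (simp add: power2_eq_square)
    have "\<bar>c2 * u\<^sup>2 / 2\<bar> \<le> \<bar>c2\<bar> * u\<^sup>2" by (simp add: abs_mult)
    also have "\<dots> \<le> \<bar>c2\<bar> * \<bar>u\<bar>" using u2 by (rule mult_left_mono) simp
    finally have "\<bar>c1 * u + c2 * u\<^sup>2 / 2\<bar> \<le> (\<bar>c1\<bar> + \<bar>c2\<bar>) * \<bar>u\<bar>"
      using abs_triangle_ineq[of "c1 * u" "c2 * u\<^sup>2 / 2"] by (simp add: abs_mult distrib_right)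
    also have "\<dots> \<le> K1 * \<bar>u\<bar>" using that(1) by (rule mult_right_mono) simp
    finally show "\<bar>c1 * u + c2 * u\<^sup>2 / 2\<bar> \<le> K1 * \<bar>u\<bar>" .
    have "\<bar>c2\<bar> * u\<^sup>2 \<le> K1 * u\<^sup>2" using that(1) by (intro mult_right_mono) auto
    then show "\<bar>c2 * u\<^sup>2 / 2\<bar> \<le> K1 * u\<^sup>2 / 2" by (simp add: abs_mult)
  qed
  have Pb: "\<bar>P\<bar> \<le> K1 * \<bar>s\<bar>" "\<bar>P - s1 * s\<bar> \<le> K1 * s\<^sup>2 / 2"
    and Rb: "\<bar>R\<bar> \<le> K1 * \<bar>t\<bar>" "\<bar>R - s2 * t\<bar> \<le> K1 * t\<^sup>2 / 2"
    using small(1)[of s1 k1 s] small(2)[of s1 k1 s] small(1)[of s2 k2 t] small(2)[of s2 k2 t] st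
    unfolding P R by (auto simp: K1)
  have lin: "\<bar>s1 * s\<bar> \<le> K1 * \<bar>s\<bar>" "\<bar>s2 * t\<bar> \<le> K1 * \<bar>t\<bar>"
    unfolding abs_mult K1 by (auto intro!: mult_right_mono)
  have sq: "\<bar>U\<^sup>2 - V\<^sup>2\<bar> \<le> K1\<^sup>2 * \<bar>u\<bar> ^ 3"
    if "\<bar>U\<bar> \<le> K1 * \<bar>u\<bar>" "\<bar>V\<bar> \<le> K1 * \<bar>u\<bar>" "\<bar>U - V\<bar> \<le> K1 * u\<^sup>2 / 2" for U V u :: real
  proof -
    have "\<bar>U\<^sup>2 - V\<^sup>2\<bar> = \<bar>U - V\<bar> * \<bar>U + V\<bar>" by (simp add: power2_eq_square algebra_simps flip: abs_mult)
    also have "\<dots> \<le> (K1 * u\<^sup>2 / 2) * (2 * K1 * \<bar>u\<bar>)" using that K10 by (intro mult_mono) auto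
    also have "\<dots> = K1\<^sup>2 * (\<bar>u\<bar>\<^sup>2 * \<bar>u\<bar>)" by (simp add: power2_eq_square)
    also have "\<bar>u\<bar>\<^sup>2 * \<bar>u\<bar> = \<bar>u\<bar> ^ 3" by (simp only: power3_eq_cube power2_eq_square)
    finally show ?thesis .
  qed
  have w3: "\<bar>s\<bar> ^ 3 \<le> w ^ 3" "\<bar>t\<bar> ^ 3 \<le> w ^ 3" "\<bar>s\<bar> * t\<^sup>2 + \<bar>t\<bar> * s\<^sup>2 \<le> w ^ 3"
    using cube_sum_ge[of "\<bar>s\<bar>" "\<bar>t\<bar>"] by (simp_all add: w_def)
  have K12: "0 \<le> K1\<^sup>2" by simp
  have q1: "\<bar>P\<^sup>2 - (s1 * s)\<^sup>2\<bar> \<le> K1\<^sup>2 * w ^ 3"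
    by (rule order_trans[OF sq[OF Pb(1) lin(1) Pb(2)] mult_left_mono[OF w3(1) K12]])
  have q2: "\<bar>R\<^sup>2 - (s2 * t)\<^sup>2\<bar> \<le> K1\<^sup>2 * w ^ 3"
    by (rule order_trans[OF sq[OF Rb(1) lin(2) Rb(2)] mult_left_mono[OF w3(2) K12]])
  have q3: "\<bar>P * R - (s1 * s) * (s2 * t)\<bar> \<le> K1\<^sup>2 * w ^ 3"
  proof -
    have "P * R - (s1 * s) * (s2 * t) = P * (R - s2 * t) + (s2 * t) * (P - s1 * s)" by (simp add: algebra_simps)
    then have "\<bar>P * R - (s1 * s) * (s2 * t)\<bar> \<le> \<bar>P\<bar> * \<bar>R - s2 * t\<bar> + \<bar>s2 * t\<bar> * \<bar>P - s1 * s\<bar>"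
      using abs_triangle_ineq[of "P * (R - s2 * t)" "(s2 * t) * (P - s1 * s)"] by (simp only: abs_mult)
    also have "\<dots> \<le> (K1 * \<bar>s\<bar>) * (K1 * t\<^sup>2 / 2) + (K1 * \<bar>t\<bar>) * (K1 * s\<^sup>2 / 2)"
      using Pb Rb lin K10 by (intro add_mono mult_mono) auto
    also have "\<dots> = K1\<^sup>2 * ((\<bar>s\<bar> * t\<^sup>2 + \<bar>t\<bar> * s\<^sup>2) / 2)" by (simp add: power2_eq_square algebra_simps)
    also have "\<dots> \<le> K1\<^sup>2 * w ^ 3"
    proof (rule mult_left_mono[OF _ K12])
      have half: "x / 2 \<le> y" if "x \<le> y" "0 \<le> y" for x y :: real using that by linarith
      show "(\<bar>s\<bar> * t\<^sup>2 + \<bar>t\<bar> * s\<^sup>2) / 2 \<le> w ^ 3" by (rule half[OF w3(3)]) (use w0 in simp)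
    qed
    finally show ?thesis .
  qed
  note b = bounds[OF pr(1,2)]
  have mK: "\<bar>c * x\<bar> \<le> K * (K1\<^sup>2 * w ^ 3)" if "\<bar>c\<bar> \<le> K" "\<bar>x\<bar> \<le> K1\<^sup>2 * w ^ 3" for c x
    unfolding abs_mult using that K0 by (intro mult_mono) auto
  have e: "\<bar>Hxx p r * (P\<^sup>2 - (s1 * s)\<^sup>2)\<bar> \<le> K * (K1\<^sup>2 * w ^ 3)" "\<bar>Hyy p r * (R\<^sup>2 - (s2 * t)\<^sup>2)\<bar> \<le> K * (K1\<^sup>2 * w ^ 3)"
    "\<bar>Hxy p r * (P * R - (s1 * s) * (s2 * t))\<bar> \<le> K * (K1\<^sup>2 * w ^ 3)"
    using b q1 q2 q3 by (auto intro!: mK)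
  have "(\<bar>P\<bar> + \<bar>R\<bar>) ^ 3 \<le> (K1 * w) ^ 3" using Pb Rb by (intro power_mono) (auto simp: w_def distrib_left)
  then have "K * (\<bar>P\<bar> + \<bar>R\<bar>) ^ 3 \<le> K * K1 ^ 3 * w ^ 3" using K0 by (simp add: power_mult_distrib mult.assoc mult_left_mono)
  moreover have "\<bar>H (p + P) (r + R) - H p r - Hx p r * P - Hy p r * R
        - (Hxx p r * P\<^sup>2 + 2 * Hxy p r * P * R + Hyy p r * R\<^sup>2) / 2\<bar> \<le> K * (\<bar>P\<bar> + \<bar>R\<bar>) ^ 3"
    using taylor2[OF pr(1,3,2,4)] by simp
  moreover have "H (p + P) (r + R) - H p r - (Hx p r * s1 * s + Hy p r * s2 * t)
    - ((Hx p r * k1 + Hxx p r * s1\<^sup>2) * s\<^sup>2 + 2 * (Hxy p r * s1 * s2) * s * t + (Hy p r * k2 + Hyy p r * s2\<^sup>2) * t\<^sup>2) / 2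
    = (H (p + P) (r + R) - H p r - Hx p r * P - Hy p r * R - (Hxx p r * P\<^sup>2 + 2 * Hxy p r * P * R + Hyy p r * R\<^sup>2) / 2)
     + (Hxx p r * (P\<^sup>2 - (s1 * s)\<^sup>2) / 2 + Hyy p r * (R\<^sup>2 - (s2 * t)\<^sup>2) / 2 + Hxy p r * (P * R - (s1 * s) * (s2 * t)))"
    unfolding P R by (simp add: field_simps power2_eq_square)
  moreover have "0 \<le> K * (K1\<^sup>2 * w ^ 3)" using K0 w0 by simp
  ultimately show ?thesis using e unfolding w_def[symmetric] distrib_right mult.assoc abs_le_iff by linarith
qed

text \<open>The slopes \<open>s1\<close>, \<open>s2\<close> make the linear part of \<open>H (\<phi> s) (\<psi> t)\<close> a
function of \<open>z = a s + b t\<close>, which is needed for the supremum along a line to be of the right order. The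
curvatures \<open>k1\<close>, \<open>k2\<close> make the quadratic part at most \<open>\<kappa> z\<^sup>2 - \<eta>
(s\<^sup>2 + t\<^sup>2)\<close>, and the margin \<open>\<eta>\<close> absorbs the cubic error on a small square.
Outside the square at least one of the two functions takes the value shifted by \<open>d\<close> in the direction that
decreases \<open>H\<close>. The resulting loss \<open>\<theta>\<close> outweighs everything else as long as
\<open>z\<close> is small, and for large \<open>z\<close> the cubic term takes over.\<close>

lemma test_functions:
  fixes a b \<nu> \<kappa> \<eta> :: real
  assumes pr: "p \<in> {i0<..<i1}" "r \<in> {j0<..<j1}" and \<eta>: "0 < \<eta>"
  defines "s1 \<equiv> a * \<nu> / Hx p r" and "s2 \<equiv> b * \<nu> / Hy p r"
  defines "m \<equiv> \<bar>Hxy p r * s1 * s2 - \<kappa> * a * b\<bar> + \<eta>"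
  defines "k1 \<equiv> (\<kappa> * a\<^sup>2 - m - Hxx p r * s1\<^sup>2) / Hx p r" and "k2 \<equiv> (\<kappa> * b\<^sup>2 - m - Hyy p r * s2\<^sup>2) / Hy p r"
  shows "\<exists>\<phi> \<psi> L. \<phi> \<in> borel_measurable borel \<and> \<psi> \<in> borel_measurable borel \<and> 0 \<le> L \<and>
    (\<forall>t. \<phi> t \<in> {i0..i1}) \<and> (\<forall>t. \<psi> t \<in> {j0..j1}) \<and>
    (\<forall>t. \<bar>\<phi> t - p - s1 * t - k1 * t\<^sup>2 / 2\<bar> \<le> L * \<bar>t\<bar> ^ 3) \<and>
    (\<forall>t. \<bar>\<psi> t - r - s2 * t - k2 * t\<^sup>2 / 2\<bar> \<le> L * \<bar>t\<bar> ^ 3) \<and>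
    (\<forall>s t. H (\<phi> s) (\<psi> t) \<le> H p r + \<nu> * (a * s + b * t) + \<kappa> * (a * s + b * t)\<^sup>2 / 2 + L * \<bar>a * s + b * t\<bar> ^ 3)"
proof -
  have pr': "p \<in> {i0..i1}" "r \<in> {j0..j1}" using pr by auto
  have K0: "0 < K" using K_ge_1 by simp
  note az = away_from_0[OF pr']
  have Hnz: "Hx p r \<noteq> 0" "Hy p r \<noteq> 0" using az by auto
  define K1 where "K1 = \<bar>s1\<bar> + \<bar>k1\<bar> + \<bar>s2\<bar> + \<bar>k2\<bar>"
  have K10: "0 \<le> K1" by (simp add: K1_def)
  define C2 where "C2 = K * K1 ^ 3 + 3 * K * K1\<^sup>2"
  have C20: "0 \<le> C2" using K0 K10 by (simp add: C2_def)
  define d where "d = Min {p - i0, i1 - p, r - j0, j1 - r, 1 / (16 * K\<^sup>2)}"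
  have d: "0 < d" "d \<le> p - i0" "d \<le> i1 - p" "d \<le> r - j0" "d \<le> j1 - r" "d \<le> 1 / (16 * K\<^sup>2)"
    using pr K0 by (auto simp: d_def)
  define c where "c = Min {1, d / (4 * K\<^sup>2 * (K1 + 1)), \<eta> / (8 * C2 + 1)}"
  have c: "0 < c" "c \<le> 1" "c \<le> d / (4 * K\<^sup>2 * (K1 + 1))" "c \<le> \<eta> / (8 * C2 + 1)"
    using d K0 K10 C20 \<eta> by (auto simp: c_def)
  have "c * (4 * K\<^sup>2 * (K1 + 1)) \<le> d" using c(3) K0 K10 by (simp add: pos_le_divide_eq)
  then have "4 * K\<^sup>2 * (K1 * c) + 4 * K\<^sup>2 * c \<le> d" by (simp add: algebra_simps)
  moreover have "0 \<le> 4 * K\<^sup>2 * c" using c by simp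
  ultimately have Kc: "4 * K\<^sup>2 * (K1 * c) \<le> d" by linarith
  have K1c0: "0 \<le> K1 * c" using K10 c by simp
  have "1 * (K1 * c) \<le> 4 * K\<^sup>2 * (K1 * c)"
    using K1c0 one_le_power[OF K_ge_1, of 2] by (intro mult_right_mono) auto
  with Kc have K1cd: "K1 * c \<le> d" by linarith
  define \<phi> where "\<phi> t = p + (if \<bar>t\<bar> \<le> c then s1 * t + k1 * t\<^sup>2 / 2 else - (\<sigma> * d))" for t
  define \<psi> where "\<psi> t = r + (if \<bar>t\<bar> \<le> c then s2 * t + k2 * t\<^sup>2 / 2 else - (\<tau> * d))" for t
  have near: "\<bar>c1 * t + c2 * t\<^sup>2 / 2\<bar> \<le> K1 * c" if "\<bar>c1\<bar> + \<bar>c2\<bar> \<le> K1" "\<bar>t\<bar> \<le> c" for c1 c2 t :: real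
  proof -
    have "t\<^sup>2 \<le> \<bar>t\<bar>" using that(2) c(2) mult_right_le_one_le[of "\<bar>t\<bar>" "\<bar>t\<bar>"] by (simp add: power2_eq_square)
    then have "t\<^sup>2 \<le> c" using that by linarith
    then have "\<bar>c2\<bar> * t\<^sup>2 \<le> \<bar>c2\<bar> * c" "\<bar>c1\<bar> * \<bar>t\<bar> \<le> \<bar>c1\<bar> * c" using that by (auto intro!: mult_left_mono)
    moreover have "\<bar>c1 * t + c2 * t\<^sup>2 / 2\<bar> \<le> \<bar>c1\<bar> * \<bar>t\<bar> + \<bar>c2\<bar> * t\<^sup>2"
    proof -
      have "\<bar>c1 * t + c2 * t\<^sup>2 / 2\<bar> \<le> \<bar>c1 * t\<bar> + \<bar>c2 * t\<^sup>2 / 2\<bar>" by (rule abs_triangle_ineq)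
      moreover have "\<bar>c2 * t\<^sup>2 / 2\<bar> \<le> \<bar>c2\<bar> * t\<^sup>2" by (simp add: abs_mult)
      moreover have "\<bar>c1 * t\<bar> = \<bar>c1\<bar> * \<bar>t\<bar>" by (rule abs_mult)
      ultimately show ?thesis by linarith
    qed
    moreover have "(\<bar>c1\<bar> + \<bar>c2\<bar>) * c \<le> K1 * c" using that(1) c(1) by (intro mult_right_mono) auto
    ultimately show ?thesis by (simp add: distrib_right)
  qed
  have n1: "\<bar>s1 * t + k1 * t\<^sup>2 / 2\<bar> \<le> K1 * c" and n2: "\<bar>s2 * t + k2 * t\<^sup>2 / 2\<bar> \<le> K1 * c" if "\<bar>t\<bar> \<le> c" for t
    using near[OF _ that, of s1 k1] near[OF _ that, of s2 k2] by (simp_all add: K1_def)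
  have st: "\<bar>\<sigma>\<bar> = 1" "\<bar>\<tau>\<bar> = 1" using sgn_cases by auto
  have dist: "\<bar>\<phi> t - p\<bar> \<le> d" "\<bar>\<psi> t - r\<bar> \<le> d" for t
    using n1[of t] n2[of t] K1cd d(1) st by (auto simp: \<phi>_def \<psi>_def abs_mult)
  have range: "\<phi> t \<in> {i0..i1}" "\<psi> t \<in> {j0..j1}" for t
    using dist[of t] d by (auto simp: abs_le_iff)
  define \<theta> where "\<theta> = d / (2 * K)"
  have \<theta>0: "0 < \<theta>" using d K0 by (simp add: \<theta>_def)
  \<comment> \<open>Off the small square the first-order loss from the shift by \<open>d\<close> dominates the gain
    \<open>K * (K1 * c)\<close> of the other variable and the quadratic error \<open>K * (2 * d)\<^sup>2\<close>.\<close>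
  have far: "H (\<phi> s) (\<psi> t) \<le> H p r - \<theta>" if st': "\<not> (\<bar>s\<bar> \<le> c \<and> \<bar>t\<bar> \<le> c)" for s t
  proof -
    define P where "P = \<phi> s - p"
    define R where "R = \<psi> t - r"
    have P: "\<bar>P\<bar> \<le> d" "\<bar>R\<bar> \<le> d" using dist by (auto simp: P_def R_def)
    have H: "H (\<phi> s) (\<psi> t) \<le> H p r + Hx p r * P + Hy p r * R + K * (2 * d)\<^sup>2"
    proof -
      have "K * (\<bar>P\<bar> + \<bar>R\<bar>)\<^sup>2 \<le> K * (2 * d)\<^sup>2" using P K0 by (intro mult_left_mono power_mono) auto
      then show ?thesis
        using taylor1[OF pr'(1) range(1)[of s] pr'(2) range(2)[of t]] unfolding P_def[symmetric] R_def[symmetric]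
        by linarith
    qed
    have "K * (2 * d)\<^sup>2 = 4 * K * d * d" by (simp add: power2_eq_square)
    also have "\<dots> \<le> 4 * K * d * (1 / (16 * K\<^sup>2))" using d K0 by (intro mult_left_mono) auto
    also have "\<dots> = d / (4 * K)" using K0 by (simp add: power2_eq_square)
    finally have sq: "K * (2 * d)\<^sup>2 \<le> d / (4 * K)" .
    have down: "G * (- (u * d)) \<le> - (d / K)" if "1 \<le> K * (u * G)" for G u :: real
    proof -
      have "d * 1 \<le> d * (K * (u * G))" using that d by (intro mult_left_mono) auto
      then show ?thesis using K0 by (simp add: field_simps)
    qed
    have small: "G * x \<le> d / (4 * K)" if "\<bar>G\<bar> \<le> K" "\<bar>x\<bar> \<le> K1 * c" for G x :: real
    proof -
      have "G * x \<le> \<bar>G\<bar> * \<bar>x\<bar>" by (metis abs_ge_self abs_mult)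
      also have "\<dots> \<le> K * (K1 * c)" using that K0 by (intro mult_mono) auto
      also have "\<dots> \<le> d / (4 * K)" using Kc K0 by (simp add: field_simps power2_eq_square)
      finally show ?thesis .
    qed
    have dK: "0 < d / K" using d K0 by simp
    have X: "Hx p r * P \<le> (if \<bar>s\<bar> \<le> c then d / (4 * K) else - (d / K))"
      using down[of \<sigma> "Hx p r"] small[of "Hx p r" P] bounds[OF pr'] az n1[of s] by (auto simp: P_def \<phi>_def)
    have Y: "Hy p r * R \<le> (if \<bar>t\<bar> \<le> c then d / (4 * K) else - (d / K))"
      using down[of \<tau> "Hy p r"] small[of "Hy p r" R] bounds[OF pr'] az n2[of t] by (auto simp: R_def \<psi>_def)
    have "d / (4 * K) = (d / K) / 4" "\<theta> = (d / K) / 2" by (simp_all add: \<theta>_def)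
    then show ?thesis using H X Y sq st' dK by (auto split: if_splits)
  qed
  define c' where "c' = min 1 (\<theta> / (\<bar>\<nu>\<bar> + \<bar>\<kappa>\<bar> + 1))"
  have c': "0 < c'" "c' \<le> 1" using \<theta>0 by (auto simp: c'_def)
  define L where "L = (\<bar>\<nu>\<bar> + \<bar>\<kappa>\<bar>) / c' ^ 3 + (d + K1) / c ^ 3"
  have La: "0 \<le> (\<bar>\<nu>\<bar> + \<bar>\<kappa>\<bar>) / c' ^ 3" and Lb: "0 \<le> (d + K1) / c ^ 3" using c' c d K10 by simp_all
  have L0: "0 \<le> L" using La Lb by (simp add: L_def)
  \<comment> \<open>The bounding polynomial stays above \<open>- \<theta>\<close>: for small \<open>z\<close> by continuity, for large
    \<open>z\<close> because of its cubic term.\<close>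
  have lower: "- \<theta> \<le> \<nu> * z + \<kappa> * z\<^sup>2 / 2 + L * \<bar>z\<bar> ^ 3" for z
  proof -
    have ab: "\<bar>\<nu> * z + \<kappa> * z\<^sup>2 / 2\<bar> \<le> \<bar>\<nu>\<bar> * \<bar>z\<bar> + \<bar>\<kappa>\<bar> * \<bar>z\<bar>\<^sup>2"
    proof -
      have "\<bar>\<nu> * z + \<kappa> * z\<^sup>2 / 2\<bar> \<le> \<bar>\<nu> * z\<bar> + \<bar>\<kappa> * z\<^sup>2 / 2\<bar>" by (rule abs_triangle_ineq)
      moreover have "\<bar>\<kappa> * z\<^sup>2 / 2\<bar> \<le> \<bar>\<kappa>\<bar> * \<bar>z\<bar>\<^sup>2" by (simp add: abs_mult)
      moreover have "\<bar>\<nu> * z\<bar> = \<bar>\<nu>\<bar> * \<bar>z\<bar>" by (rule abs_mult)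
      ultimately show ?thesis by linarith
    qed
    show ?thesis
    proof (cases "\<bar>z\<bar> \<le> c'")
      case True
      have "\<bar>z\<bar>\<^sup>2 \<le> \<bar>z\<bar>" using True c'(2) mult_right_le_one_le[of "\<bar>z\<bar>" "\<bar>z\<bar>"] by (simp add: power2_eq_square)
      then have "\<bar>\<kappa>\<bar> * \<bar>z\<bar>\<^sup>2 \<le> \<bar>\<kappa>\<bar> * c'" "\<bar>\<nu>\<bar> * \<bar>z\<bar> \<le> \<bar>\<nu>\<bar> * c'" using True by (auto intro!: mult_left_mono)
      moreover have "(\<bar>\<nu>\<bar> + \<bar>\<kappa>\<bar> + 1) * c' \<le> \<theta>"
      proof -
        have "c' \<le> \<theta> / (\<bar>\<nu>\<bar> + \<bar>\<kappa>\<bar> + 1)" by (simp add: c'_def)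
        then show ?thesis by (simp add: field_simps)
      qed
      moreover have "0 \<le> L * \<bar>z\<bar> ^ 3" using L0 by simp
      ultimately show ?thesis using ab c' unfolding distrib_right by linarith
    next
      case False
      then have "\<bar>z\<bar> ^ 1 \<le> \<bar>z\<bar> ^ 3 / c' ^ 3" "\<bar>z\<bar> ^ 2 \<le> \<bar>z\<bar> ^ 3 / c' ^ 3"
        using c' by (intro power_le_cube_div; simp)+
      then have "\<bar>\<nu>\<bar> * \<bar>z\<bar> \<le> \<bar>\<nu>\<bar> * (\<bar>z\<bar> ^ 3 / c' ^ 3)" "\<bar>\<kappa>\<bar> * \<bar>z\<bar>\<^sup>2 \<le> \<bar>\<kappa>\<bar> * (\<bar>z\<bar> ^ 3 / c' ^ 3)"
        by (intro mult_left_mono; simp)+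
      then have "\<bar>\<nu>\<bar> * \<bar>z\<bar> + \<bar>\<kappa>\<bar> * \<bar>z\<bar>\<^sup>2 \<le> (\<bar>\<nu>\<bar> + \<bar>\<kappa>\<bar>) / c' ^ 3 * \<bar>z\<bar> ^ 3"
        by (simp add: algebra_simps add_divide_distrib)
      also have "\<dots> \<le> L * \<bar>z\<bar> ^ 3" using Lb by (intro mult_right_mono) (auto simp: L_def)
      finally show ?thesis using ab \<theta>0 by linarith
    qed
  qed
  have appr: "\<bar>v - c1 * t - c2 * t\<^sup>2 / 2\<bar> \<le> L * \<bar>t\<bar> ^ 3"
    if v: "\<bar>v\<bar> \<le> d" "\<bar>t\<bar> \<le> c \<Longrightarrow> v = c1 * t + c2 * t\<^sup>2 / 2" and cc: "\<bar>c1\<bar> + \<bar>c2\<bar> \<le> K1" for v c1 c2 t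
  proof (cases "\<bar>t\<bar> \<le> c")
    case True
    then show ?thesis using v L0 by simp
  next
    case False
    then have pw: "\<bar>t\<bar> ^ 0 \<le> \<bar>t\<bar> ^ 3 / c ^ 3" "\<bar>t\<bar> ^ 1 \<le> \<bar>t\<bar> ^ 3 / c ^ 3" "\<bar>t\<bar> ^ 2 \<le> \<bar>t\<bar> ^ 3 / c ^ 3"
      using c by (intro power_le_cube_div; simp)+
    let ?w = "\<bar>t\<bar> ^ 3 / c ^ 3"
    have "\<bar>v - c1 * t - c2 * t\<^sup>2 / 2\<bar> \<le> \<bar>v\<bar> + \<bar>c1 * t\<bar> + \<bar>c2 * t\<^sup>2 / 2\<bar>" by linarith
    also have "\<dots> \<le> d * \<bar>t\<bar> ^ 0 + \<bar>c1\<bar> * \<bar>t\<bar> ^ 1 + \<bar>c2\<bar> * \<bar>t\<bar> ^ 2"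
      using v(1) by (simp add: abs_mult add_mono)
    also have "\<dots> \<le> d * ?w + \<bar>c1\<bar> * ?w + \<bar>c2\<bar> * ?w"
      using pw d by (intro add_mono mult_left_mono) auto
    also have "\<dots> = (d + (\<bar>c1\<bar> + \<bar>c2\<bar>)) * ?w" by (simp only: distrib_right add.assoc)
    also have "\<dots> \<le> (d + K1) * ?w" using cc c by (intro mult_right_mono) auto
    also have "\<dots> = (d + K1) / c ^ 3 * \<bar>t\<bar> ^ 3" by simp
    also have "\<dots> \<le> L * \<bar>t\<bar> ^ 3" using La by (intro mult_right_mono) (auto simp: L_def)
    finally show ?thesis .
  qed
  have ap1: "\<bar>\<phi> t - p - s1 * t - k1 * t\<^sup>2 / 2\<bar> \<le> L * \<bar>t\<bar> ^ 3" and ap2: "\<bar>\<psi> t - r - s2 * t - k2 * t\<^sup>2 / 2\<bar> \<le> L * \<bar>t\<bar> ^ 3" for t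
    by (rule appr; use dist[of t] in \<open>simp add: \<phi>_def \<psi>_def K1_def\<close>)+
  have main: "H (\<phi> s) (\<psi> t) \<le> H p r + \<nu> * (a * s + b * t) + \<kappa> * (a * s + b * t)\<^sup>2 / 2 + L * \<bar>a * s + b * t\<bar> ^ 3" for s t
  proof (cases "\<bar>s\<bar> \<le> c \<and> \<bar>t\<bar> \<le> c")
    case False
    then show ?thesis using far[OF False] lower[of "a * s + b * t"] by linarith
  next
    case True
    define z where "z = a * s + b * t"
    define P where "P = s1 * s + k1 * s\<^sup>2 / 2"
    define R where "R = s2 * t + k2 * t\<^sup>2 / 2"
    define w where "w = \<bar>s\<bar> + \<bar>t\<bar>"
    have PR: "\<phi> s = p + P" "\<psi> t = r + R" using True by (auto simp: \<phi>_def \<psi>_def P_def R_def)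
    have nb: "\<bar>H (p + P) (r + R) - H p r - (Hx p r * s1 * s + Hy p r * s2 * t)
      - ((Hx p r * k1 + Hxx p r * s1\<^sup>2) * s\<^sup>2 + 2 * (Hxy p r * s1 * s2) * s * t + (Hy p r * k2 + Hyy p r * s2\<^sup>2) * t\<^sup>2) / 2\<bar>
      \<le> C2 * w ^ 3"
      unfolding C2_def w_def
      by (rule near_bound) (use pr' range(1)[of s] range(2)[of t] True c in \<open>auto simp: PR P_def R_def K1_def\<close>)
    have e1: "Hx p r * s1 * s + Hy p r * s2 * t = \<nu> * z" using Hnz by (simp add: s1_def s2_def z_def algebra_simps)
    have e2: "Hx p r * k1 + Hxx p r * s1\<^sup>2 = \<kappa> * a\<^sup>2 - m" "Hy p r * k2 + Hyy p r * s2\<^sup>2 = \<kappa> * b\<^sup>2 - m"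
      using Hnz by (simp_all add: k1_def k2_def)
    define X where "X = (\<kappa> * a\<^sup>2 - m) * s\<^sup>2 + 2 * (Hxy p r * s1 * s2) * s * t + (\<kappa> * b\<^sup>2 - m) * t\<^sup>2"
    have "X \<le> \<kappa> * z\<^sup>2 - \<eta> * (s\<^sup>2 + t\<^sup>2)"
      unfolding X_def z_def by (rule quadratic_form_le) (simp add: m_def)
    moreover have "C2 * w ^ 3 \<le> \<eta> * (s\<^sup>2 + t\<^sup>2) / 2"
    proof -
      have w: "0 \<le> w" "w \<le> 2 * c" using True by (auto simp: w_def)
      have w2: "w\<^sup>2 \<le> 2 * (s\<^sup>2 + t\<^sup>2)"
        using sum_squares_bound[of "\<bar>s\<bar>" "\<bar>t\<bar>"] by (simp add: w_def power2_sum)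
      have "C2 * w ^ 3 = C2 * w * w\<^sup>2" by (simp add: power3_eq_cube power2_eq_square)
      also have "\<dots> \<le> C2 * (2 * c) * (2 * (s\<^sup>2 + t\<^sup>2))" using w w2 C20 c by (intro mult_mono) auto
      also have "\<dots> = (8 * C2 * c) * (s\<^sup>2 + t\<^sup>2) / 2" by simp
      also have "\<dots> \<le> \<eta> * (s\<^sup>2 + t\<^sup>2) / 2"
      proof -
        have "8 * C2 * c + c \<le> \<eta>" using c(4) C20 by (simp add: field_simps)
        then have "8 * C2 * c \<le> \<eta>" using c by linarith
        then show ?thesis by (intro divide_right_mono mult_right_mono) auto
      qed
      finally show ?thesis .
    qed
    moreover have "0 \<le> L * \<bar>z\<bar> ^ 3" using L0 by simp
    moreover have "H (p + P) (r + R) - H p r - \<nu> * z - X / 2 \<le> C2 * w ^ 3"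
      using nb unfolding e1 e2 X_def abs_le_iff by (rule conjunct1)
    ultimately show ?thesis unfolding PR z_def[symmetric] by linarith
  qed
  have meas: "\<phi> \<in> borel_measurable borel" "\<psi> \<in> borel_measurable borel"
    unfolding \<phi>_def \<psi>_def by measurable
  show ?thesis
    using meas L0 range ap1 ap2 main by (intro exI[of _ \<phi>] exI[of _ \<psi>] exI[of _ L] conjI allI) auto
qed

end

section \<open>Essential suprema along lines\<close>

text \<open>The essential supremum of a bounded section is finite, so nothing is lost by passing from \<open>ereal\<close> to
\<open>real\<close>. It is measurable in \<open>x\<close> because it is at most \<open>c\<close> exactly if \<open>{y.
c < F x y}\<close> has measure zero, and the measure of a section depends measurably on \<open>x\<close>.
Measurability matters: the integral of a function that is not integrable is \<open>0\<close>.\<close>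

lemma esssup_section:
  fixes F :: "'a \<Rightarrow> 'b::euclidean_space \<Rightarrow> real"
  assumes F: "(\<lambda>(x, y). F x y) \<in> borel_measurable (N \<Otimes>\<^sub>M borel)"
    and bd: "\<And>x y. x \<in> space N \<Longrightarrow> F x y \<in> {lo..hi}"
  defines "q \<equiv> \<lambda>x. real_of_ereal (esssup lborel (\<lambda>y. ereal (F x y)))"
  shows "q \<in> borel_measurable N"
    and "\<And>x. x \<in> space N \<Longrightarrow> q x \<in> {lo..hi}"
    and "\<And>x. x \<in> space N \<Longrightarrow> AE y in lborel. F x y \<le> q x"
    and "\<And>x B. x \<in> space N \<Longrightarrow> AE y in lborel. F x y \<le> B \<Longrightarrow> q x \<le> B"
proof -
  have m: "F x \<in> borel_measurable borel" if "x \<in> space N" for x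
    using measurable_compose_Pair1[OF that F] by simp
  have fin: "ereal lo \<le> esssup lborel (\<lambda>y. ereal (F x y)) \<and> (\<forall>B. (AE y in lborel. F x y \<le> B) \<longrightarrow> esssup lborel (\<lambda>y. ereal (F x y)) \<le> ereal B)"
    if x: "x \<in> space N" for x
  proof -
    have *: "(\<lambda>y. ereal (F x y)) \<in> borel_measurable lborel" using m[OF x] by simp
    have "ereal lo = esssup lborel (\<lambda>y::'b. ereal lo)" by (rule esssup_const[symmetric]) simp
    also have "\<dots> \<le> esssup lborel (\<lambda>y. ereal (F x y))" using bd[OF x] by (intro esssup_mono) auto
    finally show ?thesis using * by (auto intro!: esssup_I)
  qed
  have q: "ereal (q x) = esssup lborel (\<lambda>y. ereal (F x y))" if x: "x \<in> space N" for x
  proof -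
    have "esssup lborel (\<lambda>y. ereal (F x y)) \<le> ereal hi" using fin[OF x] bd[OF x] by simp
    then have "\<bar>esssup lborel (\<lambda>y. ereal (F x y))\<bar> \<noteq> \<infinity>"
      using fin[OF x] by (cases "esssup lborel (\<lambda>y. ereal (F x y))") auto
    then show ?thesis unfolding q_def by (simp add: ereal_real)
  qed
  show upper: "\<And>x B. x \<in> space N \<Longrightarrow> AE y in lborel. F x y \<le> B \<Longrightarrow> q x \<le> B"
    using fin q by (metis ereal_less_eq(3))
  show "q x \<in> {lo..hi}" if "x \<in> space N" for x
    using fin[OF that] q[OF that] upper[OF that, of hi] bd[OF that] by (metis atLeastAtMost_iff ereal_less_eq(3) always_eventually)
  show ae: "AE y in lborel. F x y \<le> q x" if "x \<in> space N" for x
    using esssup_AE[of "\<lambda>y. ereal (F x y)" lborel] unfolding q[OF that, symmetric] by simp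
  show "q \<in> borel_measurable N"
    unfolding borel_measurable_iff_le
  proof
    fix c
    have set: "{x \<in> space (N \<Otimes>\<^sub>M lborel). snd x \<in> {y. c < F (fst x) y}} \<in> sets (N \<Otimes>\<^sub>M lborel)"
    proof -
      have "(\<lambda>x. F (fst x) (snd x)) \<in> borel_measurable (N \<Otimes>\<^sub>M lborel)"
        using F by (simp add: case_prod_unfold cong: measurable_cong_sets sets_pair_measure_cong)
      from borel_measurable_less[OF measurable_const this, of c] show ?thesis by simp
    qed
    have "{x \<in> space N. q x \<le> c} = {x \<in> space N. emeasure lborel {y. c < F x y} = 0}"
    proof (intro Collect_cong conj_cong refl)
      fix x assume x: "x \<in> space N"
      have meas: "{y. c < F x y} \<in> sets borel" using m[OF x] by simp
      have "q x \<le> c \<longleftrightarrow> (AE y in lborel. F x y \<le> c)"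
        using upper[OF x] eventually_mono[OF ae[OF x], of "\<lambda>y. F x y \<le> c"] by force
      also have "\<dots> \<longleftrightarrow> emeasure lborel {y. c < F x y} = 0"
        using meas by (subst AE_iff_measurable[OF _ refl]) (simp_all add: not_le)
      finally show "q x \<le> c \<longleftrightarrow> emeasure lborel {y. c < F x y} = 0" .
    qed
    also have "\<dots> \<in> sets N"
      using measurable_sets[OF lborel.measurable_emeasure[OF _ set], of "{0}"] by (simp add: vimage_def Int_def conj_commute)
    finally show "{x \<in> space N. q x \<le> c} \<in> sets N" .
  qed
qed

definition sup_convolution ::
  "real \<Rightarrow> real \<Rightarrow> (real \<Rightarrow> real \<Rightarrow> real) \<Rightarrow> ('b::euclidean_space \<Rightarrow> real) \<Rightarrow> ('b \<Rightarrow> real) \<Rightarrow> 'b \<Rightarrow> real" where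
  "sup_convolution a b H f g x =
     real_of_ereal (esssup lborel (\<lambda>y. ereal (H (f ((1 / a) *\<^sub>R (x - y))) (g ((1 / b) *\<^sub>R y)))))"

context smooth_rectangle
begin

lemma H_measurable:
  assumes [measurable]: "f \<in> borel_measurable N" "g \<in> borel_measurable N"
    and "\<And>x. f x \<in> {i0..i1}" "\<And>x. g x \<in> {j0..j1}"
  shows "(\<lambda>x. H (f x) (g x)) \<in> borel_measurable N"
proof -
  let ?S = "{i0..i1} \<times> {j0..j1}"
  have "(\<lambda>x. (f x, g x)) \<in> N \<rightarrow>\<^sub>M restrict_space borel ?S"
    using assms by (intro measurable_restrict_space2) auto
  from measurable_compose[OF this borel_measurable_continuous_on_restrict[OF cont_H]]
  show ?thesis by simp
qed

lemma H_bounded: "\<exists>B. \<forall>x\<in>{i0..i1}. \<forall>y\<in>{j0..j1}. H x y \<in> {-B..B}"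
proof -
  obtain B where "\<forall>x\<in>{i0..i1}. \<forall>y\<in>{j0..j1}. \<bar>H x y\<bar> \<le> B"
    using continuous_on_rectangle_bounded[OF cont_H] by blast
  then show ?thesis by (intro exI[of _ B]) (simp add: abs_le_iff minus_le_iff)
qed

lemma sup_convolution:
  fixes f g :: "'b::euclidean_space \<Rightarrow> real"
  assumes f[measurable]: "f \<in> borel_measurable borel" and g[measurable]: "g \<in> borel_measurable borel"
    and fI: "\<And>x. f x \<in> {i0..i1}" and gJ: "\<And>x. g x \<in> {j0..j1}"
  shows "sup_convolution a b H f g \<in> borel_measurable borel"
    and "\<exists>B. \<forall>x. \<bar>sup_convolution a b H f g x\<bar> \<le> B"
    and "\<And>x. AE y in lborel. H (f ((1 / a) *\<^sub>R (x - y))) (g ((1 / b) *\<^sub>R y)) \<le> sup_convolution a b H f g x"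
    and "\<And>x B. (\<And>y. H (f ((1 / a) *\<^sub>R (x - y))) (g ((1 / b) *\<^sub>R y)) \<le> B) \<Longrightarrow> sup_convolution a b H f g x \<le> B"
proof -
  let ?F = "\<lambda>x y. H (f ((1 / a) *\<^sub>R (x - y))) (g ((1 / b) *\<^sub>R y))"
  have F: "(\<lambda>(x, y). ?F x y) \<in> borel_measurable (borel \<Otimes>\<^sub>M borel)"
    unfolding case_prod_unfold using fI gJ by (intro H_measurable) measurable
  obtain B where B: "\<And>x y. x \<in> {i0..i1} \<Longrightarrow> y \<in> {j0..j1} \<Longrightarrow> H x y \<in> {-B..B}" using H_bounded by blast
  note * = esssup_section[OF F, of "-B" B, OF B[OF fI gJ], folded sup_convolution_def]
  show "sup_convolution a b H f g \<in> borel_measurable borel" using *(1) by (simp add: sup_convolution_def[abs_def])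
  have "\<bar>sup_convolution a b H f g x\<bar> \<le> B" for x using *(2)[of x] by (auto simp: abs_le_iff)
  then show "\<exists>B. \<forall>x. \<bar>sup_convolution a b H f g x\<bar> \<le> B" by blast
  show "\<And>x. AE y in lborel. ?F x y \<le> sup_convolution a b H f g x" using *(3) by simp
  show "\<And>x B. (\<And>y. ?F x y \<le> B) \<Longrightarrow> sup_convolution a b H f g x \<le> B" using *(4) by simp
qed

end

lemma esssup_inequality_iff:
  "esssup_inequality a b I J H M \<longleftrightarrow>
     (\<forall>f \<in> borel_measurable borel. \<forall>g \<in> borel_measurable borel.
        (\<forall>x. f x \<in> I) \<and> (\<forall>x. g x \<in> J) \<longrightarrow>
        H (\<integral>x. f x \<partial>M) (\<integral>x. g x \<partial>M) \<le> (\<integral>x. sup_convolution a b H f g x \<partial>M))"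
  unfolding esssup_inequality_def sup_convolution_def ..

lemma (in prob_space) integral_in_Icc:
  fixes f :: "'a \<Rightarrow> real"
  assumes "f \<in> borel_measurable M" "\<And>x. f x \<in> {l..u}"
  shows "integrable M f" "(\<integral>x. f x \<partial>M) \<in> {l..u}"
proof -
  show i: "integrable M f"
  proof (rule integrable_const_bound[where B = "\<bar>l\<bar> + \<bar>u\<bar>"])
    have "norm (f x) \<le> \<bar>l\<bar> + \<bar>u\<bar>" for x using assms(2)[of x] by auto
    then show "AE x in M. norm (f x) \<le> \<bar>l\<bar> + \<bar>u\<bar>" by simp
  qed fact
  have "(\<integral>x. l \<partial>M) \<le> (\<integral>x. f x \<partial>M)" "(\<integral>x. f x \<partial>M) \<le> (\<integral>x. u \<partial>M)"
    using assms(2) by (intro integral_mono i; simp)+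
  then show "(\<integral>x. f x \<partial>M) \<in> {l..u}" by (simp add: prob_space)
qed

lemma integrable_affine_power:
  fixes M :: "'b::euclidean_space measure"
  assumes "prob_space M" and sM[measurable_cong]: "sets M = sets borel" and "integrable M (\<lambda>x. norm x ^ 3)" and "k \<le> 3"
  shows "integrable M (\<lambda>x. \<bar>x \<bullet> e - c\<bar> ^ k)" "integrable M (\<lambda>x. (x \<bullet> e - c) ^ k)"
proof -
  interpret prob_space M by fact
  define C where "C = 1 + norm e + \<bar>c\<bar>"
  have bd: "\<bar>x \<bullet> e - c\<bar> ^ k \<le> (2 * C) ^ 3 * (1 + norm x ^ 3)" for x
  proof -
    have "\<bar>x \<bullet> e - c\<bar> \<le> norm x * norm e + \<bar>c\<bar>" using Cauchy_Schwarz_ineq2[of x e] by linarith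
    also have "\<dots> \<le> C * max 1 (norm x)"
    proof -
      have "norm x * norm e \<le> max 1 (norm x) * norm e" by (intro mult_right_mono) auto
      moreover have "\<bar>c\<bar> * 1 \<le> \<bar>c\<bar> * max 1 (norm x)" by (intro mult_left_mono) auto
      ultimately show ?thesis by (simp add: C_def algebra_simps)
    qed
    finally have "\<bar>x \<bullet> e - c\<bar> ^ k \<le> (C * max 1 (norm x)) ^ k" by (intro power_mono) auto
    also have "\<dots> \<le> (C * max 1 (norm x)) ^ 3"
    proof (rule power_increasing[OF assms(4)])
      have "1 * 1 \<le> C * max 1 (norm x)" by (intro mult_mono) (auto simp: C_def)
      then show "1 \<le> C * max 1 (norm x)" by simp
    qed
    also have "\<dots> \<le> C ^ 3 * (1 + norm x ^ 3)"
      unfolding power_mult_distrib by (intro mult_left_mono) (auto simp: C_def max_def)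
    also have "\<dots> \<le> (2 * C) ^ 3 * (1 + norm x ^ 3)"
      by (intro mult_right_mono power_mono) (auto simp: C_def)
    finally show ?thesis .
  qed
  have "integrable M (\<lambda>x. (2 * C) ^ 3 * (1 + norm x ^ 3))" using assms(3) by simp
  note * = Bochner_Integration.integrable_bound[OF this]
  have bd': "norm ((x \<bullet> e - c) ^ k) \<le> norm ((2 * C) ^ 3 * (1 + norm x ^ 3))" for x
    using order_trans[OF bd[of x] abs_ge_self] by (simp add: power_abs)
  show "integrable M (\<lambda>x. (x \<bullet> e - c) ^ k)"
    by (rule *) (use bd' in \<open>simp_all del: norm_power\<close>)
  then show "integrable M (\<lambda>x. \<bar>x \<bullet> e - c\<bar> ^ k)"
    unfolding power_abs[symmetric] by (rule integrable_abs)
qed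

section \<open>Necessity\<close>

lemma nonpos_if_le_mult:
  fixes x C :: real
  assumes "\<And>\<epsilon>. 0 < \<epsilon> \<Longrightarrow> \<epsilon> \<le> 1 \<Longrightarrow> x \<le> C * \<epsilon>"
  shows "x \<le> 0"
proof (rule ccontr)
  assume "\<not> x \<le> 0"
  define \<epsilon> where "\<epsilon> = min 1 (x / (2 * (\<bar>C\<bar> + 1)))"
  have "0 < \<epsilon>" "\<epsilon> \<le> 1" using \<open>\<not> x \<le> 0\<close> by (auto simp: \<epsilon>_def)
  have "x \<le> C * \<epsilon>" by (rule assms) fact+
  also have "\<dots> \<le> (\<bar>C\<bar> + 1) * \<epsilon>" using \<open>0 < \<epsilon>\<close> by (intro mult_right_mono) auto
  also have "\<dots> \<le> (\<bar>C\<bar> + 1) * (x / (2 * (\<bar>C\<bar> + 1)))" by (intro mult_left_mono) (auto simp: \<epsilon>_def)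
  also have "\<dots> = x / 2" by (simp add: field_simps)
  finally show False using \<open>\<not> x \<le> 0\<close> by simp
qed

lemma (in prob_space) integral_linear_combination:
  fixes u v w z :: "'a \<Rightarrow> real"
  assumes "integrable M u" "integrable M v" "integrable M w"
  shows "integrable M (\<lambda>x. c + \<alpha> * u x + \<beta> * v x + \<gamma> * w x)"
    and "(\<integral>x. c + \<alpha> * u x + \<beta> * v x + \<gamma> * w x \<partial>M) = c + \<alpha> * (\<integral>x. u x \<partial>M) + \<beta> * (\<integral>x. v x \<partial>M) + \<gamma> * (\<integral>x. w x \<partial>M)"
  using assms by (simp_all add: prob_space)

context smooth_rectangle
begin

text \<open>The inequality for the functions \<open>\<phi> (\<epsilon> (x \<bullet> e - m0))\<close> and \<open>\<psi> (\<epsilon>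
(x \<bullet> e - m0))\<close>, integrated. On the line through \<open>x\<close> the two arguments \<open>s\<close>,
\<open>t\<close> satisfy \<open>a s + b t = \<epsilon> (x \<bullet> e - (a + b) m0)\<close>, which explains the two
centrings. Here \<open>P\<close> and \<open>R\<close> are the deviations of the means of \<open>f\<close> and
\<open>g\<close> from \<open>p\<close> and \<open>r\<close>.\<close>

lemma small_perturbation_inequality:
  fixes a b \<nu> \<kappa> \<eta> m0 :: real and e :: "real ^ 'n" and M :: "(real ^ 'n) measure"
  assumes pr: "p \<in> {i0<..<i1}" "r \<in> {j0<..<j1}" and ab: "0 < a" "0 < b" and \<eta>: "0 < \<eta>"
    and E: "esssup_inequality a b {i0..i1} {j0..j1} H M"
    and M: "prob_space M" and sM[measurable_cong]: "sets M = sets borel" and int: "integrable M (\<lambda>x. norm x ^ 3)"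
  defines "s1 \<equiv> a * \<nu> / Hx p r" and "s2 \<equiv> b * \<nu> / Hy p r"
  defines "m \<equiv> \<bar>Hxy p r * s1 * s2 - \<kappa> * a * b\<bar> + \<eta>"
  defines "k1 \<equiv> (\<kappa> * a\<^sup>2 - m - Hxx p r * s1\<^sup>2) / Hx p r" and "k2 \<equiv> (\<kappa> * b\<^sup>2 - m - Hyy p r * s2\<^sup>2) / Hy p r"
  defines "A1 \<equiv> \<integral>x. x \<bullet> e - m0 \<partial>M" and "A2 \<equiv> \<integral>x. (x \<bullet> e - m0)\<^sup>2 \<partial>M"
  defines "B1 \<equiv> \<integral>x. x \<bullet> e - (a + b) * m0 \<partial>M" and "B2 \<equiv> \<integral>x. (x \<bullet> e - (a + b) * m0)\<^sup>2 \<partial>M"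
  shows "\<exists>L\<ge>0. \<forall>\<epsilon>. 0 < \<epsilon> \<and> \<epsilon> \<le> 1 \<longrightarrow> (\<exists>P R.
    \<bar>P - (s1 * A1 * \<epsilon> + k1 * A2 * \<epsilon>\<^sup>2 / 2)\<bar> \<le> L * \<epsilon> ^ 3 \<and> \<bar>R - (s2 * A1 * \<epsilon> + k2 * A2 * \<epsilon>\<^sup>2 / 2)\<bar> \<le> L * \<epsilon> ^ 3 \<and>
    Hx p r * P + Hy p r * R \<le> \<nu> * B1 * \<epsilon> + \<kappa> * B2 * \<epsilon>\<^sup>2 / 2 + L * \<epsilon> ^ 3 + K * (\<bar>P\<bar> + \<bar>R\<bar>)\<^sup>2)"
proof -
  interpret prob_space M by fact
  have pr': "p \<in> {i0..i1}" "r \<in> {j0..j1}" using pr by auto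
  obtain \<phi> \<psi> L where \<phi>[measurable]: "\<phi> \<in> borel_measurable borel" and \<psi>[measurable]: "\<psi> \<in> borel_measurable borel"
    and L0: "0 \<le> L" and range: "\<And>t. \<phi> t \<in> {i0..i1}" "\<And>t. \<psi> t \<in> {j0..j1}"
    and ap: "\<And>t. \<bar>\<phi> t - p - s1 * t - k1 * t\<^sup>2 / 2\<bar> \<le> L * \<bar>t\<bar> ^ 3" "\<And>t. \<bar>\<psi> t - r - s2 * t - k2 * t\<^sup>2 / 2\<bar> \<le> L * \<bar>t\<bar> ^ 3"
    and up: "\<And>s t. H (\<phi> s) (\<psi> t) \<le> H p r + \<nu> * (a * s + b * t) + \<kappa> * (a * s + b * t)\<^sup>2 / 2 + L * \<bar>a * s + b * t\<bar> ^ 3"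
    using test_functions[OF pr \<eta>, where a = a and b = b and \<nu> = \<nu> and \<kappa> = \<kappa>, folded s1_def s2_def, folded m_def, folded k1_def k2_def] by blast
  define A3 where "A3 = (\<integral>x. \<bar>x \<bullet> e - m0\<bar> ^ 3 \<partial>M)"
  define B3 where "B3 = (\<integral>x. \<bar>x \<bullet> e - (a + b) * m0\<bar> ^ 3 \<partial>M)"
  have A30: "0 \<le> A3" "0 \<le> B3" unfolding A3_def B3_def by (auto intro!: integral_nonneg_AE)
  note ints = integrable_affine_power[OF M sM int]
  have i1: "integrable M (\<lambda>x. x \<bullet> e - c)" for c using ints(2)[of 1 e c] by simp
  have i2: "integrable M (\<lambda>x. (x \<bullet> e - c)\<^sup>2)" for c using ints(2)[of 2 e c] by simp
  have i3: "integrable M (\<lambda>x. \<bar>x \<bullet> e - c\<bar> ^ 3)" for c using ints(1)[of 3 e c] by simp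
  have taylor: "\<bar>(\<integral>x. \<omega> (\<epsilon> * (x \<bullet> e - m0)) \<partial>M) - c0 - (c1 * A1 * \<epsilon> + c2 * A2 * \<epsilon>\<^sup>2 / 2)\<bar> \<le> L * A3 * \<epsilon> ^ 3"
    if \<omega>[measurable]: "\<omega> \<in> borel_measurable borel" and r: "\<And>t. \<omega> t \<in> {l..u}"
      and a3: "\<And>t. \<bar>\<omega> t - c0 - c1 * t - c2 * t\<^sup>2 / 2\<bar> \<le> L * \<bar>t\<bar> ^ 3" and e: "0 < \<epsilon>" for \<omega> l u c0 c1 c2 \<epsilon>
  proof -
    have i0: "integrable M (\<lambda>x. \<omega> (\<epsilon> * (x \<bullet> e - m0)))"
      by (rule integral_in_Icc(1)[where l = l and u = u]) (use r in measurable)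
    let ?F = "\<lambda>x. - c0 + 1 * \<omega> (\<epsilon> * (x \<bullet> e - m0)) + (- c1 * \<epsilon>) * (x \<bullet> e - m0) + (- c2 * \<epsilon>\<^sup>2 / 2) * (x \<bullet> e - m0)\<^sup>2"
    note lc = integral_linear_combination[OF i0 i1 i2, of "- c0" 1 "- c1 * \<epsilon>" m0 "- c2 * \<epsilon>\<^sup>2 / 2" m0, folded A1_def A2_def]
    have "(\<integral>x. \<omega> (\<epsilon> * (x \<bullet> e - m0)) \<partial>M) - c0 - (c1 * A1 * \<epsilon> + c2 * A2 * \<epsilon>\<^sup>2 / 2) = (\<integral>x. ?F x \<partial>M)"
      unfolding lc(2) by simp
    moreover have "\<bar>\<integral>x. ?F x \<partial>M\<bar> \<le> (\<integral>x. L * \<epsilon> ^ 3 * \<bar>x \<bullet> e - m0\<bar> ^ 3 \<partial>M)"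
    proof (rule integral_abs_bound_integral)
      show "integrable M ?F" by (rule lc(1))
      show "integrable M (\<lambda>x. L * \<epsilon> ^ 3 * \<bar>x \<bullet> e - m0\<bar> ^ 3)" using i3 by (intro integrable_mult_right)
      fix x
      show "\<bar>?F x\<bar> \<le> L * \<epsilon> ^ 3 * \<bar>x \<bullet> e - m0\<bar> ^ 3"
        using a3[of "\<epsilon> * (x \<bullet> e - m0)"] e by (simp add: power_mult_distrib abs_mult mult_ac)
    qed
    moreover have "(\<integral>x. L * \<epsilon> ^ 3 * \<bar>x \<bullet> e - m0\<bar> ^ 3 \<partial>M) = L * A3 * \<epsilon> ^ 3" by (simp add: A3_def[symmetric])
    ultimately show ?thesis by (simp only:)
  qed
  define L' where "L' = L * A3 + L * B3"
  have L': "0 \<le> L'" "L * A3 \<le> L'" "L * B3 \<le> L'" using L0 A30 by (auto simp: L'_def)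
  have "\<exists>P R. \<bar>P - (s1 * A1 * \<epsilon> + k1 * A2 * \<epsilon>\<^sup>2 / 2)\<bar> \<le> L' * \<epsilon> ^ 3 \<and> \<bar>R - (s2 * A1 * \<epsilon> + k2 * A2 * \<epsilon>\<^sup>2 / 2)\<bar> \<le> L' * \<epsilon> ^ 3 \<and>
    Hx p r * P + Hy p r * R \<le> \<nu> * B1 * \<epsilon> + \<kappa> * B2 * \<epsilon>\<^sup>2 / 2 + L' * \<epsilon> ^ 3 + K * (\<bar>P\<bar> + \<bar>R\<bar>)\<^sup>2"
    if e: "0 < \<epsilon>" "\<epsilon> \<le> 1" for \<epsilon>
  proof -
    define f where "f x = \<phi> (\<epsilon> * (x \<bullet> e - m0))" for x :: "real ^ 'n"
    define g where "g x = \<psi> (\<epsilon> * (x \<bullet> e - m0))" for x :: "real ^ 'n"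
    have fm[measurable]: "f \<in> borel_measurable borel" and gm[measurable]: "g \<in> borel_measurable borel"
      unfolding f_def g_def by measurable
    have fr: "\<And>x. f x \<in> {i0..i1}" and gr: "\<And>x. g x \<in> {j0..j1}" using range by (auto simp: f_def g_def)
    define P where "P = (\<integral>x. f x \<partial>M) - p"
    define R where "R = (\<integral>x. g x \<partial>M) - r"
    have "L * A3 * \<epsilon> ^ 3 \<le> L' * \<epsilon> ^ 3" using L' e by (intro mult_right_mono) auto
    then have P: "\<bar>P - (s1 * A1 * \<epsilon> + k1 * A2 * \<epsilon>\<^sup>2 / 2)\<bar> \<le> L' * \<epsilon> ^ 3" and R: "\<bar>R - (s2 * A1 * \<epsilon> + k2 * A2 * \<epsilon>\<^sup>2 / 2)\<bar> \<le> L' * \<epsilon> ^ 3"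
      using taylor[OF \<phi> range(1) ap(1) e(1)] taylor[OF \<psi> range(2) ap(2) e(1)]
      unfolding P_def R_def f_def g_def by linarith+
    let ?q = "sup_convolution a b H f g"
    note sc = sup_convolution[OF fm gm fr gr, where a = a and b = b]
    obtain B where B: "\<And>x. \<bar>?q x\<bar> \<le> B" using sc(2) by blast
    have qb: "?q x \<in> {-B..B}" for x using B[of x] by (simp add: abs_le_iff)
    have "?q \<in> borel_measurable M" using sc(1) by (simp cong: measurable_cong_sets)
    then have qi: "integrable M ?q" using qb by (rule integral_in_Icc(1))
    let ?t = "\<lambda>x. H p r + \<nu> * \<epsilon> * (x \<bullet> e - (a + b) * m0) + \<kappa> * \<epsilon>\<^sup>2 / 2 * (x \<bullet> e - (a + b) * m0)\<^sup>2 + L * \<epsilon> ^ 3 * \<bar>x \<bullet> e - (a + b) * m0\<bar> ^ 3"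
    have q: "?q x \<le> ?t x" for x
    proof (rule sc(4))
      fix y
      define s where "s = \<epsilon> * (((1 / a) *\<^sub>R (x - y)) \<bullet> e - m0)"
      define t where "t = \<epsilon> * (((1 / b) *\<^sub>R y) \<bullet> e - m0)"
      have z: "a * s + b * t = \<epsilon> * (x \<bullet> e - (a + b) * m0)"
        using ab unfolding s_def t_def by (simp add: inner_diff_left algebra_simps)
      show "H (f ((1 / a) *\<^sub>R (x - y))) (g ((1 / b) *\<^sub>R y)) \<le> ?t x"
        using up[of s t] e unfolding z f_def g_def s_def[symmetric] t_def[symmetric]
        by (simp add: power_mult_distrib abs_mult mult_ac)
    qed
    note lc = integral_linear_combination[OF i1 i2 i3, of "H p r" "\<nu> * \<epsilon>" "(a + b) * m0" "\<kappa> * \<epsilon>\<^sup>2 / 2" "(a + b) * m0" "L * \<epsilon> ^ 3" "(a + b) * m0"]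
    have "H (p + P) (r + R) \<le> (\<integral>x. ?q x \<partial>M)"
      using E fr gr unfolding esssup_inequality_iff P_def R_def by auto
    also have "\<dots> \<le> (\<integral>x. ?t x \<partial>M)" using qi lc(1) q by (rule integral_mono)
    also have "\<dots> = H p r + \<nu> * \<epsilon> * B1 + \<kappa> * \<epsilon>\<^sup>2 / 2 * B2 + L * \<epsilon> ^ 3 * B3"
      unfolding lc(2) B1_def B2_def B3_def ..
    also have "\<dots> \<le> H p r + \<nu> * B1 * \<epsilon> + \<kappa> * B2 * \<epsilon>\<^sup>2 / 2 + L' * \<epsilon> ^ 3"
    proof -
      have "L * B3 * \<epsilon> ^ 3 \<le> L' * \<epsilon> ^ 3" using L' e by (intro mult_right_mono) auto
      then show ?thesis by (simp add: mult_ac)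
    qed
    finally have HU: "H (p + P) (r + R) \<le> H p r + \<nu> * B1 * \<epsilon> + \<kappa> * B2 * \<epsilon>\<^sup>2 / 2 + L' * \<epsilon> ^ 3" .
    have "p + P \<in> {i0..i1}" "r + R \<in> {j0..j1}"
      using integral_in_Icc(2)[OF _ fr] integral_in_Icc(2)[OF _ gr] by (auto simp: P_def R_def)
    from taylor1[OF pr'(1) this(1) pr'(2) this(2)]
    have "\<bar>H (p + P) (r + R) - H p r - Hx p r * P - Hy p r * R\<bar> \<le> K * (\<bar>P\<bar> + \<bar>R\<bar>)\<^sup>2" by simp
    then have "Hx p r * P + Hy p r * R \<le> \<nu> * B1 * \<epsilon> + \<kappa> * B2 * \<epsilon>\<^sup>2 / 2 + L' * \<epsilon> ^ 3 + K * (\<bar>P\<bar> + \<bar>R\<bar>)\<^sup>2"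
      using HU by linarith
    with P R show ?thesis by blast
  qed
  then show ?thesis using L'(1) by blast
qed

lemma perturbation_size:
  fixes P x y L \<epsilon> :: real
  assumes "\<bar>P - (x * \<epsilon> + y * \<epsilon>\<^sup>2 / 2)\<bar> \<le> L * \<epsilon> ^ 3" "0 < \<epsilon>" "\<epsilon> \<le> 1" "0 \<le> L"
  shows "\<bar>P - x * \<epsilon>\<bar> \<le> (\<bar>y\<bar> + L) * \<epsilon>\<^sup>2"
proof -
  have "\<epsilon> ^ 3 \<le> \<epsilon>\<^sup>2" using assms by (intro power_decreasing) auto
  then have "L * \<epsilon> ^ 3 \<le> L * \<epsilon>\<^sup>2" using assms by (intro mult_left_mono) auto
  moreover have "\<bar>y * \<epsilon>\<^sup>2 / 2\<bar> \<le> \<bar>y\<bar> * \<epsilon>\<^sup>2" by (simp add: abs_mult)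
  ultimately show ?thesis using assms(1) unfolding distrib_right by linarith
qed

text \<open>First order in \<open>\<epsilon>\<close>, with \<open>m0 = 0\<close>: the left-hand side moves by \<open>\<nu> \<mu>
\<epsilon>\<close> and the right-hand side by \<open>\<nu> (a + b) \<mu> \<epsilon>\<close>, where
\<open>\<mu>\<close> is the mean of \<open>x \<bullet> e\<close> and \<open>\<nu>\<close> may have either sign.\<close>

lemma necessary_mean:
  fixes a b :: real and e :: "real ^ 'n" and M :: "(real ^ 'n) measure"
  assumes ab: "0 < a" "0 < b"
    and E: "esssup_inequality a b {i0..i1} {j0..j1} H M"
    and M: "prob_space M" and sM: "sets M = sets borel" and int: "integrable M (\<lambda>x. norm x ^ 3)"
  shows "(a + b - 1) * (\<integral>x. x \<bullet> e \<partial>M) = 0"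
proof -
  define mu where "mu = (\<integral>x. x \<bullet> e \<partial>M)"
  define p where "p = (i0 + i1) / 2"
  define r where "r = (j0 + j1) / 2"
  have pr: "p \<in> {i0<..<i1}" "r \<in> {j0<..<j1}" using i_less j_less by (auto simp: p_def r_def)
  then have pr': "p \<in> {i0..i1}" "r \<in> {j0..j1}" by auto
  have Hnz: "Hx p r \<noteq> 0" "Hy p r \<noteq> 0" using away_from_0[OF pr'] by auto
  note b = bounds[OF pr']
  have K0: "0 \<le> K" using K_ge_1 by simp
  have "\<nu> * ((a + b - 1) * mu) \<le> 0" for \<nu> :: real
  proof -
    define s1 where "s1 = a * \<nu> / Hx p r"
    define s2 where "s2 = b * \<nu> / Hy p r"
    obtain k1 k2 A2 L where L0: "0 \<le> L" and *: "\<And>\<epsilon>. 0 < \<epsilon> \<Longrightarrow> \<epsilon> \<le> 1 \<Longrightarrow> (\<exists>P R.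
      \<bar>P - (s1 * mu * \<epsilon> + k1 * A2 * \<epsilon>\<^sup>2 / 2)\<bar> \<le> L * \<epsilon> ^ 3 \<and> \<bar>R - (s2 * mu * \<epsilon> + k2 * A2 * \<epsilon>\<^sup>2 / 2)\<bar> \<le> L * \<epsilon> ^ 3 \<and>
      Hx p r * P + Hy p r * R \<le> \<nu> * mu * \<epsilon> + L * \<epsilon> ^ 3 + K * (\<bar>P\<bar> + \<bar>R\<bar>)\<^sup>2)"
      using small_perturbation_inequality[OF pr ab zero_less_one E M sM int, where \<nu> = \<nu> and \<kappa> = 0 and e = e and ?m0.0 = 0, folded s1_def s2_def]
      unfolding diff_zero mult_zero_right mult_zero_left add_0_right div_0 mu_def[symmetric] by metis
    define D where "D = (\<bar>k1 * A2\<bar> + L) + (\<bar>k2 * A2\<bar> + L)"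
    define G where "G = \<bar>s1 * mu\<bar> + \<bar>s2 * mu\<bar> + D"
    have D0: "0 \<le> D" using L0 by (simp add: D_def)
    have G0: "0 \<le> G" using D0 by (simp add: G_def)
    show ?thesis
    proof (rule nonpos_if_le_mult[where C = "L + K * G\<^sup>2 + K * D"])
      fix \<epsilon> :: real assume e: "0 < \<epsilon>" "\<epsilon> \<le> 1"
      obtain P R where PR: "\<bar>P - (s1 * mu * \<epsilon> + k1 * A2 * \<epsilon>\<^sup>2 / 2)\<bar> \<le> L * \<epsilon> ^ 3" "\<bar>R - (s2 * mu * \<epsilon> + k2 * A2 * \<epsilon>\<^sup>2 / 2)\<bar> \<le> L * \<epsilon> ^ 3"
        "Hx p r * P + Hy p r * R \<le> \<nu> * mu * \<epsilon> + L * \<epsilon> ^ 3 + K * (\<bar>P\<bar> + \<bar>R\<bar>)\<^sup>2" using *[OF e] by blast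
      have P: "\<bar>P - s1 * mu * \<epsilon>\<bar> \<le> (\<bar>k1 * A2\<bar> + L) * \<epsilon>\<^sup>2" and R: "\<bar>R - s2 * mu * \<epsilon>\<bar> \<le> (\<bar>k2 * A2\<bar> + L) * \<epsilon>\<^sup>2"
        using perturbation_size[OF PR(1) e L0] perturbation_size[OF PR(2) e L0] .
      have e2: "\<epsilon>\<^sup>2 \<le> \<epsilon>" "\<epsilon> ^ 3 \<le> \<epsilon>\<^sup>2" using e power_decreasing[of 1 2 \<epsilon>] power_decreasing[of 2 3 \<epsilon>] by auto
      have sum: "\<bar>P - s1 * mu * \<epsilon>\<bar> + \<bar>R - s2 * mu * \<epsilon>\<bar> \<le> D * \<epsilon>\<^sup>2"
        using P R unfolding D_def by (simp add: distrib_right)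
      have "D * \<epsilon>\<^sup>2 \<le> D * \<epsilon>" using e2 D0 by (intro mult_left_mono)
      moreover have "\<bar>s1 * mu * \<epsilon>\<bar> = \<bar>s1 * mu\<bar> * \<epsilon>" "\<bar>s2 * mu * \<epsilon>\<bar> = \<bar>s2 * mu\<bar> * \<epsilon>" using e by (simp_all add: abs_mult)
      ultimately have "\<bar>P\<bar> + \<bar>R\<bar> \<le> G * \<epsilon>" using sum unfolding G_def distrib_right by linarith
      then have "(\<bar>P\<bar> + \<bar>R\<bar>)\<^sup>2 \<le> (G * \<epsilon>)\<^sup>2" by (intro power_mono) auto
      then have q: "K * (\<bar>P\<bar> + \<bar>R\<bar>)\<^sup>2 \<le> K * G\<^sup>2 * \<epsilon>\<^sup>2" using K0 by (simp add: power_mult_distrib mult.assoc mult_left_mono)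
      have "\<bar>Hx p r * (P - s1 * mu * \<epsilon>)\<bar> \<le> K * \<bar>P - s1 * mu * \<epsilon>\<bar>" "\<bar>Hy p r * (R - s2 * mu * \<epsilon>)\<bar> \<le> K * \<bar>R - s2 * mu * \<epsilon>\<bar>"
        using b by (auto simp: abs_mult intro!: mult_right_mono)
      moreover have "K * \<bar>P - s1 * mu * \<epsilon>\<bar> + K * \<bar>R - s2 * mu * \<epsilon>\<bar> \<le> K * (D * \<epsilon>\<^sup>2)"
        unfolding distrib_left[symmetric] using sum K0 by (rule mult_left_mono)
      moreover have "Hx p r * (P - s1 * mu * \<epsilon>) + Hy p r * (R - s2 * mu * \<epsilon>) = Hx p r * P + Hy p r * R - \<nu> * (a + b) * mu * \<epsilon>"
        using Hnz by (simp add: s1_def s2_def algebra_simps)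
      moreover have "L * \<epsilon> ^ 3 \<le> L * \<epsilon>\<^sup>2" using e2 L0 by (intro mult_left_mono)
      ultimately have "\<nu> * (a + b) * mu * \<epsilon> - \<nu> * mu * \<epsilon> \<le> L * \<epsilon>\<^sup>2 + K * G\<^sup>2 * \<epsilon>\<^sup>2 + K * (D * \<epsilon>\<^sup>2)"
        using PR(3) q by linarith
      then have "(\<nu> * ((a + b - 1) * mu)) * \<epsilon> \<le> ((L + K * G\<^sup>2 + K * D) * \<epsilon>) * \<epsilon>"
        by (simp add: algebra_simps power2_eq_square)
      then show "\<nu> * ((a + b - 1) * mu) \<le> (L + K * G\<^sup>2 + K * D) * \<epsilon>" using e(1) by (rule mult_right_le_imp_le)
    qed
  qed
  from this[of 1] this[of "-1"] show ?thesis by (simp add: mu_def)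
qed

text \<open>With \<open>m0\<close> equal to the mean of \<open>x \<bullet> e\<close> both centrings agree, by the relation for the
mean, and the linear terms vanish. The order \<open>\<epsilon>\<^sup>2\<close> then compares \<open>\<kappa>\<close>
with \<open>H\<^sub>x k1 + H\<^sub>y k2\<close>, both multiplied by the positive variance of \<open>x \<bullet>
e\<close>.\<close>

lemma necessary_second_order:
  fixes a b :: real and e :: "real ^ 'n" and M :: "(real ^ 'n) measure"
  assumes pr: "p \<in> {i0<..<i1}" "r \<in> {j0<..<j1}" and ab: "0 < a" "0 < b"
    and E: "esssup_inequality a b {i0..i1} {j0..j1} H M"
    and M: "prob_space M" and sM: "sets M = sets borel" and int: "integrable M (\<lambda>x. norm x ^ 3)"
    and var: "0 < (\<integral>x. (x \<bullet> e - (\<integral>x. x \<bullet> e \<partial>M))\<^sup>2 \<partial>M)"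
  defines "B \<equiv> a * b * Hxy p r / (Hx p r * Hy p r)"
    and "S \<equiv> a\<^sup>2 * Hxx p r / (Hx p r)\<^sup>2 + b\<^sup>2 * Hyy p r / (Hy p r)\<^sup>2"
  shows "0 \<le> \<kappa> * (1 - a\<^sup>2 - b\<^sup>2) + 2 * \<bar>B - \<kappa> * a * b\<bar> + S"
proof -
  interpret prob_space M by fact
  define mu where "mu = (\<integral>x. x \<bullet> e \<partial>M)"
  have pr': "p \<in> {i0..i1}" "r \<in> {j0..j1}" using pr by auto
  have Hnz: "Hx p r \<noteq> 0" "Hy p r \<noteq> 0" using away_from_0[OF pr'] by auto
  note bd = bounds[OF pr']
  have K0: "0 \<le> K" using K_ge_1 by simp
  define V where "V = (\<integral>x. (x \<bullet> e - mu)\<^sup>2 \<partial>M)"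
  have V0: "0 < V" using var by (simp add: V_def mu_def)
  have mu: "(a + b) * mu = mu"
    using necessary_mean[OF ab E M sM int, of e] by (simp add: mu_def algebra_simps)
  have i1: "integrable M (\<lambda>x. x \<bullet> e)" using integrable_affine_power(2)[OF M sM int, of 1 e 0] by simp
  have m0: "(\<integral>x. x \<bullet> e - mu \<partial>M) = 0" using i1 by (simp add: mu_def prob_space)
  have *: "0 \<le> \<kappa> * (1 - a\<^sup>2 - b\<^sup>2) + 2 * (\<bar>B - \<kappa> * a * b\<bar> + \<eta>) + S" if \<eta>: "0 < \<eta>" for \<eta>
  proof -
    define s1 where "s1 = a * 1 / Hx p r"
    define s2 where "s2 = b * 1 / Hy p r"
    define m where "m = \<bar>Hxy p r * s1 * s2 - \<kappa> * a * b\<bar> + \<eta>"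
    define k1 where "k1 = (\<kappa> * a\<^sup>2 - m - Hxx p r * s1\<^sup>2) / Hx p r"
    define k2 where "k2 = (\<kappa> * b\<^sup>2 - m - Hyy p r * s2\<^sup>2) / Hy p r"
    obtain L where L0: "0 \<le> L" and *: "\<And>\<epsilon>. 0 < \<epsilon> \<Longrightarrow> \<epsilon> \<le> 1 \<Longrightarrow> (\<exists>P R.
      \<bar>P - k1 * V * \<epsilon>\<^sup>2 / 2\<bar> \<le> L * \<epsilon> ^ 3 \<and> \<bar>R - k2 * V * \<epsilon>\<^sup>2 / 2\<bar> \<le> L * \<epsilon> ^ 3 \<and>
      Hx p r * P + Hy p r * R \<le> \<kappa> * V * \<epsilon>\<^sup>2 / 2 + L * \<epsilon> ^ 3 + K * (\<bar>P\<bar> + \<bar>R\<bar>)\<^sup>2)"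
      using small_perturbation_inequality[OF pr ab \<eta> E M sM int, where \<nu> = 1 and \<kappa> = \<kappa> and e = e and ?m0.0 = mu, folded s1_def s2_def, folded m_def, folded k1_def k2_def]
      unfolding mu m0 mult_zero_right mult_zero_left add_0_left V_def[symmetric] by blast
    define D where "D = (\<bar>k1 * V\<bar> + L) + (\<bar>k2 * V\<bar> + L)"
    have D0: "0 \<le> D" using L0 by (simp add: D_def)
    have "(Hx p r * k1 + Hy p r * k2 - \<kappa>) * V / 2 \<le> 0"
    proof (rule nonpos_if_le_mult[where C = "L + K * D\<^sup>2 + K * (2 * L)"])
      fix \<epsilon> :: real assume e: "0 < \<epsilon>" "\<epsilon> \<le> 1"
      obtain P R where PR: "\<bar>P - k1 * V * \<epsilon>\<^sup>2 / 2\<bar> \<le> L * \<epsilon> ^ 3" "\<bar>R - k2 * V * \<epsilon>\<^sup>2 / 2\<bar> \<le> L * \<epsilon> ^ 3"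
        "Hx p r * P + Hy p r * R \<le> \<kappa> * V * \<epsilon>\<^sup>2 / 2 + L * \<epsilon> ^ 3 + K * (\<bar>P\<bar> + \<bar>R\<bar>)\<^sup>2" using *[OF e] by blast
      have "\<bar>P\<bar> \<le> (\<bar>k1 * V\<bar> + L) * \<epsilon>\<^sup>2" "\<bar>R\<bar> \<le> (\<bar>k2 * V\<bar> + L) * \<epsilon>\<^sup>2"
        using perturbation_size[of P 0 \<epsilon> "k1 * V" L] perturbation_size[of R 0 \<epsilon> "k2 * V" L] PR e L0 by auto
      then have "\<bar>P\<bar> + \<bar>R\<bar> \<le> D * \<epsilon>\<^sup>2" unfolding D_def by (simp add: distrib_right)
      then have "(\<bar>P\<bar> + \<bar>R\<bar>)\<^sup>2 \<le> (D * \<epsilon>\<^sup>2)\<^sup>2" by (intro power_mono) auto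
      also have "\<dots> = D\<^sup>2 * \<epsilon> ^ 4" by (simp add: power_mult_distrib)
      also have "\<dots> \<le> D\<^sup>2 * \<epsilon> ^ 3" using e by (intro mult_left_mono power_decreasing) auto
      finally have q: "K * (\<bar>P\<bar> + \<bar>R\<bar>)\<^sup>2 \<le> K * (D\<^sup>2 * \<epsilon> ^ 3)" using K0 by (rule mult_left_mono)
      have mK: "\<bar>c * x\<bar> \<le> K * y" if "\<bar>c\<bar> \<le> K" "\<bar>x\<bar> \<le> y" for c x y
        unfolding abs_mult using that K0 by (intro mult_mono) auto
      have "\<bar>Hx p r * (P - k1 * V * \<epsilon>\<^sup>2 / 2)\<bar> \<le> K * (L * \<epsilon> ^ 3)" "\<bar>Hy p r * (R - k2 * V * \<epsilon>\<^sup>2 / 2)\<bar> \<le> K * (L * \<epsilon> ^ 3)"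
        using bd PR(1,2) by (intro mK; blast)+
      moreover have "Hx p r * (P - k1 * V * \<epsilon>\<^sup>2 / 2) + Hy p r * (R - k2 * V * \<epsilon>\<^sup>2 / 2)
        = Hx p r * P + Hy p r * R - (Hx p r * k1 + Hy p r * k2) * V / 2 * \<epsilon>\<^sup>2"
        by (simp add: field_simps)
      ultimately have "(Hx p r * k1 + Hy p r * k2) * V / 2 * \<epsilon>\<^sup>2 - \<kappa> * V * \<epsilon>\<^sup>2 / 2
        \<le> L * \<epsilon> ^ 3 + K * (D\<^sup>2 * \<epsilon> ^ 3) + K * (L * \<epsilon> ^ 3) + K * (L * \<epsilon> ^ 3)"
        using PR(3) q by linarith
      moreover have "(A - \<kappa>) * V / 2 * x = A * V / 2 * x - \<kappa> * V * x / 2" for A x by (simp add: field_simps)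
      moreover have "((L + K * D\<^sup>2 + K * (2 * L)) * \<epsilon>) * \<epsilon>\<^sup>2 = L * \<epsilon> ^ 3 + K * (D\<^sup>2 * \<epsilon> ^ 3) + K * (L * \<epsilon> ^ 3) + K * (L * \<epsilon> ^ 3)"
        by (simp add: distrib_right power3_eq_cube power2_eq_square[of \<epsilon>])
      ultimately have "((Hx p r * k1 + Hy p r * k2 - \<kappa>) * V / 2) * \<epsilon>\<^sup>2 \<le> ((L + K * D\<^sup>2 + K * (2 * L)) * \<epsilon>) * \<epsilon>\<^sup>2"
        by (simp only:)
      then show "(Hx p r * k1 + Hy p r * k2 - \<kappa>) * V / 2 \<le> (L + K * D\<^sup>2 + K * (2 * L)) * \<epsilon>"
        by (rule mult_right_le_imp_le) (use e in simp)
    qed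
    then have "Hx p r * k1 + Hy p r * k2 \<le> \<kappa>" using V0 by (simp add: mult_le_0_iff)
    moreover have "Hx p r * k1 = \<kappa> * a\<^sup>2 - m - Hxx p r * s1\<^sup>2" "Hy p r * k2 = \<kappa> * b\<^sup>2 - m - Hyy p r * s2\<^sup>2"
      using Hnz by (simp_all add: k1_def k2_def)
    moreover have "Hxx p r * s1\<^sup>2 + Hyy p r * s2\<^sup>2 = S" by (simp add: S_def s1_def s2_def power_divide mult.commute)
    moreover have "m = \<bar>B - \<kappa> * a * b\<bar> + \<eta>" by (simp add: m_def B_def s1_def s2_def mult_ac)
    ultimately show ?thesis unfolding right_diff_distrib by (simp add: algebra_simps)
  qed
  show ?thesis
  proof (rule field_le_epsilon)
    fix \<delta> :: real assume "0 < \<delta>"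
    then show "0 \<le> \<kappa> * (1 - a\<^sup>2 - b\<^sup>2) + 2 * \<bar>B - \<kappa> * a * b\<bar> + S + \<delta>" using *[of "\<delta> / 2"] by simp
  qed
qed

end

text \<open>The bound forces \<open>\<bar>\<kappa>\<bar> (2 d - \<bar>c\<bar>)\<close> to be bounded below as
\<open>\<kappa>\<close> grows with sign opposite to \<open>c\<close>.\<close>

lemma abs_le_if_affine_bound:
  fixes c d S B :: real
  assumes "\<And>\<kappa>. 0 \<le> \<kappa> * c + 2 * \<bar>B - \<kappa> * d\<bar> + S" "0 \<le> d"
  shows "\<bar>c\<bar> \<le> 2 * d"
proof (rule ccontr)
  assume "\<not> \<bar>c\<bar> \<le> 2 * d"
  then have pos: "0 < \<bar>c\<bar> - 2 * d" by simp
  define X where "X = (2 * \<bar>B\<bar> + \<bar>S\<bar> + 1) / (\<bar>c\<bar> - 2 * d)"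
  have X0: "0 \<le> X" using pos by (simp add: X_def)
  have X: "X * \<bar>c\<bar> - X * d * 2 = 2 * \<bar>B\<bar> + \<bar>S\<bar> + 1"
  proof -
    have "X * (\<bar>c\<bar> - 2 * d) = 2 * \<bar>B\<bar> + \<bar>S\<bar> + 1" using pos by (simp add: X_def)
    then show ?thesis by (simp add: algebra_simps)
  qed
  define \<kappa> where "\<kappa> = - X * sgn c"
  have "\<kappa> * c = - (X * \<bar>c\<bar>)" by (simp add: \<kappa>_def abs_sgn mult_ac)
  moreover have "\<bar>\<kappa> * d\<bar> \<le> X * d" using X0 assms(2) by (simp add: \<kappa>_def abs_mult sgn_if)
  moreover have False
    if "k = - u" "\<bar>m\<bar> \<le> v" "0 \<le> k + 2 * \<bar>B - m\<bar> + S" "u - v * 2 = 2 * \<bar>B\<bar> + \<bar>S\<bar> + 1" for k u m v :: real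
  proof -
    have "k + 2 * \<bar>B - m\<bar> + S \<le> - u + 2 * (\<bar>B\<bar> + v) + \<bar>S\<bar>"
      using that(1,2) abs_triangle_ineq4[of B m] by (intro add_mono) auto
    then show False using that(3,4) by (simp add: algebra_simps)
  qed
  ultimately show False using assms(1)[of \<kappa>] X by blast
qed

text \<open>Zero variance would concentrate \<open>M\<close> on a hyperplane, which is a Lebesgue null set.\<close>

lemma absolutely_continuous_variance_pos:
  fixes M :: "(real ^ 'n) measure" and e :: "real ^ 'n"
  assumes "prob_space M" and sM[measurable_cong]: "sets M = sets borel" and ac: "absolutely_continuous lborel M"
    and int: "integrable M (\<lambda>x. (x \<bullet> e - c)\<^sup>2)" and e: "e \<noteq> 0"
  shows "0 < (\<integral>x. (x \<bullet> e - c)\<^sup>2 \<partial>M)"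
proof -
  interpret prob_space M by fact
  have "(\<integral>x. (x \<bullet> e - c)\<^sup>2 \<partial>M) \<noteq> 0"
  proof
    assume "(\<integral>x. (x \<bullet> e - c)\<^sup>2 \<partial>M) = 0"
    then have "AE x in M. (x \<bullet> e - c)\<^sup>2 = 0" using int by (subst (asm) integral_nonneg_eq_0_iff_AE) auto
    then have 1: "AE x in M. e \<bullet> x = c" by (simp add: inner_commute)
    have "{x. e \<bullet> x = c} \<in> null_sets lborel"
    proof -
      have "negligible {x. e \<bullet> x = c}" using e by (intro negligible_hyperplane) auto
      then have "emeasure lebesgue {x. e \<bullet> x = c} = 0" by (simp add: negligible_iff_null_sets null_setsD1)
      moreover have "{x. e \<bullet> x = c} \<in> sets borel" by measurable
      ultimately show ?thesis by (auto simp: null_sets_def)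
    qed
    then have "{x. e \<bullet> x = c} \<in> null_sets M" using ac by (auto simp: absolutely_continuous_def)
    then have "AE x in M. x \<notin> {x. e \<bullet> x = c}" by (rule AE_not_in)
    with 1 have "AE x in M. False" by eventually_elim simp
    then show False by simp
  qed
  moreover have "0 \<le> (\<integral>x. (x \<bullet> e - c)\<^sup>2 \<partial>M)" by (rule integral_nonneg_AE) simp
  ultimately show ?thesis by linarith
qed

lemma continuous_nonneg_on_closed_rectangle:
  fixes F :: "real \<Rightarrow> real \<Rightarrow> real"
  assumes ij: "i0 < i1" "j0 < j1" and cont: "continuous_on ({i0..i1} \<times> {j0..j1}) (\<lambda>(x, y). F x y)"
    and nn: "\<And>x y. x \<in> {i0<..<i1} \<Longrightarrow> y \<in> {j0<..<j1} \<Longrightarrow> 0 \<le> F x y"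
    and xy: "x \<in> {i0..i1}" "y \<in> {j0..j1}"
  shows "0 \<le> F x y"
proof -
  have cl: "closure ({i0<..<i1} \<times> {j0<..<j1}) = {i0..i1} \<times> {j0..j1}" using ij by (simp add: closure_Times)
  show ?thesis
    using continuous_ge_on_closure[of "{i0<..<i1} \<times> {j0<..<j1}" "\<lambda>(x, y). F x y" "(x, y)" 0] cont nn xy
    unfolding cl by auto
qed

text \<open>At interior points the differential condition is the second-order inequality at \<open>\<kappa> = B / (a b)\<close>;
it extends to the boundary by continuity.\<close>

theorem esssup_inequality_necessary:
  fixes M :: "(real ^ 'n) measure"
  assumes rect: "smooth_rectangle i0 i1 j0 j1 H Hx Hy Hxx Hxy Hyy K \<sigma> \<tau>"
    and cont: "continuous_on ({i0..i1} \<times> {j0..j1}) (\<lambda>(x, y). Hx x y)" "continuous_on ({i0..i1} \<times> {j0..j1}) (\<lambda>(x, y). Hy x y)"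
      "continuous_on ({i0..i1} \<times> {j0..j1}) (\<lambda>(x, y). Hxx x y)" "continuous_on ({i0..i1} \<times> {j0..j1}) (\<lambda>(x, y). Hxy x y)"
      "continuous_on ({i0..i1} \<times> {j0..j1}) (\<lambda>(x, y). Hyy x y)"
    and ab: "0 < a" "0 < b"
    and E: "esssup_inequality a b {i0..i1} {j0..j1} H M"
    and M: "prob_space M" and sM: "sets M = sets borel" and ac: "absolutely_continuous lborel M"
    and int: "integrable M (\<lambda>x. norm x ^ 3)"
  shows "\<And>x y. x \<in> {i0..i1} \<Longrightarrow> y \<in> {j0..j1} \<Longrightarrow>
      0 \<le> a\<^sup>2 * (Hxx x y / (Hx x y)\<^sup>2) + (1 - a\<^sup>2 - b\<^sup>2) * (Hxy x y / (Hx x y * Hy x y)) + b\<^sup>2 * (Hyy x y / (Hy x y)\<^sup>2)"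
    and "\<bar>1 - a\<^sup>2 - b\<^sup>2\<bar> \<le> 2 * a * b"
    and "a + b > 1 \<Longrightarrow> (\<integral>x. x \<partial>M) = 0"
proof -
  interpret R: smooth_rectangle i0 i1 j0 j1 H Hx Hy Hxx Hxy Hyy K \<sigma> \<tau> by fact
  interpret prob_space M by fact
  define e :: "real ^ 'n" where "e = (\<chi> i. 1)"
  have e: "e \<noteq> 0" by (simp add: e_def vec_eq_iff)
  have var: "0 < (\<integral>x. (x \<bullet> e - (\<integral>x. x \<bullet> e \<partial>M))\<^sup>2 \<partial>M)"
    using integrable_affine_power(2)[OF M sM int, of 2 e] by (intro absolutely_continuous_variance_pos M sM ac e) auto
  have nz: "Hx x y \<noteq> 0" "Hy x y \<noteq> 0" if "x \<in> {i0..i1}" "y \<in> {j0..j1}" for x y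
    using R.away_from_0[OF that] by auto
  show "0 \<le> a\<^sup>2 * (Hxx x y / (Hx x y)\<^sup>2) + (1 - a\<^sup>2 - b\<^sup>2) * (Hxy x y / (Hx x y * Hy x y)) + b\<^sup>2 * (Hyy x y / (Hy x y)\<^sup>2)"
    if xy: "x \<in> {i0..i1}" "y \<in> {j0..j1}" for x y
  proof (rule continuous_nonneg_on_closed_rectangle[OF R.i_less R.j_less _ _ xy])
    show "continuous_on ({i0..i1} \<times> {j0..j1}) (\<lambda>(x, y). a\<^sup>2 * (Hxx x y / (Hx x y)\<^sup>2)
      + (1 - a\<^sup>2 - b\<^sup>2) * (Hxy x y / (Hx x y * Hy x y)) + b\<^sup>2 * (Hyy x y / (Hy x y)\<^sup>2))"
      using cont nz unfolding case_prod_unfold by (intro continuous_intros) auto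
    fix p r assume pr: "p \<in> {i0<..<i1}" "r \<in> {j0<..<j1}"
    then have nz: "Hx p r \<noteq> 0" "Hy p r \<noteq> 0" using nz[of p r] by auto
    have "\<And>\<kappa>. 0 \<le> \<kappa> * (1 - a\<^sup>2 - b\<^sup>2) + 2 * \<bar>a * b * Hxy p r / (Hx p r * Hy p r) - \<kappa> * a * b\<bar>
        + (a\<^sup>2 * Hxx p r / (Hx p r)\<^sup>2 + b\<^sup>2 * Hyy p r / (Hy p r)\<^sup>2)"
      by (rule R.necessary_second_order[OF pr ab E M sM int var])
    from this[of "Hxy p r / (Hx p r * Hy p r)"]
    show "0 \<le> a\<^sup>2 * (Hxx p r / (Hx p r)\<^sup>2) + (1 - a\<^sup>2 - b\<^sup>2) * (Hxy p r / (Hx p r * Hy p r)) + b\<^sup>2 * (Hyy p r / (Hy p r)\<^sup>2)"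
      by (simp add: mult_ac)
  qed
  have "\<bar>1 - a\<^sup>2 - b\<^sup>2\<bar> \<le> 2 * (a * b)"
    using R.necessary_second_order[OF _ _ ab E M sM int var, of "(i0 + i1) / 2" "(j0 + j1) / 2"] R.i_less R.j_less ab
    by (intro abs_le_if_affine_bound) (auto simp: mult.assoc)
  then show "\<bar>1 - a\<^sup>2 - b\<^sup>2\<bar> \<le> 2 * a * b" by simp
  assume "a + b > 1"
  have "integrable M (\<lambda>x. norm x)"
  proof (rule Bochner_Integration.integrable_bound[of _ "\<lambda>x. 1 + norm x ^ 3"])
    show "AE x in M. norm (norm x) \<le> norm (1 + norm x ^ 3)"
    proof (rule AE_I2)
      fix x :: "real ^ 'n"
      have "norm x \<le> 1 + norm x ^ 3"
      proof (cases "norm x \<le> 1")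
        case True then show ?thesis by (intro order_trans[OF True]) simp
      next
        case False then show ?thesis using power_increasing[of 1 3 "norm x"] by simp
      qed
      then show "norm (norm x) \<le> norm (1 + norm x ^ 3)" by simp
    qed
  qed (use int sM in \<open>auto cong: measurable_cong_sets\<close>)
  then have "integrable M (\<lambda>x. x)" by (subst (asm) integrable_norm_iff) (use sM in \<open>auto cong: measurable_cong_sets\<close>)
  then have "(\<integral>x. x \<partial>M) \<bullet> u = (\<integral>x. x \<bullet> u \<partial>M)" for u by simp
  moreover have "(\<integral>x. x \<bullet> u \<partial>M) = 0" for u
    using R.necessary_mean[OF ab E M sM int, of u] \<open>a + b > 1\<close> by simp
  ultimately show "(\<integral>x. x \<partial>M) = 0" by (metis inner_eq_zero_iff)
qed

section \<open>Centred Gaussian measures\<close>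

lemma nn_integral_lborel_affine:
  fixes f :: "'b::euclidean_space \<Rightarrow> ennreal"
  assumes [measurable]: "f \<in> borel_measurable borel" and k: "k \<noteq> 0"
  shows "(\<integral>\<^sup>+x. f x \<partial>lborel) = ennreal (\<bar>k\<bar> ^ DIM('b)) * (\<integral>\<^sup>+x. f (t + k *\<^sub>R x) \<partial>lborel)"
  by (subst lborel_affine[OF k, of t])
     (simp add: nn_integral_density nn_integral_distr nn_integral_cmult ennreal_power)

lemma lborel_integral_translate:
  fixes f :: "'b::euclidean_space \<Rightarrow> real"
  assumes [measurable]: "f \<in> borel_measurable borel"
  shows "(\<integral>x. f (e + x) \<partial>lborel) = (\<integral>x. f x \<partial>lborel)" "integrable lborel (\<lambda>x. f (e + x)) \<longleftrightarrow> integrable lborel f"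
  using integral_distr[of "(+) e" lborel borel f] integrable_distr_eq[of "(+) e" lborel borel f]
  by (simp_all add: lborel_distr_plus)

text \<open>For \<open>s \<ge> 0\<close> the bound \<open>s\<^sup>2 exp s\<close> follows from \<open>1 - s \<le> exp (-
s)\<close>, for \<open>s < 0\<close> the same inequality gives \<open>s\<^sup>2\<close>. A factor \<open>exp s\<close>
is harmless later because it amounts to a translation of the Gaussian.\<close>

lemma exp_taylor1_le: "\<bar>exp s - 1 - s\<bar> \<le> s\<^sup>2 * (1 + exp s)" for s :: real
proof -
  have 0: "0 \<le> exp s - 1 - s" using exp_ge_add_one_self[of s] by linarith
  have "exp s - 1 - s \<le> s\<^sup>2 * (1 + exp s)"
  proof (cases "0 \<le> s")
    case True
    have "(1 - s) * exp s \<le> exp (- s) * exp s" using exp_ge_add_one_self[of "- s"] by (intro mult_right_mono) auto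
    then have *: "exp s - 1 \<le> s * exp s" by (simp add: exp_minus algebra_simps)
    have "exp s - 1 - s \<le> s * (exp s - 1)" using * by (simp add: algebra_simps)
    also have "\<dots> \<le> s * (s * exp s)" using * True by (rule mult_left_mono)
    also have "\<dots> \<le> s\<^sup>2 * (1 + exp s)" by (simp add: power2_eq_square algebra_simps)
    finally show ?thesis .
  next
    case False
    have "exp s * (1 - s) \<le> exp s * exp (- s)" using exp_ge_add_one_self[of "- s"] by (intro mult_left_mono) auto
    also have "\<dots> = 1" by (simp flip: exp_add)
    finally have "exp s \<le> 1 / (1 - s)" using False by (simp add: field_simps)
    then have "exp s - 1 - s \<le> 1 / (1 - s) - 1 - s" by simp
    also have "\<dots> = s\<^sup>2 / (1 - s)" using False by (simp add: field_simps power2_eq_square)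
    also have "\<dots> \<le> s\<^sup>2 / 1" using False by (intro divide_left_mono) auto
    also have "\<dots> \<le> s\<^sup>2 * (1 + exp s)" by (simp add: algebra_simps)
    finally show ?thesis .
  qed
  with 0 show ?thesis by simp
qed

text \<open>The class of functions with bounded Lipschitz gradient, usually written C with superscript 1,1, in the form in which
it enters a single time step: first-order Taylor expansion at every point with uniform constants.\<close>

definition C11 :: "real \<Rightarrow> ('b::real_inner \<Rightarrow> real) \<Rightarrow> bool" where
  "C11 L f \<longleftrightarrow> (\<exists>D. \<forall>u. norm (D u) \<le> L \<and>
     (\<forall>e. \<bar>f (u + e) - f u\<bar> \<le> L * norm e \<and> \<bar>f (u + e) - f u - D u \<bullet> e\<bar> \<le> L * (norm e)\<^sup>2))"

text \<open>In the application \<open>\<gamma>\<close> is a translate of the given Gaussian measure, from which it inherits the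
finite third moment. The normalising constant is \<open>exp c\<close>.\<close>

locale centered_gaussian =
  fixes A :: "real ^ 'n ^ 'n" and c :: real and \<gamma> :: "(real ^ 'n) measure"
  assumes A_sym: "transpose A = A" and A_pos: "\<And>x. x \<noteq> 0 \<Longrightarrow> 0 < x \<bullet> (A *v x)"
    and gamma: "\<gamma> = density lborel (\<lambda>x. ennreal (exp (- (x \<bullet> (A *v x)) + c)))"
    and prob: "prob_space \<gamma>"
    and moment3: "integrable \<gamma> (\<lambda>x. norm x ^ 3)"
begin

sublocale prob_space \<gamma> by (rule prob)
sublocale pair: pair_prob_space \<gamma> \<gamma> ..

definition \<rho> :: "real ^ 'n \<Rightarrow> real" where "\<rho> x = exp (- (x \<bullet> (A *v x)) + c)"

lemma \<rho>_measurable[measurable]: "\<rho> \<in> borel_measurable borel"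
  unfolding \<rho>_def by (intro borel_measurable_continuous_onI continuous_intros linear_continuous_on_compose matrix_vector_mul_linear)

lemma \<rho>_pos: "0 < \<rho> x" by (simp add: \<rho>_def)

lemma gamma_density: "\<gamma> = density lborel (\<lambda>x. ennreal (\<rho> x))"
  unfolding \<rho>_def by (rule gamma)

lemma sets_gamma[measurable_cong, simp]: "sets \<gamma> = sets borel"
  by (simp add: gamma_density)

lemma space_gamma[simp]: "space \<gamma> = UNIV"
  by (simp add: gamma_density)

lemma inner_A_commute: "x \<bullet> (A *v y) = y \<bullet> (A *v x)"
  by (metis dot_lmul_matrix inner_commute A_sym transpose_matrix_vector)

lemma quad_affine: "(s *\<^sub>R x + t *\<^sub>R y) \<bullet> (A *v (s *\<^sub>R x + t *\<^sub>R y)) = s\<^sup>2 * (x \<bullet> (A *v x)) + 2 * s * t * (x \<bullet> (A *v y)) + t\<^sup>2 * (y \<bullet> (A *v y))"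
  using inner_A_commute[of x y]
  by (simp add: matrix_vector_right_distrib matrix_vector_mult_scaleR inner_add_left inner_add_right power2_eq_square algebra_simps)

lemma \<rho>_uminus: "\<rho> (- x) = \<rho> x"
  using quad_affine[of "-1" x 0 0] by (simp add: \<rho>_def)

lemma nn_integral_\<rho>: "(\<integral>\<^sup>+x. ennreal (\<rho> x) \<partial>lborel) = 1"
  using emeasure_space_1 by (simp add: gamma_density emeasure_density)

lemma nn_integral_gamma: "f \<in> borel_measurable borel \<Longrightarrow> (\<integral>\<^sup>+x. f x \<partial>\<gamma>) = (\<integral>\<^sup>+x. ennreal (\<rho> x) * f x \<partial>lborel)"
  unfolding gamma_density by (subst nn_integral_density) auto

lemma \<rho>_rotate:
  assumes "\<alpha>\<^sup>2 + \<beta>\<^sup>2 = 1" "\<beta> \<noteq> 0"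
  shows "\<rho> x * \<rho> (- (\<alpha> / \<beta>) *\<^sub>R x + (1 / \<beta>) *\<^sub>R w) = \<rho> w * \<rho> ((1 / \<beta>) *\<^sub>R x + (- (\<alpha> / \<beta>)) *\<^sub>R w)"
proof -
  have \<alpha>: "\<alpha>\<^sup>2 = 1 - \<beta>\<^sup>2" using assms by simp
  have "x \<bullet> (A *v x) + (- (\<alpha> / \<beta>) *\<^sub>R x + (1 / \<beta>) *\<^sub>R w) \<bullet> (A *v (- (\<alpha> / \<beta>) *\<^sub>R x + (1 / \<beta>) *\<^sub>R w))
    = w \<bullet> (A *v w) + ((1 / \<beta>) *\<^sub>R x + (- (\<alpha> / \<beta>)) *\<^sub>R w) \<bullet> (A *v ((1 / \<beta>) *\<^sub>R x + (- (\<alpha> / \<beta>)) *\<^sub>R w))"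
    unfolding quad_affine using assms(2) by (simp add: power_divide \<alpha> field_simps)
  then show ?thesis unfolding \<rho>_def by (simp flip: exp_add)
qed

text \<open>Completing the square, \<open>\<rho> x * \<rho> y\<close> with \<open>w = \<alpha> x + \<beta> y\<close> equals
\<open>\<rho> w * \<rho> ((x - \<alpha> w) / \<beta>)\<close>. So after the substitution \<open>y = (w - \<alpha> x) /
\<beta>\<close> and an exchange of the integrals, the integral over \<open>x\<close> is that of a rescaled density.
This one fact supplies symmetry, the semigroup law and the correlated pair.\<close>

lemma distr_rotation:
  assumes ab: "\<alpha>\<^sup>2 + \<beta>\<^sup>2 = 1"
  shows "distr (\<gamma> \<Otimes>\<^sub>M \<gamma>) borel (\<lambda>(x, y). \<alpha> *\<^sub>R x + \<beta> *\<^sub>R y) = \<gamma>"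
proof -
  have main: "(\<integral>\<^sup>+x. \<integral>\<^sup>+y. F (\<alpha> *\<^sub>R x + \<beta> *\<^sub>R y) \<partial>\<gamma> \<partial>\<gamma>) = (\<integral>\<^sup>+x. F x \<partial>\<gamma>)"
    if F[measurable]: "F \<in> borel_measurable borel" for F
  proof (cases "\<beta> = 0")
    case True
    then have \<alpha>: "\<alpha> \<noteq> 0" "\<bar>\<alpha>\<bar> = 1" "\<alpha> = 1 \<or> \<alpha> = -1" using ab by (auto simp: power2_eq_1_iff)
    have \<rho>: "\<rho> (\<alpha> *\<^sub>R x) = \<rho> x" for x using \<alpha>(3) by (auto simp: \<rho>_uminus)
    have "(\<integral>\<^sup>+x. F x \<partial>\<gamma>) = (\<integral>\<^sup>+x. ennreal (\<rho> x) * F x \<partial>lborel)" by (rule nn_integral_gamma) measurable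
    also have "\<dots> = (\<integral>\<^sup>+x. ennreal (\<rho> x) * F (\<alpha> *\<^sub>R x) \<partial>lborel)"
      by (subst nn_integral_lborel_affine[OF _ \<alpha>(1), of _ 0]) (simp_all add: \<alpha>(2) \<rho>)
    also have "\<dots> = (\<integral>\<^sup>+x. F (\<alpha> *\<^sub>R x) \<partial>\<gamma>)" by (rule nn_integral_gamma[symmetric]) measurable
    also have "\<dots> = (\<integral>\<^sup>+x. \<integral>\<^sup>+y. F (\<alpha> *\<^sub>R x + \<beta> *\<^sub>R y) \<partial>\<gamma> \<partial>\<gamma>)" using True emeasure_space_1 by simp
    finally show ?thesis ..
  next
    case False
    let ?N = "DIM(real ^ 'n)"
    let ?k = "ennreal (\<bar>1 / \<beta>\<bar> ^ ?N)"
    define y' where "y' x w = - (\<alpha> / \<beta>) *\<^sub>R x + (1 / \<beta>) *\<^sub>R w" for x w :: "real ^ 'n"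
    define x' where "x' x w = (1 / \<beta>) *\<^sub>R x + (- (\<alpha> / \<beta>)) *\<^sub>R w" for x w :: "real ^ 'n"
    have y'_m[measurable]: "(\<lambda>z. y' (u z) (v z)) \<in> borel_measurable N"
      if [measurable]: "u \<in> borel_measurable N" "v \<in> borel_measurable N" for u v :: "'c \<Rightarrow> real ^ 'n" and N
      unfolding y'_def by measurable
    have x'_m[measurable]: "(\<lambda>z. x' (u z) (v z)) \<in> borel_measurable N"
      if [measurable]: "u \<in> borel_measurable N" "v \<in> borel_measurable N" for u v :: "'c \<Rightarrow> real ^ 'n" and N
      unfolding x'_def by measurable
    have F'[measurable]: "(\<lambda>x. F (fst x)) \<in> borel_measurable (lborel \<Otimes>\<^sub>M lborel)"
      by (rule measurable_compose[OF measurable_fst]) simp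
    have inner: "(\<integral>\<^sup>+y. F (\<alpha> *\<^sub>R x + \<beta> *\<^sub>R y) \<partial>\<gamma>) = ?k * (\<integral>\<^sup>+w. ennreal (\<rho> (y' x w)) * F w \<partial>lborel)" for x
    proof -
      have "(\<integral>\<^sup>+y. F (\<alpha> *\<^sub>R x + \<beta> *\<^sub>R y) \<partial>\<gamma>) = (\<integral>\<^sup>+y. ennreal (\<rho> y) * F (\<alpha> *\<^sub>R x + \<beta> *\<^sub>R y) \<partial>lborel)"
        by (rule nn_integral_gamma) measurable
      also have "\<dots> = ?k * (\<integral>\<^sup>+w. ennreal (\<rho> (y' x w)) * F (\<alpha> *\<^sub>R x + \<beta> *\<^sub>R y' x w) \<partial>lborel)"
        unfolding y'_def using False by (intro nn_integral_lborel_affine) auto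
      also have "(\<lambda>w. \<alpha> *\<^sub>R x + \<beta> *\<^sub>R y' x w) = (\<lambda>w. w)"
        using False by (simp add: y'_def scaleR_diff_right scaleR_add_right)
      finally show ?thesis by (simp add: fun_eq_iff)
    qed
    have mass: "?k * (\<integral>\<^sup>+x. ennreal (\<rho> (x' x w)) \<partial>lborel) = 1" for w
    proof -
      have "x' (\<alpha> *\<^sub>R w + \<beta> *\<^sub>R x) w = x" for x
        using False by (simp add: x'_def scaleR_diff_right scaleR_add_right)
      then have "(\<integral>\<^sup>+x. ennreal (\<rho> (x' x w)) \<partial>lborel) = ennreal (\<bar>\<beta>\<bar> ^ ?N) * (\<integral>\<^sup>+x. ennreal (\<rho> x) \<partial>lborel)"
        by (subst nn_integral_lborel_affine[OF _ False, of _ "\<alpha> *\<^sub>R w"]) auto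
      then show ?thesis using False by (simp add: nn_integral_\<rho> power_divide flip: ennreal_mult)
    qed
    have "(\<integral>\<^sup>+x. \<integral>\<^sup>+y. F (\<alpha> *\<^sub>R x + \<beta> *\<^sub>R y) \<partial>\<gamma> \<partial>\<gamma>)
      = (\<integral>\<^sup>+x. ennreal (\<rho> x) * (?k * (\<integral>\<^sup>+w. ennreal (\<rho> (y' x w)) * F w \<partial>lborel)) \<partial>lborel)"
      unfolding inner by (rule nn_integral_gamma) measurable
    also have "\<dots> = (\<integral>\<^sup>+x. \<integral>\<^sup>+w. ?k * (ennreal (\<rho> x * \<rho> (y' x w)) * F w) \<partial>lborel \<partial>lborel)"
      by (simp add: nn_integral_cmult[symmetric] ennreal_mult \<rho>_pos less_imp_le mult_ac)
    also have "\<dots> = (\<integral>\<^sup>+w. \<integral>\<^sup>+x. ?k * (ennreal (\<rho> x * \<rho> (y' x w)) * F w) \<partial>lborel \<partial>lborel)"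
      by (rule lborel_pair.Fubini') measurable
    also have "\<dots> = (\<integral>\<^sup>+w. \<integral>\<^sup>+x. (ennreal (\<rho> w) * F w) * (?k * ennreal (\<rho> (x' x w))) \<partial>lborel \<partial>lborel)"
      using \<rho>_rotate[OF ab False] by (simp add: y'_def x'_def ennreal_mult \<rho>_pos less_imp_le mult_ac)
    also have "\<dots> = (\<integral>\<^sup>+w. ennreal (\<rho> w) * F w * (?k * (\<integral>\<^sup>+x. ennreal (\<rho> (x' x w)) \<partial>lborel)) \<partial>lborel)"
      by (simp add: nn_integral_cmult)
    also have "\<dots> = (\<integral>\<^sup>+x. F x \<partial>\<gamma>)" unfolding mass by (simp add: nn_integral_gamma)
    finally show ?thesis .
  qed
  show ?thesis
  proof (rule measure_eqI)
    fix B assume "B \<in> sets (distr (\<gamma> \<Otimes>\<^sub>M \<gamma>) borel (\<lambda>(x, y). \<alpha> *\<^sub>R x + \<beta> *\<^sub>R y))"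
    then have B[measurable]: "B \<in> sets borel" by simp
    have "emeasure (distr (\<gamma> \<Otimes>\<^sub>M \<gamma>) borel (\<lambda>(x, y). \<alpha> *\<^sub>R x + \<beta> *\<^sub>R y)) B
      = (\<integral>\<^sup>+z. indicator B z \<partial>distr (\<gamma> \<Otimes>\<^sub>M \<gamma>) borel (\<lambda>(x, y). \<alpha> *\<^sub>R x + \<beta> *\<^sub>R y))" by simp
    also have "\<dots> = (\<integral>\<^sup>+z. indicator B (\<alpha> *\<^sub>R fst z + \<beta> *\<^sub>R snd z) \<partial>(\<gamma> \<Otimes>\<^sub>M \<gamma>))"
      by (subst nn_integral_distr) (simp_all add: case_prod_unfold)
    also have "\<dots> = (\<integral>\<^sup>+x. \<integral>\<^sup>+y. indicator B (\<alpha> *\<^sub>R x + \<beta> *\<^sub>R y) \<partial>\<gamma> \<partial>\<gamma>)"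
      by (subst nn_integral_fst[symmetric]) simp_all
    also have "\<dots> = (\<integral>\<^sup>+x. indicator B x \<partial>\<gamma>)" by (rule main) measurable
    also have "\<dots> = emeasure \<gamma> B" by simp
    finally show "emeasure (distr (\<gamma> \<Otimes>\<^sub>M \<gamma>) borel (\<lambda>(x, y). \<alpha> *\<^sub>R x + \<beta> *\<^sub>R y)) B = emeasure \<gamma> B" .
  qed simp
qed

lemma integral_rotation:
  fixes F :: "real ^ 'n \<Rightarrow> real"
  assumes "\<alpha>\<^sup>2 + \<beta>\<^sup>2 = 1" and [measurable]: "F \<in> borel_measurable borel"
  shows "(\<integral>z. F (\<alpha> *\<^sub>R fst z + \<beta> *\<^sub>R snd z) \<partial>(\<gamma> \<Otimes>\<^sub>M \<gamma>)) = (\<integral>x. F x \<partial>\<gamma>)"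
    and "integrable (\<gamma> \<Otimes>\<^sub>M \<gamma>) (\<lambda>z. F (\<alpha> *\<^sub>R fst z + \<beta> *\<^sub>R snd z)) \<longleftrightarrow> integrable \<gamma> F"
proof -
  let ?T = "\<lambda>(x, y). \<alpha> *\<^sub>R x + \<beta> *\<^sub>R y"
  have T: "?T \<in> \<gamma> \<Otimes>\<^sub>M \<gamma> \<rightarrow>\<^sub>M borel" by measurable
  have F: "F \<in> borel_measurable (distr (\<gamma> \<Otimes>\<^sub>M \<gamma>) borel ?T)" by simp
  show "(\<integral>z. F (\<alpha> *\<^sub>R fst z + \<beta> *\<^sub>R snd z) \<partial>(\<gamma> \<Otimes>\<^sub>M \<gamma>)) = (\<integral>x. F x \<partial>\<gamma>)"
    using integral_distr[OF T assms(2)] unfolding distr_rotation[OF assms(1)] by (simp add: case_prod_unfold)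
  show "integrable (\<gamma> \<Otimes>\<^sub>M \<gamma>) (\<lambda>z. F (\<alpha> *\<^sub>R fst z + \<beta> *\<^sub>R snd z)) \<longleftrightarrow> integrable \<gamma> F"
    using integrable_distr_eq[OF T assms(2)] unfolding distr_rotation[OF assms(1)] by (simp add: case_prod_unfold)
qed

lemma integral_reflect:
  fixes F :: "real ^ 'n \<Rightarrow> real"
  assumes [measurable]: "F \<in> borel_measurable borel"
  shows "(\<integral>x. F (- x) \<partial>\<gamma>) = (\<integral>x. F x \<partial>\<gamma>)"
proof -
  have "(\<integral>x. F (- x) \<partial>\<gamma>) = (\<integral>z. F (- (1 *\<^sub>R fst z + 0 *\<^sub>R snd z)) \<partial>(\<gamma> \<Otimes>\<^sub>M \<gamma>))"
    by (rule integral_rotation(1)[symmetric]) simp_all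
  also have "\<dots> = (\<integral>z. F ((-1) *\<^sub>R fst z + 0 *\<^sub>R snd z) \<partial>(\<gamma> \<Otimes>\<^sub>M \<gamma>))" by simp
  also have "\<dots> = (\<integral>x. F x \<partial>\<gamma>)" by (rule integral_rotation(1)) simp_all
  finally show ?thesis .
qed

lemma mean_zero: "(\<integral>x. x \<bullet> e \<partial>\<gamma>) = 0"
  using integral_reflect[of "\<lambda>x. x \<bullet> e"] by simp

lemma moments: "k \<le> 3 \<Longrightarrow> integrable \<gamma> (\<lambda>x. norm x ^ k)"
proof (rule Bochner_Integration.integrable_bound[of _ "\<lambda>x. 1 + norm x ^ 3"])
  assume "k \<le> 3"
  have "norm x ^ k \<le> 1 + norm x ^ 3" for x :: "real ^ 'n"
  proof (cases "norm x \<le> 1")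
    case True
    then have "norm x ^ k \<le> 1" by (simp add: power_le_one)
    then show ?thesis by (rule order_trans) simp
  next
    case False
    then have "norm x ^ k \<le> norm x ^ 3" using \<open>k \<le> 3\<close> by (intro power_increasing) auto
    then show ?thesis by simp
  qed
  then show "AE x in \<gamma>. norm (norm x ^ k) \<le> norm (1 + norm x ^ 3)" by simp
qed (use moment3 in simp_all)

text \<open>Translation by \<open>e\<close> multiplies the density by an exponential, as \<open>\<rho> (x - e) / \<rho> x\<close>
shows.\<close>

lemma cameron_martin:
  fixes F :: "real ^ 'n \<Rightarrow> real"
  assumes [measurable]: "F \<in> borel_measurable borel"
  shows "(\<integral>x. F (e + x) \<partial>\<gamma>) = (\<integral>x. exp (2 * (x \<bullet> (A *v e)) - e \<bullet> (A *v e)) * F x \<partial>\<gamma>)" (is ?eq)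
    and "integrable \<gamma> (\<lambda>x. F (e + x)) \<longleftrightarrow> integrable \<gamma> (\<lambda>x. exp (2 * (x \<bullet> (A *v e)) - e \<bullet> (A *v e)) * F x)" (is ?int)
proof -
  let ?w = "\<lambda>x. exp (2 * (x \<bullet> (A *v e)) - e \<bullet> (A *v e))"
  have \<rho>: "\<rho> (x - e) = \<rho> x * ?w x" for x
    using quad_affine[of 1 x "-1" e] by (simp add: \<rho>_def algebra_simps flip: exp_add)
  have [measurable]: "?w \<in> borel_measurable borel" by simp
  have F: "(\<lambda>x. \<rho> (x - e) * F x) \<in> borel_measurable borel" by simp
  have d: "(\<integral>x. G x \<partial>\<gamma>) = (\<integral>x. \<rho> x * G x \<partial>lborel)" "integrable \<gamma> G \<longleftrightarrow> integrable lborel (\<lambda>x. \<rho> x * G x)"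
    if [measurable]: "G \<in> borel_measurable borel" for G :: "real ^ 'n \<Rightarrow> real"
    unfolding gamma_density by (simp_all add: integral_density integrable_density \<rho>_pos less_imp_le)
  show ?eq
    using lborel_integral_translate(1)[OF F, of e] by (simp add: d \<rho> mult_ac)
  show ?int
    using lborel_integral_translate(2)[OF F, of e] by (simp add: d \<rho> mult_ac)
qed

end

section \<open>The heat semigroup\<close>

text \<open>The gradient is Lipschitz: expanding \<open>f (u + x + w)\<close> around \<open>u\<close> and, through \<open>u +
x\<close>, in two stages gives \<open>(D (u + x) - D u) \<bullet> w\<close> up to \<open>6 L (norm x)\<^sup>2\<close>
whenever \<open>norm w = norm x\<close>; then \<open>w\<close> is taken parallel to \<open>D (u + x) - D u\<close>.\<close>

lemma C11_gradient:
  fixes f :: "'b::real_inner \<Rightarrow> real"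
  assumes "C11 L f"
  shows "0 \<le> L" "\<exists>D. \<forall>u. norm (D u) \<le> L \<and>
     (\<forall>e. \<bar>f (u + e) - f u\<bar> \<le> L * norm e \<and> \<bar>f (u + e) - f u - D u \<bullet> e\<bar> \<le> L * (norm e)\<^sup>2) \<and>
     (\<forall>x e. \<bar>f (u + x + e) - f (u + x) - D u \<bullet> e\<bar> \<le> 6 * L * norm x * norm e + L * (norm e)\<^sup>2)"
proof -
  obtain D where D: "\<And>u. norm (D u) \<le> L" "\<And>u e. \<bar>f (u + e) - f u\<bar> \<le> L * norm e"
    "\<And>u e. \<bar>f (u + e) - f u - D u \<bullet> e\<bar> \<le> L * (norm e)\<^sup>2"
    using assms unfolding C11_def by blast
  show L0: "0 \<le> L" using D(1)[of undefined] norm_ge_zero order_trans by blast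
  have lip: "norm (D (u + x) - D u) \<le> 6 * L * norm x" for u x
  proof (cases "x = 0 \<or> D (u + x) - D u = 0")
    case True
    then show ?thesis using L0 by auto
  next
    case False
    define v where "v = D (u + x) - D u"
    define w where "w = (norm x / norm v) *\<^sub>R v"
    have v0: "v \<noteq> 0" using False by (simp add: v_def)
    have nw: "norm w = norm x" using v0 by (simp add: w_def)
    have vw: "v \<bullet> w = norm v * norm x" using v0 by (simp add: w_def power2_norm_eq_inner[symmetric] power2_eq_square)
    have "L * (norm (x + w))\<^sup>2 \<le> L * (2 * norm x)\<^sup>2"
      using norm_triangle_ineq[of x w] nw L0 by (intro mult_left_mono power_mono) auto
    then have 1: "\<bar>f (u + (x + w)) - f u - D u \<bullet> (x + w)\<bar> \<le> 4 * (L * (norm x)\<^sup>2)"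
      using D(3)[of u "x + w"] by (simp add: power_mult_distrib)
    have 2: "\<bar>f (u + x) - f u - D u \<bullet> x\<bar> \<le> L * (norm x)\<^sup>2" by (rule D(3))
    have 3: "\<bar>f (u + x + w) - f (u + x) - D (u + x) \<bullet> w\<bar> \<le> L * (norm x)\<^sup>2" using D(3)[of "u + x" w] by (simp add: nw)
    have "D u \<bullet> (x + w) = D u \<bullet> x + D u \<bullet> w" "v \<bullet> w = D (u + x) \<bullet> w - D u \<bullet> w"
      by (simp_all add: v_def inner_add_right inner_diff_left)
    then have "v \<bullet> w \<le> 6 * (L * (norm x)\<^sup>2)" using 1 2 3 unfolding add.assoc[symmetric] by linarith
    then have "norm v * norm x \<le> (6 * L * norm x) * norm x" by (simp add: vw power2_eq_square)
    then show ?thesis using False unfolding v_def[symmetric] by (simp add: mult_le_cancel_right)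
  qed
  have "\<bar>f (u + x + e) - f (u + x) - D u \<bullet> e\<bar> \<le> 6 * L * norm x * norm e + L * (norm e)\<^sup>2" for u x e
  proof -
    have "\<bar>(D (u + x) - D u) \<bullet> e\<bar> \<le> norm (D (u + x) - D u) * norm e" by (rule Cauchy_Schwarz_ineq2)
    also have "\<dots> \<le> 6 * L * norm x * norm e" using lip by (intro mult_right_mono) auto
    finally show ?thesis using D(3)[of "u + x" e] by (simp add: inner_diff_left)
  qed
  then show "\<exists>D. \<forall>u. norm (D u) \<le> L \<and>
     (\<forall>e. \<bar>f (u + e) - f u\<bar> \<le> L * norm e \<and> \<bar>f (u + e) - f u - D u \<bullet> e\<bar> \<le> L * (norm e)\<^sup>2) \<and>
     (\<forall>x e. \<bar>f (u + x + e) - f (u + x) - D u \<bullet> e\<bar> \<le> 6 * L * norm x * norm e + L * (norm e)\<^sup>2)"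
    using D by blast
qed

text \<open>\<open>c1\<close>, \<open>c2\<close> and \<open>s1\<close>, \<open>s2\<close> are the cosines and sines of the angles
that the sides \<open>a\<close> and \<open>b\<close> of a triangle make with the third side, of length
\<open>1\<close>. For independent \<open>Z\<close>, \<open>W\<close> the vectors \<open>X = c1 Z + s1 W\<close> and
\<open>Y = c2 Z - s2 W\<close> then satisfy \<open>a X + b Y = Z\<close>.\<close>

lemma triangle_angles:
  fixes a b :: real
  assumes ab: "0 < a" "0 < b" and tri: "\<bar>1 - a\<^sup>2 - b\<^sup>2\<bar> \<le> 2 * a * b"
  shows "\<exists>c1 s1 c2 s2. c1\<^sup>2 + s1\<^sup>2 = 1 \<and> c2\<^sup>2 + s2\<^sup>2 = 1 \<and> a * c1 + b * c2 = 1 \<and> a * s1 = b * s2"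
proof -
  define c1 where "c1 = (1 + a\<^sup>2 - b\<^sup>2) / (2 * a)"
  define c2 where "c2 = (1 + b\<^sup>2 - a\<^sup>2) / (2 * b)"
  \<comment> \<open>Heron: \<open>T\<close> is \<open>16\<close> times the squared area, symmetric in the three sides.\<close>
  define T where "T = (2 * a * b)\<^sup>2 - (1 - a\<^sup>2 - b\<^sup>2)\<^sup>2"
  have "\<bar>1 - a\<^sup>2 - b\<^sup>2\<bar>\<^sup>2 \<le> (2 * a * b)\<^sup>2" using tri by (intro power_mono) auto
  then have T0: "0 \<le> T" by (simp add: T_def)
  define s1 where "s1 = sqrt T / (2 * a)"
  define s2 where "s2 = sqrt T / (2 * b)"
  have "(2 * a)\<^sup>2 * (c1\<^sup>2 + s1\<^sup>2) = (1 + a\<^sup>2 - b\<^sup>2)\<^sup>2 + T"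
    using ab T0 by (simp add: c1_def s1_def power_divide distrib_left)
  also have "\<dots> = (2 * a)\<^sup>2" by (simp add: T_def power2_eq_square algebra_simps)
  finally have 1: "c1\<^sup>2 + s1\<^sup>2 = 1" using ab by simp
  have "(2 * b)\<^sup>2 * (c2\<^sup>2 + s2\<^sup>2) = (1 + b\<^sup>2 - a\<^sup>2)\<^sup>2 + T"
    using ab T0 by (simp add: c2_def s2_def power_divide distrib_left)
  also have "\<dots> = (2 * b)\<^sup>2" by (simp add: T_def power2_eq_square algebra_simps)
  finally have 2: "c2\<^sup>2 + s2\<^sup>2 = 1" using ab by simp
  have "a * c1 = (1 + a\<^sup>2 - b\<^sup>2) / 2" "b * c2 = (1 + b\<^sup>2 - a\<^sup>2) / 2" using ab by (simp_all add: c1_def c2_def)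
  then have 3: "a * c1 + b * c2 = 1" by (simp add: field_simps)
  have 4: "a * s1 = b * s2" using ab by (simp add: s1_def s2_def)
  show ?thesis using 1 2 3 4 by blast
qed

context centered_gaussian
begin

definition heat :: "real \<Rightarrow> (real ^ 'n \<Rightarrow> real) \<Rightarrow> real ^ 'n \<Rightarrow> real" where
  "heat t f u = (\<integral>x. f (u + sqrt t *\<^sub>R x) \<partial>\<gamma>)"

lemma heat_measurable[measurable]:
  assumes [measurable]: "f \<in> borel_measurable borel"
  shows "heat t f \<in> borel_measurable borel"
  unfolding heat_def[abs_def] by measurable

lemma integrable_Icc:
  fixes f :: "real ^ 'n \<Rightarrow> real"
  assumes "f \<in> borel_measurable borel" "\<And>x. f x \<in> {l..u}"
  shows "integrable \<gamma> f" "(\<integral>x. f x \<partial>\<gamma>) \<in> {l..u}"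
  using integral_in_Icc[of f l u] assms by (simp_all cong: measurable_cong_sets)

lemma integrable_Icc_shift:
  fixes f :: "real ^ 'n \<Rightarrow> real"
  assumes [measurable]: "f \<in> borel_measurable borel" and "\<And>x. f x \<in> {l..u}"
  shows "integrable \<gamma> (\<lambda>x. f (v + k *\<^sub>R x))"
  by (rule integrable_Icc(1)[of _ l u]) (use assms(2) in simp_all)

lemma heat_in_Icc:
  assumes [measurable]: "f \<in> borel_measurable borel" and "\<And>x. f x \<in> {l..u}"
  shows "heat t f v \<in> {l..u}"
  unfolding heat_def by (rule integrable_Icc(2)[of _ l u]) (use assms(2) in simp_all)

lemma heat_close:
  assumes fg[measurable]: "f \<in> borel_measurable borel" "g \<in> borel_measurable borel"
    and f: "\<And>x. f x \<in> {l..u}" and g: "\<And>x. g x \<in> {l..u}" and d: "\<And>x. \<bar>f x - g x\<bar> \<le> \<epsilon>"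
  shows "\<bar>heat t f v - heat t g v\<bar> \<le> \<epsilon>"
proof -
  note i = integrable_Icc_shift[OF fg(1) f] integrable_Icc_shift[OF fg(2) g]
  have "heat t f v - heat t g v = (\<integral>x. f (v + sqrt t *\<^sub>R x) - g (v + sqrt t *\<^sub>R x) \<partial>\<gamma>)"
    unfolding heat_def by (rule Bochner_Integration.integral_diff[symmetric]; rule i)
  also have "\<bar>\<dots>\<bar> \<le> (\<integral>x. \<epsilon> \<partial>\<gamma>)"
    by (rule integral_abs_bound_integral) (use i d in \<open>auto intro: Bochner_Integration.integrable_diff\<close>)
  finally show ?thesis using prob_space by simp
qed

lemma heat_0[simp]: "heat 0 f = f"
  using prob_space by (simp add: heat_def fun_eq_iff)

lemma heat_semigroup:
  assumes st: "0 \<le> s" "0 \<le> t" and [measurable]: "f \<in> borel_measurable borel" and f: "\<And>x. f x \<in> {l..u}"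
  shows "heat s (heat t f) = heat (s + t) f"
proof (cases "s + t = 0")
  case True
  then have "s = 0" "t = 0" using st by auto
  then show ?thesis by simp
next
  case False
  then have p: "0 < s + t" using st by linarith
  define k where "k = sqrt (s + t)"
  have k: "0 < k" "k\<^sup>2 = s + t" using p by (simp_all add: k_def)
  define \<alpha> where "\<alpha> = sqrt s / k"
  define \<beta> where "\<beta> = sqrt t / k"
  have ab: "\<alpha>\<^sup>2 + \<beta>\<^sup>2 = 1" using st p by (simp add: \<alpha>_def \<beta>_def power_divide k(2) flip: add_divide_distrib)
  show ?thesis
  proof
    fix v
    let ?g = "\<lambda>x. f (v + k *\<^sub>R x)"
    have eq: "v + sqrt s *\<^sub>R x + sqrt t *\<^sub>R y = v + k *\<^sub>R (\<alpha> *\<^sub>R x + \<beta> *\<^sub>R y)" for x y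
      using k(1) by (simp add: \<alpha>_def \<beta>_def scaleR_add_right)
    have i: "integrable (\<gamma> \<Otimes>\<^sub>M \<gamma>) (\<lambda>z. ?g (\<alpha> *\<^sub>R fst z + \<beta> *\<^sub>R snd z))"
      unfolding integral_rotation(2)[OF ab, of ?g, simplified] by (rule integrable_Icc_shift[OF _ f]) simp
    have "heat s (heat t f) v = (\<integral>x. \<integral>y. ?g (\<alpha> *\<^sub>R x + \<beta> *\<^sub>R y) \<partial>\<gamma> \<partial>\<gamma>)"
      unfolding heat_def eq ..
    also have "\<dots> = (\<integral>z. ?g (\<alpha> *\<^sub>R fst z + \<beta> *\<^sub>R snd z) \<partial>(\<gamma> \<Otimes>\<^sub>M \<gamma>))"
      using pair.integral_fst'[OF i] by simp
    also have "\<dots> = heat (s + t) f v" unfolding heat_def k_def[symmetric] by (rule integral_rotation(1)[OF ab]) simp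
    finally show "heat s (heat t f) v = heat (s + t) f v" .
  qed
qed

lemma A_bounded: "\<exists>N\<ge>0. \<forall>x. norm (A *v x) \<le> N * norm x"
  using bounded_linear.nonneg_bounded[OF matrix_vector_mul_bounded_linear[of A]] by (auto simp: mult.commute)

text \<open>The linearised Cameron--Martin weight is accurate to second order in mean. The remainder of the exponential is at most
\<open>S\<^sup>2 + S\<^sup>2 exp S\<close> with \<open>S\<close> of order \<open>norm e\<close>, and the second term
is the first one for a translated Gaussian, so second moments suffice.\<close>

lemma gaussian_weight_expansion:
  "\<exists>C\<ge>0. \<forall>e. norm e \<le> 1 \<longrightarrow>
     integrable \<gamma> (\<lambda>x. exp (2 * (x \<bullet> (A *v e)) - e \<bullet> (A *v e)) - 1 - 2 * (x \<bullet> (A *v e))) \<and>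
     (\<integral>x. \<bar>exp (2 * (x \<bullet> (A *v e)) - e \<bullet> (A *v e)) - 1 - 2 * (x \<bullet> (A *v e))\<bar> \<partial>\<gamma>) \<le> C * (norm e)\<^sup>2"
proof -
  obtain N where N0: "0 \<le> N" and N: "\<And>x. norm (A *v x) \<le> N * norm x" using A_bounded by blast
  define m where "m = (\<integral>x. (2 * norm x + 1)\<^sup>2 \<partial>\<gamma>)"
  have i2: "integrable \<gamma> (\<lambda>x. (2 * norm x + 1)\<^sup>2)"
  proof -
    have "(\<lambda>x :: real ^ 'n. (2 * norm x + 1)\<^sup>2) = (\<lambda>x. 4 * norm x ^ 2 + 4 * norm x ^ 1 + 1)"
      by (auto simp: power2_eq_square algebra_simps)
    then show ?thesis using moments[of 1] moments[of 2] by simp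
  qed
  have m0: "0 \<le> m" unfolding m_def by (rule integral_nonneg_AE) simp
  define C where "C = 2 * (N\<^sup>2 * m) + N"
  have C0: "0 \<le> C" using N0 m0 by (simp add: C_def)
  have "integrable \<gamma> (\<lambda>x. exp (2 * (x \<bullet> (A *v e)) - e \<bullet> (A *v e)) - 1 - 2 * (x \<bullet> (A *v e))) \<and>
     (\<integral>x. \<bar>exp (2 * (x \<bullet> (A *v e)) - e \<bullet> (A *v e)) - 1 - 2 * (x \<bullet> (A *v e))\<bar> \<partial>\<gamma>) \<le> C * (norm e)\<^sup>2"
    if e: "norm e \<le> 1" for e
  proof -
    define n where "n = norm e"
    have n: "0 \<le> n" "n \<le> 1" using e by (auto simp: n_def)
    define \<tau> where "\<tau> = e \<bullet> (A *v e)"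
    define S where "S x = 2 * (x \<bullet> (A *v e)) - \<tau>" for x
    have xA: "\<bar>x \<bullet> (A *v e)\<bar> \<le> N * n * norm x" for x
    proof -
      have "\<bar>x \<bullet> (A *v e)\<bar> \<le> norm x * norm (A *v e)" by (rule Cauchy_Schwarz_ineq2)
      also have "\<dots> \<le> norm x * (N * n)" using N[of e] by (intro mult_left_mono) (auto simp: n_def)
      finally show ?thesis by (simp add: mult_ac)
    qed
    have \<tau>: "\<bar>\<tau>\<bar> \<le> N * n\<^sup>2" using xA[of e] by (simp add: \<tau>_def n_def power2_eq_square mult_ac)
    have "N * n\<^sup>2 \<le> N * n" using n N0 by (intro mult_left_mono) (auto simp: power2_eq_square mult_left_le)
    then have \<tau>': "\<bar>\<tau>\<bar> \<le> N * n" using \<tau> by linarith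
    have sq: "(2 * (x \<bullet> (A *v e)) + k)\<^sup>2 \<le> n\<^sup>2 * N\<^sup>2 * (2 * norm x + 1)\<^sup>2" if "\<bar>k\<bar> \<le> N * n" for x k
    proof -
      have "\<bar>2 * (x \<bullet> (A *v e)) + k\<bar> \<le> n * N * (2 * norm x + 1)"
        using xA[of x] that by (simp add: algebra_simps)
      then have "\<bar>2 * (x \<bullet> (A *v e)) + k\<bar>\<^sup>2 \<le> (n * N * (2 * norm x + 1))\<^sup>2" by (rule power_mono) simp
      then show ?thesis by (simp add: power_mult_distrib)
    qed
    have [measurable]: "S \<in> borel_measurable borel" unfolding S_def by measurable
    have bnd_int: "integrable \<gamma> F \<and> (\<integral>x. F x \<partial>\<gamma>) \<le> n\<^sup>2 * N\<^sup>2 * m"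
      if [measurable]: "F \<in> borel_measurable borel" and F: "\<And>x. 0 \<le> F x" "\<And>x. F x \<le> n\<^sup>2 * N\<^sup>2 * (2 * norm x + 1)\<^sup>2" for F
    proof
      have i: "integrable \<gamma> (\<lambda>x. n\<^sup>2 * N\<^sup>2 * (2 * norm x + 1)\<^sup>2)" using i2 by simp
      show F': "integrable \<gamma> F"
        by (rule Bochner_Integration.integrable_bound[OF i]) (use F in \<open>auto intro!: order_trans[OF _ abs_ge_self]\<close>)
      have "(\<integral>x. F x \<partial>\<gamma>) \<le> (\<integral>x. n\<^sup>2 * N\<^sup>2 * (2 * norm x + 1)\<^sup>2 \<partial>\<gamma>)" by (rule integral_mono[OF F' i F(2)])
      then show "(\<integral>x. F x \<partial>\<gamma>) \<le> n\<^sup>2 * N\<^sup>2 * m" by (simp add: m_def)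
    qed
    have I1: "integrable \<gamma> (\<lambda>x. (S x)\<^sup>2)" "(\<integral>x. (S x)\<^sup>2 \<partial>\<gamma>) \<le> n\<^sup>2 * N\<^sup>2 * m"
      using bnd_int[of "\<lambda>x. (S x)\<^sup>2"] sq[of "- \<tau>"] \<tau>' by (auto simp: S_def)
    have Se: "S (e + x) = 2 * (x \<bullet> (A *v e)) + \<tau>" for x by (simp add: S_def \<tau>_def inner_add_left)
    have I2: "integrable \<gamma> (\<lambda>x. (S (e + x))\<^sup>2)" "(\<integral>x. (S (e + x))\<^sup>2 \<partial>\<gamma>) \<le> n\<^sup>2 * N\<^sup>2 * m"
      using bnd_int[of "\<lambda>x. (S (e + x))\<^sup>2"] sq[of \<tau>] \<tau>' by (auto simp: Se)
    have I3: "integrable \<gamma> (\<lambda>x. exp (S x) * (S x)\<^sup>2)" "(\<integral>x. exp (S x) * (S x)\<^sup>2 \<partial>\<gamma>) \<le> n\<^sup>2 * N\<^sup>2 * m"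
      using cameron_martin[of "\<lambda>x. (S x)\<^sup>2" e] I2 by (simp_all add: S_def \<tau>_def)
    define E where "E x = exp (S x) - 1 - 2 * (x \<bullet> (A *v e))" for x
    have [measurable]: "E \<in> borel_measurable borel" unfolding E_def by measurable
    have E: "\<bar>E x\<bar> \<le> (S x)\<^sup>2 + exp (S x) * (S x)\<^sup>2 + N * n\<^sup>2" for x
    proof -
      have "E x = (exp (S x) - 1 - S x) - \<tau>" by (simp add: E_def S_def)
      then have "\<bar>E x\<bar> \<le> \<bar>exp (S x) - 1 - S x\<bar> + \<bar>\<tau>\<bar>" by linarith
      also have "\<dots> \<le> (S x)\<^sup>2 * (1 + exp (S x)) + N * n\<^sup>2" using exp_taylor1_le \<tau> by (rule add_mono)
      finally show ?thesis by (simp add: algebra_simps)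
    qed
    have i: "integrable \<gamma> (\<lambda>x. (S x)\<^sup>2 + exp (S x) * (S x)\<^sup>2 + N * n\<^sup>2)" using I1 I3 by simp
    have iE: "integrable \<gamma> E"
      by (rule Bochner_Integration.integrable_bound[OF i]) (use E in \<open>auto intro!: order_trans[OF _ abs_ge_self]\<close>)
    have "(\<integral>x. \<bar>E x\<bar> \<partial>\<gamma>) \<le> (\<integral>x. (S x)\<^sup>2 + exp (S x) * (S x)\<^sup>2 + N * n\<^sup>2 \<partial>\<gamma>)"
      by (rule integral_mono[OF _ i E]) (use iE in simp)
    also have "\<dots> = (\<integral>x. (S x)\<^sup>2 \<partial>\<gamma>) + (\<integral>x. exp (S x) * (S x)\<^sup>2 \<partial>\<gamma>) + N * n\<^sup>2"
      using I1 I3 prob_space by simp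
    also have "\<dots> \<le> n\<^sup>2 * N\<^sup>2 * m + n\<^sup>2 * N\<^sup>2 * m + N * n\<^sup>2" using I1 I3 by linarith
    also have "\<dots> = C * n\<^sup>2" by (simp add: C_def algebra_simps)
    finally show ?thesis using iE by (simp add: E_def[abs_def] S_def \<tau>_def n_def)
  qed
  then show ?thesis using C0 by blast
qed

text \<open>Translating \<open>heat \<delta> f\<close> amounts to changing the weight in the integral, so the regularity of the
weight passes to \<open>heat \<delta> f\<close> with constants that depend only on \<open>\<delta>\<close> and on a
bound for \<open>f\<close>. That \<open>L\<close> does not depend on \<open>f\<close> is what makes the errors of all
time steps comparable.\<close>

lemma heat_C11:
  assumes B0: "0 \<le> B" and \<delta>: "0 < \<delta>"
  shows "\<exists>L\<ge>0. \<forall>f. f \<in> borel_measurable borel \<longrightarrow> (\<forall>x. \<bar>f x\<bar> \<le> B) \<longrightarrow> C11 L (heat \<delta> f)"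
proof -
  obtain N where N0: "0 \<le> N" and N: "\<And>x. norm (A *v x) \<le> N * norm x" using A_bounded by blast
  obtain C where C0: "0 \<le> C" and C: "\<And>e. norm e \<le> 1 \<Longrightarrow>
     integrable \<gamma> (\<lambda>x. exp (2 * (x \<bullet> (A *v e)) - e \<bullet> (A *v e)) - 1 - 2 * (x \<bullet> (A *v e)))"
     "\<And>e. norm e \<le> 1 \<Longrightarrow> (\<integral>x. \<bar>exp (2 * (x \<bullet> (A *v e)) - e \<bullet> (A *v e)) - 1 - 2 * (x \<bullet> (A *v e))\<bar> \<partial>\<gamma>) \<le> C * (norm e)\<^sup>2"
    using gaussian_weight_expansion by blast
  define s where "s = sqrt \<delta>"
  have s: "0 < s" using \<delta> by (simp add: s_def)
  define \<mu> where "\<mu> = (\<integral>x. norm x \<partial>\<gamma>)"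
  have i1: "integrable \<gamma> (\<lambda>x. norm x)" using moments[of 1] by simp
  have \<mu>0: "0 \<le> \<mu>" unfolding \<mu>_def by (rule integral_nonneg_AE) simp
  define d where "d = 2 / s * B * N * \<mu>"
  have d0: "0 \<le> d" using s B0 N0 \<mu>0 by (simp add: d_def)
  define L where "L = d + B * C / s + 2 * B / s + B * C / s\<^sup>2 + (2 * B / s\<^sup>2 + d / s)"
  have Lparts: "0 \<le> B * C / s" "0 \<le> 2 * B / s" "0 \<le> B * C / s\<^sup>2" "0 \<le> 2 * B / s\<^sup>2" "0 \<le> d / s"
    using B0 C0 s d0 by auto
  have L0: "0 \<le> L" using Lparts d0 by (simp add: L_def)
  have "C11 L (heat \<delta> f)" if f[measurable]: "f \<in> borel_measurable borel" and fB: "\<And>x. \<bar>f x\<bar> \<le> B" for f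
  proof -
    have fI: "f x \<in> {-B..B}" for x using fB[of x] by (simp add: abs_le_iff)
    define D where "D u = (\<integral>x. (2 / s * f (u + s *\<^sub>R x)) *\<^sub>R (A *v x) \<partial>\<gamma>)" for u
    have [measurable]: "(\<lambda>x. A *v x) \<in> borel_measurable borel"
      by (intro borel_measurable_continuous_onI linear_continuous_on matrix_vector_mul_bounded_linear)
    have nb: "norm ((2 / s * f (u + s *\<^sub>R x)) *\<^sub>R (A *v x)) \<le> 2 / s * B * N * norm x" for u x
    proof -
      have "norm ((2 / s * f (u + s *\<^sub>R x)) *\<^sub>R (A *v x)) = (2 / s) * (\<bar>f (u + s *\<^sub>R x)\<bar> * norm (A *v x))"
        using s by (simp add: abs_mult)
      also have "\<dots> \<le> (2 / s) * (B * (N * norm x))" using s fB N B0 by (intro mult_left_mono mult_mono) auto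
      finally show ?thesis by (simp add: mult_ac)
    qed
    have in1: "integrable \<gamma> (\<lambda>x. 2 / s * B * N * norm x)" using i1 by simp
    have iD: "integrable \<gamma> (\<lambda>x. (2 / s * f (u + s *\<^sub>R x)) *\<^sub>R (A *v x))" for u
    proof (rule Bochner_Integration.integrable_bound[OF in1])
      show "AE x in \<gamma>. norm ((2 / s * f (u + s *\<^sub>R x)) *\<^sub>R (A *v x)) \<le> norm (2 / s * B * N * norm x)"
        unfolding real_norm_def by (rule AE_I2, rule order_trans[OF nb abs_ge_self])
    qed measurable
    have nD: "norm (D u) \<le> d" for u
    proof -
      have "norm (D u) \<le> (\<integral>x. 2 / s * B * N * norm x \<partial>\<gamma>)"
        unfolding D_def by (rule Bochner_Integration.integral_norm_bound_integral[OF iD in1 nb])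
      then show ?thesis by (simp add: d_def \<mu>_def)
    qed
    have De: "\<bar>D u \<bullet> e\<bar> \<le> d * norm e" for u e
      by (rule order_trans[OF Cauchy_Schwarz_ineq2]) (use nD in \<open>auto intro: mult_right_mono\<close>)
    have hb: "\<bar>heat \<delta> f u\<bar> \<le> B" for u
      using heat_in_Icc[OF f fI, of \<delta> u] by (simp add: abs_le_iff)
    have small: "\<bar>heat \<delta> f (u + e) - heat \<delta> f u - D u \<bullet> e\<bar> \<le> B * C * (norm e / s)\<^sup>2" if e: "norm e \<le> s" for u e
    proof -
      define e' where "e' = (1 / s) *\<^sub>R e"
      have ne: "norm e' = norm e / s" "norm e' \<le> 1" using e s by (auto simp: e'_def)
      have se: "s *\<^sub>R e' = e" using s by (simp add: e'_def)
      define F where "F x = f (u + s *\<^sub>R x)" for x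
      have F[measurable]: "F \<in> borel_measurable borel" unfolding F_def by measurable
      have FB: "\<bar>F x\<bar> \<le> B" for x using fB by (simp add: F_def)
      have iF: "integrable \<gamma> F" by (rule integrable_Icc(1)[OF F, of "-B" B]) (use fI in \<open>simp add: F_def\<close>)
      define w where "w x = exp (2 * (x \<bullet> (A *v e')) - e' \<bullet> (A *v e'))" for x
      have hu: "heat \<delta> f u = (\<integral>x. F x \<partial>\<gamma>)" by (simp add: heat_def F_def s_def)
      have "heat \<delta> f (u + e) = (\<integral>x. F (e' + x) \<partial>\<gamma>)"
        by (simp add: heat_def F_def scaleR_add_right se add.assoc flip: s_def)
      also have "\<dots> = (\<integral>x. w x * F x \<partial>\<gamma>)" unfolding w_def by (rule cameron_martin(1)[OF F])
      finally have hue: "heat \<delta> f (u + e) = (\<integral>x. w x * F x \<partial>\<gamma>)" .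
      have iw: "integrable \<gamma> (\<lambda>x. w x * F x)"
        unfolding w_def cameron_martin(2)[OF F, symmetric]
        by (rule integrable_Icc(1)[of _ "-B" B]) (use fI in \<open>simp_all add: F_def\<close>)
      have inner_eq: "(2 / s * f (u + s *\<^sub>R x)) *\<^sub>R (A *v x) \<bullet> e = 2 * (x \<bullet> (A *v e')) * F x" for x
        unfolding F_def e'_def using s inner_A_commute[of x e] by (simp add: matrix_vector_mult_scaleR inner_commute)
      have iDe: "integrable \<gamma> (\<lambda>x. 2 * (x \<bullet> (A *v e')) * F x)"
        using integrable_inner_left[of e \<gamma>, OF iD[of u]] unfolding inner_eq by simp
      have "D u \<bullet> e = (\<integral>x. 2 * (x \<bullet> (A *v e')) * F x \<partial>\<gamma>)"
        using integral_inner_left[of e \<gamma>, OF iD[of u]] unfolding inner_eq D_def by simp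
      then have "heat \<delta> f (u + e) - heat \<delta> f u - D u \<bullet> e = (\<integral>x. w x * F x - F x - 2 * (x \<bullet> (A *v e')) * F x \<partial>\<gamma>)"
        using iw iF iDe by (simp add: hu hue)
      also have "\<bar>\<dots>\<bar> \<le> (\<integral>x. B * \<bar>w x - 1 - 2 * (x \<bullet> (A *v e'))\<bar> \<partial>\<gamma>)"
      proof (rule integral_abs_bound_integral)
        show "integrable \<gamma> (\<lambda>x. w x * F x - F x - 2 * (x \<bullet> (A *v e')) * F x)" using iw iF iDe by simp
        show "integrable \<gamma> (\<lambda>x. B * \<bar>w x - 1 - 2 * (x \<bullet> (A *v e'))\<bar>)"
          using C(1)[OF ne(2)] unfolding w_def by (intro integrable_mult_right integrable_abs)
        fix x
        have "\<bar>w x * F x - F x - 2 * (x \<bullet> (A *v e')) * F x\<bar> = \<bar>F x\<bar> * \<bar>w x - 1 - 2 * (x \<bullet> (A *v e'))\<bar>"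
          by (simp add: algebra_simps flip: abs_mult)
        also have "\<dots> \<le> B * \<bar>w x - 1 - 2 * (x \<bullet> (A *v e'))\<bar>" using FB by (rule mult_right_mono) simp
        finally show "\<bar>w x * F x - F x - 2 * (x \<bullet> (A *v e')) * F x\<bar> \<le> B * \<bar>w x - 1 - 2 * (x \<bullet> (A *v e'))\<bar>" .
      qed
      also have "\<dots> = B * (\<integral>x. \<bar>w x - 1 - 2 * (x \<bullet> (A *v e'))\<bar> \<partial>\<gamma>)" by simp
      also have "\<dots> \<le> B * (C * (norm e')\<^sup>2)" using C(2)[OF ne(2)] B0 unfolding w_def by (rule mult_left_mono)
      finally show ?thesis by (simp add: ne)
    qed
    have "\<bar>heat \<delta> f (u + e) - heat \<delta> f u\<bar> \<le> L * norm e \<and> \<bar>heat \<delta> f (u + e) - heat \<delta> f u - D u \<bullet> e\<bar> \<le> L * (norm e)\<^sup>2" for u e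
    proof (cases "norm e \<le> s")
      case True
      have eq: "B * C * (norm e / s)\<^sup>2 = B * C / s\<^sup>2 * (norm e)\<^sup>2" by (simp add: power_divide)
      have "B * C * (norm e / s)\<^sup>2 = B * C / s * (norm e / s) * norm e" by (simp add: power2_eq_square)
      also have "\<dots> \<le> B * C / s * 1 * norm e"
        using True s Lparts by (intro mult_right_mono mult_left_mono) auto
      finally have q: "B * C * (norm e / s)\<^sup>2 \<le> B * C / s * norm e" by simp
      have "(B * C / s + d) * norm e \<le> L * norm e" using Lparts unfolding L_def by (intro mult_right_mono) auto
      moreover have "B * C / s\<^sup>2 * (norm e)\<^sup>2 \<le> L * (norm e)\<^sup>2" using Lparts d0 unfolding L_def by (intro mult_right_mono) auto
      ultimately show ?thesis
        using small[OF True, of u] q De[of u e] unfolding eq distrib_right by linarith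
    next
      case False
      then have big: "1 \<le> norm e / s" using s by simp
      have e0: "0 \<le> norm e" by simp
      have "2 * B * 1 \<le> 2 * B * (norm e / s)" using big B0 by (intro mult_left_mono) auto
      then have l1: "2 * B \<le> 2 * B / s * norm e" by simp
      have "1 * 1 \<le> (norm e / s) * (norm e / s)" using big by (intro mult_mono) auto
      then have "2 * B * 1 \<le> 2 * B * (norm e / s)\<^sup>2" using B0 by (intro mult_left_mono) (auto simp: power2_eq_square)
      then have l2: "2 * B \<le> 2 * B / s\<^sup>2 * (norm e)\<^sup>2" by (simp add: power_divide)
      have "d * norm e * 1 \<le> d * norm e * (norm e / s)" using big d0 by (intro mult_left_mono) auto
      then have l3: "d * norm e \<le> d / s * (norm e)\<^sup>2" by (simp add: power2_eq_square mult_ac)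
      have "2 * B / s * norm e \<le> L * norm e" using Lparts d0 unfolding L_def by (intro mult_right_mono) auto
      moreover have "(2 * B / s\<^sup>2 + d / s) * (norm e)\<^sup>2 \<le> L * (norm e)\<^sup>2" using Lparts d0 unfolding L_def by (intro mult_right_mono) auto
      moreover have "\<bar>heat \<delta> f (u + e) - heat \<delta> f u\<bar> \<le> 2 * B" using hb[of u] hb[of "u + e"] by linarith
      ultimately show ?thesis using l1 l2 l3 De[of u e] unfolding distrib_right by linarith
    qed
    moreover have "norm (D u) \<le> L" for u using nD[of u] Lparts d0 unfolding L_def by linarith
    ultimately show ?thesis unfolding C11_def by blast
  qed
  then show ?thesis using L0 by blast
qed

end

section \<open>Increments under correlated noise\<close>

text \<open>Continuity of a quadratic form: the replacement of \<open>(s, t)\<close> by \<open>(s0, t0)\<close> costs size times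
distance.\<close>

lemma quadratic_difference:
  fixes s t s0 t0 M K hxx hxy hyy ds dt :: real
  assumes M: "\<bar>s\<bar> \<le> M" "\<bar>t\<bar> \<le> M" "\<bar>s0\<bar> \<le> M" "\<bar>t0\<bar> \<le> M"
    and K: "\<bar>hxx\<bar> \<le> K" "\<bar>hxy\<bar> \<le> K" "\<bar>hyy\<bar> \<le> K" and d: "\<bar>s - s0\<bar> \<le> ds" "\<bar>t - t0\<bar> \<le> dt"
  shows "\<bar>(hxx * s\<^sup>2 + 2 * hxy * s * t + hyy * t\<^sup>2) - (hxx * s0\<^sup>2 + 2 * hxy * s0 * t0 + hyy * t0\<^sup>2)\<bar> \<le> 4 * K * (M * (ds + dt))"
proof -
  have M0: "0 \<le> M" "0 \<le> K" "0 \<le> ds" "0 \<le> dt" using M K d by (meson abs_ge_zero order_trans)+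
  have sq: "\<bar>s\<^sup>2 - s0\<^sup>2\<bar> \<le> 2 * (M * ds)" if "\<bar>s\<bar> \<le> M" "\<bar>s0\<bar> \<le> M" "\<bar>s - s0\<bar> \<le> ds" for s s0 ds
  proof -
    have "\<bar>s\<^sup>2 - s0\<^sup>2\<bar> = \<bar>s + s0\<bar> * \<bar>s - s0\<bar>" by (simp add: power2_eq_square algebra_simps flip: abs_mult)
    also have "\<dots> \<le> (2 * M) * ds" using that M0 by (intro mult_mono) auto
    finally show ?thesis by simp
  qed
  have pr: "\<bar>s * t - s0 * t0\<bar> \<le> M * ds + M * dt"
  proof -
    have "s * t - s0 * t0 = s * (t - t0) + t0 * (s - s0)" by (simp add: algebra_simps)
    then have "\<bar>s * t - s0 * t0\<bar> \<le> \<bar>s\<bar> * \<bar>t - t0\<bar> + \<bar>t0\<bar> * \<bar>s - s0\<bar>"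
      using abs_triangle_ineq[of "s * (t - t0)" "t0 * (s - s0)"] by (simp only: abs_mult)
    also have "\<dots> \<le> M * dt + M * ds" using M d M0 by (intro add_mono mult_mono) auto
    finally show ?thesis by simp
  qed
  have k: "\<bar>c * x\<bar> \<le> K * y" if "\<bar>c\<bar> \<le> K" "\<bar>x\<bar> \<le> y" for c x y
    unfolding abs_mult using that M0 by (intro mult_mono) auto
  have "\<bar>hxx * (s\<^sup>2 - s0\<^sup>2)\<bar> \<le> K * (2 * (M * ds))" "\<bar>hxy * (s * t - s0 * t0)\<bar> \<le> K * (M * ds + M * dt)"
    "\<bar>hyy * (t\<^sup>2 - t0\<^sup>2)\<bar> \<le> K * (2 * (M * dt))"
    by (intro k K sq pr M d)+
  moreover have "(hxx * s\<^sup>2 + 2 * hxy * s * t + hyy * t\<^sup>2) - (hxx * s0\<^sup>2 + 2 * hxy * s0 * t0 + hyy * t0\<^sup>2)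
    = hxx * (s\<^sup>2 - s0\<^sup>2) + 2 * (hxy * (s * t - s0 * t0)) + hyy * (t\<^sup>2 - t0\<^sup>2)" by (simp add: algebra_simps)
  moreover have "4 * K * (M * (ds + dt)) = K * (2 * (M * ds)) + 2 * (K * (M * ds + M * dt)) + K * (2 * (M * dt))" by (simp add: algebra_simps)
  ultimately show ?thesis by linarith
qed

text \<open>Bookkeeping for one time step of length \<open>h = \<theta>\<^sup>2\<close>. Everything is of order \<open>h
\<theta>\<close>, except the cross term of order \<open>h\<close> with the defect \<open>\<Delta>\<close>. Its
coefficient involves only \<open>Ca\<close>, which does not depend on the strength of the drift, so the drift can be
chosen to compensate it.\<close>

lemma step_error_bound:
  fixes \<theta> h R Ca C K \<Delta> \<Delta>1 s t ds dt :: real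
  assumes \<theta>: "0 \<le> \<theta>" "\<theta> \<le> 1" "h = \<theta>\<^sup>2" and R: "1 \<le> R" and C: "0 \<le> Ca" "0 \<le> C" "0 \<le> K" "0 \<le> \<Delta>" "\<Delta> \<le> \<Delta>1"
    and st: "\<bar>s\<bar> \<le> \<theta> * Ca * R + h * C * R" "\<bar>t\<bar> \<le> \<theta> * Ca * R + h * C * R"
    and ds: "ds = h * C * R\<^sup>2" and dt: "dt = h * C * R\<^sup>2 + \<theta> * \<Delta> * R"
  shows "2 * K * ((\<theta> * Ca * R + h * C * R) * (ds + dt)) + K * (\<bar>s\<bar> + \<bar>t\<bar>) ^ 3
    \<le> (2 * K * (2 * Ca * C + 2 * C\<^sup>2 + C * \<Delta>1) + 8 * K * (Ca + C) ^ 3) * ((h * \<theta>) * R ^ 3) + 2 * K * Ca * \<Delta> * (h * R\<^sup>2)"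
proof -
  have h: "0 \<le> h" "h \<le> \<theta>" using \<theta> mult_left_le[of \<theta> \<theta>] by (auto simp: power2_eq_square)
  have R2: "R\<^sup>2 \<le> R ^ 3" using R by (intro power_increasing) auto
  have e: "(\<theta> * Ca * R + h * C * R) * (ds + dt)
    = 2 * Ca * C * ((h * \<theta>) * R ^ 3) + 2 * C\<^sup>2 * ((h * h) * R ^ 3) + C * \<Delta> * ((h * \<theta>) * R\<^sup>2) + Ca * \<Delta> * (\<theta>\<^sup>2 * R\<^sup>2)"
    unfolding ds dt by (simp add: power2_eq_square power3_eq_cube algebra_simps)
  have 1: "2 * C\<^sup>2 * ((h * h) * R ^ 3) \<le> 2 * C\<^sup>2 * ((h * \<theta>) * R ^ 3)"
    using h R by (intro mult_left_mono mult_right_mono) auto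
  have 2: "C * \<Delta> * ((h * \<theta>) * R\<^sup>2) \<le> C * \<Delta>1 * ((h * \<theta>) * R ^ 3)"
    using h R C \<theta> R2 by (intro mult_mono mult_left_mono) auto
  have "(\<theta> * Ca * R + h * C * R) * (ds + dt) \<le> (2 * Ca * C + 2 * C\<^sup>2 + C * \<Delta>1) * ((h * \<theta>) * R ^ 3) + Ca * \<Delta> * (h * R\<^sup>2)"
    unfolding e using 1 2 unfolding \<theta>(3) distrib_right by linarith
  then have A: "2 * K * ((\<theta> * Ca * R + h * C * R) * (ds + dt)) \<le> 2 * K * ((2 * Ca * C + 2 * C\<^sup>2 + C * \<Delta>1) * ((h * \<theta>) * R ^ 3) + Ca * \<Delta> * (h * R\<^sup>2))"
    using C by (intro mult_left_mono) auto
  have "h * C * R \<le> \<theta> * C * R" using h C R by (intro mult_right_mono) auto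
  then have "\<bar>s\<bar> + \<bar>t\<bar> \<le> 2 * (\<theta> * (Ca + C) * R)" using st by (simp add: algebra_simps)
  then have "(\<bar>s\<bar> + \<bar>t\<bar>) ^ 3 \<le> (2 * (\<theta> * (Ca + C) * R)) ^ 3" by (intro power_mono) auto
  also have "\<dots> = 8 * (Ca + C) ^ 3 * ((h * \<theta>) * R ^ 3)"
  proof -
    have "(2 * (\<theta> * X * R)) ^ 3 = 8 * X ^ 3 * ((\<theta>\<^sup>2 * \<theta>) * R ^ 3)" for X
      by (simp add: power2_eq_square power3_eq_cube)
    then show ?thesis unfolding \<theta>(3) .
  qed
  finally have "K * (\<bar>s\<bar> + \<bar>t\<bar>) ^ 3 \<le> K * (8 * (Ca + C) ^ 3 * ((h * \<theta>) * R ^ 3))" using C(3) by (rule mult_left_mono)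
  then show ?thesis using A by (simp add: algebra_simps)
qed

context centered_gaussian
begin

definition wt :: "(real ^ 'n) \<times> (real ^ 'n) \<Rightarrow> real" where
  "wt z = 1 + norm (fst z) + norm (snd z)"

definition rot :: "real \<Rightarrow> real \<Rightarrow> (real ^ 'n) \<times> (real ^ 'n) \<Rightarrow> real ^ 'n" where
  "rot \<alpha> \<beta> z = \<alpha> *\<^sub>R fst z + \<beta> *\<^sub>R snd z"

lemma wt_ge_1: "1 \<le> wt z" by (simp add: wt_def)

lemma wt_measurable[measurable]: "wt \<in> borel_measurable (\<gamma> \<Otimes>\<^sub>M \<gamma>)"
  unfolding wt_def by measurable

lemma rot_measurable[measurable]: "rot \<alpha> \<beta> \<in> borel_measurable (\<gamma> \<Otimes>\<^sub>M \<gamma>)"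
  unfolding rot_def[abs_def] by measurable

lemma integrable_wt: "k \<le> 3 \<Longrightarrow> integrable (\<gamma> \<Otimes>\<^sub>M \<gamma>) (\<lambda>z. wt z ^ k)"
proof (rule Bochner_Integration.integrable_bound[of _ "\<lambda>z. 27 * (1 + norm (fst z) ^ 3 + norm (snd z) ^ 3)"])
  show "integrable (\<gamma> \<Otimes>\<^sub>M \<gamma>) (\<lambda>z. 27 * (1 + norm (fst z) ^ 3 + norm (snd z) ^ 3))"
    using integral_rotation(2)[of 1 0 "\<lambda>x. norm x ^ 3"] integral_rotation(2)[of 0 1 "\<lambda>x. norm x ^ 3"] moment3 by simp
  assume k: "k \<le> 3"
  have "wt z ^ k \<le> 27 * (1 + norm (fst z) ^ 3 + norm (snd z) ^ 3)" for z
  proof -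
    define u where "u = max 1 (max (norm (fst z)) (norm (snd z)))"
    have u: "wt z \<le> 3 * u" "u ^ 3 \<le> 1 + norm (fst z) ^ 3 + norm (snd z) ^ 3"
      unfolding wt_def u_def by (auto simp: max_def)
    have "wt z ^ k \<le> wt z ^ 3" using k wt_ge_1 by (intro power_increasing) auto
    also have "\<dots> \<le> (3 * u) ^ 3" using u wt_ge_1[of z] by (intro power_mono) auto
    finally show ?thesis using u by (simp add: power_mult_distrib)
  qed
  then show "AE z in \<gamma> \<Otimes>\<^sub>M \<gamma>. norm (wt z ^ k) \<le> norm (27 * (1 + norm (fst z) ^ 3 + norm (snd z) ^ 3))"
    using wt_ge_1 by (auto simp: power_abs intro!: AE_I2 order_trans[OF _ abs_ge_self]) (smt (verit) wt_ge_1)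
qed measurable

lemma norm_rot: "\<alpha>\<^sup>2 + \<beta>\<^sup>2 = 1 \<Longrightarrow> norm (rot \<alpha> \<beta> z) \<le> wt z"
proof -
  assume ab: "\<alpha>\<^sup>2 + \<beta>\<^sup>2 = 1"
  have "\<bar>\<alpha>\<bar> \<le> 1" "\<bar>\<beta>\<bar> \<le> 1"
  proof -
    have "\<alpha>\<^sup>2 \<le> 1" "\<beta>\<^sup>2 \<le> 1" using ab zero_le_power2[of \<alpha>] zero_le_power2[of \<beta>] by linarith+
    then show "\<bar>\<alpha>\<bar> \<le> 1" "\<bar>\<beta>\<bar> \<le> 1" by (simp_all add: abs_square_le_1)
  qed
  then have "\<bar>\<alpha>\<bar> * norm (fst z) \<le> norm (fst z)" "\<bar>\<beta>\<bar> * norm (snd z) \<le> norm (snd z)"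
    by (auto intro: mult_left_le_one_le)
  then show ?thesis
    using norm_triangle_ineq[of "\<alpha> *\<^sub>R fst z" "\<beta> *\<^sub>R snd z"] by (simp add: rot_def wt_def)
qed

lemma integral_rot:
  fixes F :: "real ^ 'n \<Rightarrow> real"
  assumes "\<alpha>\<^sup>2 + \<beta>\<^sup>2 = 1" "F \<in> borel_measurable borel"
  shows "(\<integral>z. F (rot \<alpha> \<beta> z) \<partial>(\<gamma> \<Otimes>\<^sub>M \<gamma>)) = (\<integral>x. F x \<partial>\<gamma>)"
    and "integrable (\<gamma> \<Otimes>\<^sub>M \<gamma>) (\<lambda>z. F (rot \<alpha> \<beta> z)) \<longleftrightarrow> integrable \<gamma> F"
  using integral_rotation[OF assms] by (simp_all add: rot_def)

definition increment :: "real \<Rightarrow> (real ^ 'n \<Rightarrow> real) \<Rightarrow> real ^ 'n \<Rightarrow> real ^ 'n \<Rightarrow> real \<Rightarrow> real \<Rightarrow> (real ^ 'n) \<times> (real ^ 'n) \<Rightarrow> real" where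
  "increment h f v \<omega> \<alpha> \<beta> z = f (v + sqrt h *\<^sub>R rot \<alpha> \<beta> z + h *\<^sub>R \<omega>) - heat h f v"

text \<open>\<open>increment\<close> is the deviation of \<open>f\<close>, at a point displaced by noise \<open>sqrt h * rot
\<alpha> \<beta> z\<close> and drift \<open>h \<omega>\<close>, from the mean of \<open>f\<close> under the noise
alone. Its own mean is the drift \<open>h D \<bullet> \<omega>\<close>, up to \<open>h powr (3/2)\<close>: the noise
contributes nothing because \<open>rot \<alpha> \<beta> z\<close> has law \<open>\<gamma>\<close>. Its main part is
\<open>sqrt h * (D \<bullet> rot \<alpha> \<beta> z)\<close>. The gradient \<open>D\<close> has to be obtained before
\<open>\<omega>\<close>, which is chosen depending on it; and the bound \<open>N\<close> on the drift does not enter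
the leading coefficient \<open>L * (1 + \<mu>)\<close>.\<close>

lemma increment_estimates:
  assumes N0: "0 \<le> N" and L0: "0 \<le> L"
  defines "\<mu> \<equiv> \<integral>x. norm x \<partial>\<gamma>"
  shows "\<exists>C\<ge>0. \<forall>f l u v. f \<in> borel_measurable borel \<longrightarrow> C11 L f \<longrightarrow> (\<forall>x. f x \<in> {l..u}) \<longrightarrow>
    (\<exists>D. norm D \<le> L \<and> (\<forall>h \<omega> \<alpha> \<beta>. 0 < h \<longrightarrow> h \<le> 1 \<longrightarrow> norm \<omega> \<le> N \<longrightarrow> \<alpha>\<^sup>2 + \<beta>\<^sup>2 = 1 \<longrightarrow>
      integrable (\<gamma> \<Otimes>\<^sub>M \<gamma>) (increment h f v \<omega> \<alpha> \<beta>) \<and>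
      \<bar>(\<integral>z. increment h f v \<omega> \<alpha> \<beta> z \<partial>(\<gamma> \<Otimes>\<^sub>M \<gamma>)) - h * (D \<bullet> \<omega>)\<bar> \<le> C * ((h * sqrt h) * (\<integral>z. wt z \<partial>(\<gamma> \<Otimes>\<^sub>M \<gamma>))) \<and>
      (\<forall>z. \<bar>increment h f v \<omega> \<alpha> \<beta> z - sqrt h * (D \<bullet> rot \<alpha> \<beta> z)\<bar> \<le> h * C * (wt z)\<^sup>2 \<and>
           \<bar>increment h f v \<omega> \<alpha> \<beta> z\<bar> \<le> sqrt h * (L * (1 + \<mu>)) * wt z + h * C * wt z)))"
proof -
  let ?N = "\<gamma> \<Otimes>\<^sub>M \<gamma>"
  define \<mu>2 where "\<mu>2 = (\<integral>x. norm x ^ 2 \<partial>\<gamma>)"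
  have \<mu>0: "0 \<le> \<mu>" "0 \<le> \<mu>2" unfolding \<mu>_def \<mu>2_def by (auto intro!: integral_nonneg_AE)
  define C1 where "C1 = 6 * L * N + L * N\<^sup>2"
  define C2 where "C2 = L * (1 + N)\<^sup>2 + L * N + L * \<mu>2"
  define C where "C = C1 + C2 + L * N"
  have C10: "0 \<le> C1" "0 \<le> C2" "0 \<le> L * N" using N0 L0 \<mu>0 by (auto simp: C1_def C2_def)
  have C: "0 \<le> C" "C1 \<le> C" "C2 \<le> C" "L * N \<le> C" using C10 by (auto simp: C_def)
  have "\<exists>D. norm D \<le> L \<and> (\<forall>h \<omega> \<alpha> \<beta>. 0 < h \<longrightarrow> h \<le> 1 \<longrightarrow> norm \<omega> \<le> N \<longrightarrow> \<alpha>\<^sup>2 + \<beta>\<^sup>2 = 1 \<longrightarrow>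
      integrable ?N (increment h f v \<omega> \<alpha> \<beta>) \<and>
      \<bar>(\<integral>z. increment h f v \<omega> \<alpha> \<beta> z \<partial>?N) - h * (D \<bullet> \<omega>)\<bar> \<le> C * ((h * sqrt h) * (\<integral>z. wt z \<partial>?N)) \<and>
      (\<forall>z. \<bar>increment h f v \<omega> \<alpha> \<beta> z - sqrt h * (D \<bullet> rot \<alpha> \<beta> z)\<bar> \<le> h * C * (wt z)\<^sup>2 \<and>
           \<bar>increment h f v \<omega> \<alpha> \<beta> z\<bar> \<le> sqrt h * (L * (1 + \<mu>)) * wt z + h * C * wt z))"
    if f[measurable]: "f \<in> borel_measurable borel" and f11: "C11 L f" and fI: "\<And>x. f x \<in> {l..u}" for f l u v
  proof -
    obtain G where G: "\<And>u. norm (G u) \<le> L" "\<And>u e. \<bar>f (u + e) - f u\<bar> \<le> L * norm e"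
      "\<And>u e. \<bar>f (u + e) - f u - G u \<bullet> e\<bar> \<le> L * (norm e)\<^sup>2"
      "\<And>u x e. \<bar>f (u + x + e) - f (u + x) - G u \<bullet> e\<bar> \<le> 6 * L * norm x * norm e + L * (norm e)\<^sup>2"
      using C11_gradient(2)[OF f11] by blast
    define D where "D = G v"
    have DL: "norm D \<le> L" using G(1) by (simp add: D_def)
    have concl: "integrable ?N (increment h f v \<omega> \<alpha> \<beta>) \<and>
      \<bar>(\<integral>z. increment h f v \<omega> \<alpha> \<beta> z \<partial>?N) - h * (D \<bullet> \<omega>)\<bar> \<le> C * ((h * sqrt h) * (\<integral>z. wt z \<partial>?N)) \<and>
      (\<forall>z. \<bar>increment h f v \<omega> \<alpha> \<beta> z - sqrt h * (D \<bullet> rot \<alpha> \<beta> z)\<bar> \<le> h * C * (wt z)\<^sup>2 \<and>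
           \<bar>increment h f v \<omega> \<alpha> \<beta> z\<bar> \<le> sqrt h * (L * (1 + \<mu>)) * wt z + h * C * wt z)"
      if h: "0 < h" "h \<le> 1" and \<omega>: "norm \<omega> \<le> N" and ab: "\<alpha>\<^sup>2 + \<beta>\<^sup>2 = 1" for h \<omega> \<alpha> \<beta>
    proof -
      define \<theta> where "\<theta> = sqrt h"
      have \<theta>: "0 < \<theta>" "\<theta> \<le> 1" "h = \<theta>\<^sup>2" using h by (auto simp: \<theta>_def)
      have h\<theta>: "h \<le> \<theta>" using \<theta> mult_left_le[of \<theta> \<theta>] by (simp add: power2_eq_square)
      define p where "p = heat h f v"
      define \<xi> where "\<xi> = rot \<alpha> \<beta>"
      have \<xi>m[measurable]: "\<xi> \<in> borel_measurable ?N" by (simp add: \<xi>_def)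
      have \<xi>: "norm (\<xi> z) \<le> wt z" for z using norm_rot[OF ab] by (simp add: \<xi>_def)
      define s where "s z = f (v + \<theta> *\<^sub>R \<xi> z + h *\<^sub>R \<omega>) - p" for z
      have s_eq: "increment h f v \<omega> \<alpha> \<beta> = s" by (simp add: fun_eq_iff increment_def s_def p_def \<theta>_def \<xi>_def)
      have h0: "0 \<le> h" using h by simp
      have D\<omega>: "\<bar>D \<bullet> \<omega>\<bar> \<le> L * N"
        using Cauchy_Schwarz_ineq2[of D \<omega>] mult_mono[OF DL \<omega> L0] by auto
      have nh: "norm (h *\<^sub>R \<omega>) \<le> h * N" using \<omega> h by (simp add: mult_left_mono)
      have n\<xi>: "norm (\<theta> *\<^sub>R \<xi> z) \<le> \<theta> * wt z" for z using \<xi>[of z] \<theta> by (simp add: mult_left_mono)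
      have i1: "integrable \<gamma> (\<lambda>x. norm x)" and i2: "integrable \<gamma> (\<lambda>x. (norm x)\<^sup>2)"
        using moments[of 1] moments[of 2] by simp_all
      have if': "integrable \<gamma> (\<lambda>x. f (v + \<theta> *\<^sub>R x))" by (rule integrable_Icc_shift[OF f fI])
      have p: "p = (\<integral>x. f (v + \<theta> *\<^sub>R x) \<partial>\<gamma>)" by (simp add: p_def heat_def \<theta>_def)
      have p1: "\<bar>p - f v\<bar> \<le> L * (\<theta> * \<mu>)"
      proof -
        have "p - f v = (\<integral>x. f (v + \<theta> *\<^sub>R x) - f v \<partial>\<gamma>)" using if' prob_space by (simp add: p)
        also have "\<bar>\<dots>\<bar> \<le> (\<integral>x. L * (\<theta> * norm x) \<partial>\<gamma>)"
        proof (rule integral_abs_bound_integral)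
          show "integrable \<gamma> (\<lambda>x. f (v + \<theta> *\<^sub>R x) - f v)" using if' by simp
          show "integrable \<gamma> (\<lambda>x. L * (\<theta> * norm x))" using i1 by simp
          show "\<bar>f (v + \<theta> *\<^sub>R x) - f v\<bar> \<le> L * (\<theta> * norm x)" for x using G(2)[of v "\<theta> *\<^sub>R x"] \<theta> by simp
        qed
        finally show ?thesis by (simp add: \<mu>_def)
      qed
      have p2: "\<bar>p - f v\<bar> \<le> h * (L * \<mu>2)"
      proof -
        have iD: "integrable \<gamma> (\<lambda>x. \<theta> * (x \<bullet> D))"
          using integrable_affine_power(2)[OF prob sets_gamma moment3, of 1 D 0] by simp
        have "(\<integral>x. f (v + \<theta> *\<^sub>R x) - f v - \<theta> * (x \<bullet> D) \<partial>\<gamma>) = p - f v"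
          using if' iD prob_space mean_zero[of D] by (simp add: p)
        moreover have "\<bar>\<integral>x. f (v + \<theta> *\<^sub>R x) - f v - \<theta> * (x \<bullet> D) \<partial>\<gamma>\<bar> \<le> (\<integral>x. h * L * (norm x)\<^sup>2 \<partial>\<gamma>)"
        proof (rule integral_abs_bound_integral)
          show "integrable \<gamma> (\<lambda>x. f (v + \<theta> *\<^sub>R x) - f v - \<theta> * (x \<bullet> D))" using if' iD by simp
          show "integrable \<gamma> (\<lambda>x. h * L * (norm x)\<^sup>2)" using i2 by simp
          show "\<bar>f (v + \<theta> *\<^sub>R x) - f v - \<theta> * (x \<bullet> D)\<bar> \<le> h * L * (norm x)\<^sup>2" for x
            using G(3)[of v "\<theta> *\<^sub>R x"] by (simp add: D_def inner_commute power_mult_distrib \<theta>(3) mult_ac)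
        qed
        ultimately show ?thesis by (simp add: \<mu>2_def)
      qed
      have lin: "\<bar>s z\<bar> \<le> \<theta> * (L * (1 + \<mu>)) * wt z + h * C * wt z" for z
      proof -
        have "\<bar>f (v + (\<theta> *\<^sub>R \<xi> z + h *\<^sub>R \<omega>)) - f v\<bar> \<le> L * norm (\<theta> *\<^sub>R \<xi> z + h *\<^sub>R \<omega>)" by (rule G(2))
        also have "\<dots> \<le> L * (\<theta> * wt z + h * N)"
          using norm_triangle_ineq[of "\<theta> *\<^sub>R \<xi> z" "h *\<^sub>R \<omega>"] nh n\<xi>[of z] L0 by (intro mult_left_mono) auto
        finally have 1: "\<bar>f (v + \<theta> *\<^sub>R \<xi> z + h *\<^sub>R \<omega>) - f v\<bar> \<le> L * (\<theta> * wt z + h * N)" by (simp add: add.assoc)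
        have "L * (\<theta> * \<mu>) * 1 \<le> L * (\<theta> * \<mu>) * wt z" using wt_ge_1[of z] L0 \<theta> \<mu>0 by (intro mult_left_mono) auto
        moreover have "h * (L * N) * 1 \<le> h * C * wt z"
          using wt_ge_1[of z] C h0 C10 by (intro mult_mono mult_left_mono) auto
        ultimately have "L * (\<theta> * wt z + h * N) + L * (\<theta> * \<mu>) \<le> \<theta> * (L * (1 + \<mu>)) * wt z + h * C * wt z"
          by (simp add: algebra_simps)
        then show ?thesis using 1 p1 unfolding s_def by linarith
      qed
      have quad: "\<bar>s z - \<theta> * (D \<bullet> \<xi> z)\<bar> \<le> h * C * (wt z)\<^sup>2" for z
      proof -
        have w2: "1 \<le> (wt z)\<^sup>2" using wt_ge_1[of z] by (simp add: one_le_power)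
        have "norm (\<theta> *\<^sub>R \<xi> z + h *\<^sub>R \<omega>) \<le> \<theta> * wt z + h * N"
          using norm_triangle_ineq[of "\<theta> *\<^sub>R \<xi> z" "h *\<^sub>R \<omega>"] nh n\<xi>[of z] by linarith
        also have "\<dots> \<le> \<theta> * ((1 + N) * wt z)"
        proof -
          have "h * N \<le> \<theta> * (N * wt z)" using h\<theta> N0 wt_ge_1[of z] h0 mult_left_mono[of 1 "wt z" N] by (intro mult_mono) auto
          then show ?thesis by (simp add: algebra_simps)
        qed
        finally have "(norm (\<theta> *\<^sub>R \<xi> z + h *\<^sub>R \<omega>))\<^sup>2 \<le> (\<theta> * ((1 + N) * wt z))\<^sup>2" by (rule power_mono) simp
        then have "L * (norm (\<theta> *\<^sub>R \<xi> z + h *\<^sub>R \<omega>))\<^sup>2 \<le> L * (h * ((1 + N)\<^sup>2 * (wt z)\<^sup>2))"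
          unfolding power_mult_distrib \<theta>(3) using L0 by (rule mult_left_mono)
        moreover have "\<bar>f (v + (\<theta> *\<^sub>R \<xi> z + h *\<^sub>R \<omega>)) - f v - D \<bullet> (\<theta> *\<^sub>R \<xi> z + h *\<^sub>R \<omega>)\<bar> \<le> L * (norm (\<theta> *\<^sub>R \<xi> z + h *\<^sub>R \<omega>))\<^sup>2"
          unfolding D_def by (rule G(3))
        ultimately have 1: "\<bar>f (v + \<theta> *\<^sub>R \<xi> z + h *\<^sub>R \<omega>) - f v - \<theta> * (D \<bullet> \<xi> z) - h * (D \<bullet> \<omega>)\<bar> \<le> h * (L * (1 + N)\<^sup>2) * (wt z)\<^sup>2"
          by (simp add: inner_add_right add.assoc diff_diff_eq mult_ac)
        have "\<bar>h * (D \<bullet> \<omega>)\<bar> \<le> h * (L * N)" unfolding abs_mult using D\<omega> h0 by (intro mult_mono) auto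
        also have "\<dots> \<le> h * (L * N) * (wt z)\<^sup>2" using w2 h0 C10 mult_left_mono[of 1 "(wt z)\<^sup>2" "h * (L * N)"] by simp
        finally have 2: "\<bar>h * (D \<bullet> \<omega>)\<bar> \<le> h * (L * N) * (wt z)\<^sup>2" .
        have "h * (L * \<mu>2) * 1 \<le> h * (L * \<mu>2) * (wt z)\<^sup>2" using w2 h0 L0 \<mu>0 by (intro mult_left_mono) auto
        then have 3: "\<bar>p - f v\<bar> \<le> h * (L * \<mu>2) * (wt z)\<^sup>2" using p2 by simp
        have "h * C2 * (wt z)\<^sup>2 \<le> h * C * (wt z)\<^sup>2" using C h0 by (intro mult_right_mono mult_left_mono) auto
        moreover have "h * C2 * (wt z)\<^sup>2 = h * (L * (1 + N)\<^sup>2) * (wt z)\<^sup>2 + h * (L * N) * (wt z)\<^sup>2 + h * (L * \<mu>2) * (wt z)\<^sup>2"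
          unfolding C2_def by (simp only: distrib_left distrib_right)
        ultimately show ?thesis using 1 2 3 unfolding s_def by linarith
      qed
      have sm: "(\<lambda>z. f (v + \<theta> *\<^sub>R \<xi> z + h *\<^sub>R \<omega>)) \<in> borel_measurable ?N" "(\<lambda>z. f (v + \<theta> *\<^sub>R \<xi> z)) \<in> borel_measurable ?N" by measurable
      have iF: "integrable ?N (\<lambda>z. f (v + \<theta> *\<^sub>R \<xi> z + h *\<^sub>R \<omega>))" by (rule pair.integral_in_Icc(1)[OF sm(1) fI])
      have iF0: "integrable ?N (\<lambda>z. f (v + \<theta> *\<^sub>R \<xi> z))" by (rule pair.integral_in_Icc(1)[OF sm(2) fI])
      have si: "integrable ?N s" unfolding s_def using iF by simp
      have iw: "integrable ?N wt" using integrable_wt[of 1] by simp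
      have pF: "(\<integral>z. f (v + \<theta> *\<^sub>R \<xi> z) \<partial>?N) = p"
        unfolding p \<xi>_def by (rule integral_rot(1)[OF ab]) measurable
      have mean: "\<bar>(\<integral>z. s z \<partial>?N) - h * (D \<bullet> \<omega>)\<bar> \<le> C * ((h * \<theta>) * (\<integral>z. wt z \<partial>?N))"
      proof -
        have "(\<integral>z. s z \<partial>?N) - h * (D \<bullet> \<omega>) = (\<integral>z. f (v + \<theta> *\<^sub>R \<xi> z + h *\<^sub>R \<omega>) - f (v + \<theta> *\<^sub>R \<xi> z) - h * (D \<bullet> \<omega>) \<partial>?N)"
          unfolding s_def using iF iF0 pF pair.prob_space by simp
        moreover have "\<bar>\<integral>z. f (v + \<theta> *\<^sub>R \<xi> z + h *\<^sub>R \<omega>) - f (v + \<theta> *\<^sub>R \<xi> z) - h * (D \<bullet> \<omega>) \<partial>?N\<bar> \<le> (\<integral>z. C * (h * \<theta>) * wt z \<partial>?N)"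
        proof (rule integral_abs_bound_integral)
          show "integrable ?N (\<lambda>z. f (v + \<theta> *\<^sub>R \<xi> z + h *\<^sub>R \<omega>) - f (v + \<theta> *\<^sub>R \<xi> z) - h * (D \<bullet> \<omega>))" using iF iF0 by simp
          show "integrable ?N (\<lambda>z. C * (h * \<theta>) * wt z)" using iw by simp
          fix z
          have "\<bar>f (v + \<theta> *\<^sub>R \<xi> z + h *\<^sub>R \<omega>) - f (v + \<theta> *\<^sub>R \<xi> z) - D \<bullet> (h *\<^sub>R \<omega>)\<bar>
            \<le> 6 * L * norm (\<theta> *\<^sub>R \<xi> z) * norm (h *\<^sub>R \<omega>) + L * (norm (h *\<^sub>R \<omega>))\<^sup>2"
            unfolding D_def by (rule G(4))
          also have "\<dots> \<le> 6 * L * (\<theta> * wt z) * (h * N) + L * (h * N)\<^sup>2"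
            using n\<xi>[of z] nh L0 \<theta> wt_ge_1[of z] by (intro add_mono mult_mono mult_left_mono power_mono) auto
          also have "\<dots> \<le> C1 * (h * \<theta>) * wt z"
          proof -
            have "L * (h * N)\<^sup>2 = L * N\<^sup>2 * (h * h) * 1" by (simp add: power2_eq_square)
            also have "\<dots> \<le> L * N\<^sup>2 * (h * \<theta>) * wt z"
              using h\<theta> h0 L0 wt_ge_1[of z] \<theta> by (intro mult_mono mult_left_mono) auto
            finally show ?thesis by (simp add: C1_def algebra_simps)
          qed
          also have "\<dots> \<le> C * (h * \<theta>) * wt z" using C h0 \<theta> wt_ge_1[of z] by (intro mult_right_mono) auto
          finally show "\<bar>f (v + \<theta> *\<^sub>R \<xi> z + h *\<^sub>R \<omega>) - f (v + \<theta> *\<^sub>R \<xi> z) - h * (D \<bullet> \<omega>)\<bar> \<le> C * (h * \<theta>) * wt z" by simp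
        qed
        ultimately show ?thesis by simp
      qed
      show ?thesis unfolding s_eq using si mean lin quad by (simp add: \<theta>_def \<xi>_def)
    qed
    show ?thesis using DL concl by blast
  qed
  then show ?thesis using C(1) by (intro exI[of _ C]) blast
qed

end

section \<open>One time step and the flow\<close>

locale gaussian_setting =
  smooth_rectangle i0 i1 j0 j1 H Hx Hy Hxx Hxy Hyy K \<sigma> \<tau> + centered_gaussian A c \<gamma>
  for i0 i1 j0 j1 :: real and H Hx Hy Hxx Hxy Hyy :: "real \<Rightarrow> real \<Rightarrow> real" and K \<sigma> \<tau> :: real
    and A :: "real ^ 'n ^ 'n" and c :: real and \<gamma> :: "(real ^ 'n) measure" +
  fixes a b :: real
  assumes a_pos: "0 < a" and b_pos: "0 < b"
    and triangle: "\<bar>1 - a\<^sup>2 - b\<^sup>2\<bar> \<le> 2 * a * b"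
    and diff_cond: "\<And>x y. x \<in> {i0..i1} \<Longrightarrow> y \<in> {j0..j1} \<Longrightarrow>
      0 \<le> a\<^sup>2 * (Hxx x y / (Hx x y)\<^sup>2) + (1 - a\<^sup>2 - b\<^sup>2) * (Hxy x y / (Hx x y * Hy x y)) + b\<^sup>2 * (Hyy x y / (Hy x y)\<^sup>2)"
begin

text \<open>The products of \<open>e \<bullet> X\<close> and \<open>e \<bullet> Y\<close> are eliminated by \<open>a X + b Y =
Z\<close>, and \<open>X\<close>, \<open>Y\<close>, \<open>Z\<close> have the same law. Hence the expectation is the
expression of the differential condition times the second moment of \<open>e \<bullet> x\<close>.\<close>

lemma correlated_quadratic:
  fixes e :: "real ^ 'n"
  assumes rot: "c1\<^sup>2 + s1\<^sup>2 = 1" "c2\<^sup>2 + s2\<^sup>2 = 1" and tri: "a * c1 + b * c2 = 1" "a * s1 = b * s2"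
    and pr: "p \<in> {i0..i1}" "r \<in> {j0..j1}"
  defines "Q \<equiv> \<lambda>z. Hxx p r * (a / Hx p r * (e \<bullet> rot c1 s1 z))\<^sup>2
      + 2 * Hxy p r * (a / Hx p r * (e \<bullet> rot c1 s1 z)) * (b / Hy p r * (e \<bullet> rot c2 (- s2) z))
      + Hyy p r * (b / Hy p r * (e \<bullet> rot c2 (- s2) z))\<^sup>2"
  shows "integrable (\<gamma> \<Otimes>\<^sub>M \<gamma>) Q" "0 \<le> (\<integral>z. Q z \<partial>(\<gamma> \<Otimes>\<^sub>M \<gamma>))"
proof -
  let ?N = "\<gamma> \<Otimes>\<^sub>M \<gamma>"
  have nz: "Hx p r \<noteq> 0" "Hy p r \<noteq> 0" using away_from_0[OF pr] by auto
  define \<Sigma> where "\<Sigma> = (\<integral>x. (x \<bullet> e)\<^sup>2 \<partial>\<gamma>)"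
  have \<Sigma>0: "0 \<le> \<Sigma>" unfolding \<Sigma>_def by (rule integral_nonneg_AE) simp
  have i: "integrable \<gamma> (\<lambda>x. (x \<bullet> e)\<^sup>2)"
    using integrable_affine_power(2)[OF prob sets_gamma moment3, of 2 e 0] by simp
  define X where "X z = (rot c1 s1 z \<bullet> e)\<^sup>2" for z
  define Y where "Y z = (rot c2 (- s2) z \<bullet> e)\<^sup>2" for z
  define Z where "Z z = (rot 1 0 z \<bullet> e)\<^sup>2" for z :: "(real ^ 'n) \<times> (real ^ 'n)"
  have I: "integrable ?N X" "integrable ?N Y" "integrable ?N Z"
    "(\<integral>z. X z \<partial>?N) = \<Sigma>" "(\<integral>z. Y z \<partial>?N) = \<Sigma>" "(\<integral>z. Z z \<partial>?N) = \<Sigma>"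
    unfolding X_def Y_def Z_def \<Sigma>_def
    using integral_rot[of c1 s1 "\<lambda>x. (x \<bullet> e)\<^sup>2"] integral_rot[of c2 "- s2" "\<lambda>x. (x \<bullet> e)\<^sup>2"]
      integral_rot[of 1 0 "\<lambda>x. (x \<bullet> e)\<^sup>2"] rot i by simp_all
  define k where "k = Hxy p r / (Hx p r * Hy p r)"
  define \<alpha> where "\<alpha> = a\<^sup>2 * (Hxx p r / (Hx p r)\<^sup>2) - a\<^sup>2 * k"
  define \<beta> where "\<beta> = b\<^sup>2 * (Hyy p r / (Hy p r)\<^sup>2) - b\<^sup>2 * k"
  have Q: "Q = (\<lambda>z. \<alpha> * X z + \<beta> * Y z + k * Z z)"
  proof
    fix z
    define x where "x = e \<bullet> rot c1 s1 z"
    define y where "y = e \<bullet> rot c2 (- s2) z"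
    have "a *\<^sub>R rot c1 s1 z + b *\<^sub>R rot c2 (- s2) z = (a * c1 + b * c2) *\<^sub>R fst z + (a * s1 - b * s2) *\<^sub>R snd z"
      by (simp add: rot_def scaleR_add_right scaleR_diff_right scaleR_add_left scaleR_diff_left)
    also have "\<dots> = rot 1 0 z" using tri by (simp add: rot_def)
    finally have "e \<bullet> rot 1 0 z = a * x + b * y" by (simp add: x_def y_def flip: inner_add_right inner_scaleR_right)
    then have XYZ: "X z = x\<^sup>2" "Y z = y\<^sup>2" "Z z = (a * x + b * y)\<^sup>2"
      by (simp_all add: X_def Y_def Z_def x_def y_def inner_commute)
    show "Q z = \<alpha> * X z + \<beta> * Y z + k * Z z"
      unfolding Q_def XYZ x_def[symmetric] y_def[symmetric] \<alpha>_def \<beta>_def k_def using nz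
      by (simp add: field_simps power2_eq_square)
  qed
  show "integrable ?N Q" unfolding Q using I by simp
  have "(\<integral>z. Q z \<partial>?N) = (\<alpha> + \<beta> + k) * \<Sigma>" unfolding Q using I by (simp add: algebra_simps)
  also have "\<alpha> + \<beta> + k = a\<^sup>2 * (Hxx p r / (Hx p r)\<^sup>2) + (1 - a\<^sup>2 - b\<^sup>2) * k + b\<^sup>2 * (Hyy p r / (Hy p r)\<^sup>2)"
    by (simp add: \<alpha>_def \<beta>_def algebra_simps)
  finally show "0 \<le> (\<integral>z. Q z \<partial>?N)" using diff_cond[OF pr] \<Sigma>0 by (simp add: k_def)
qed

lemma taylor_bookkeeping:
  fixes G G0 X X0 S T c3 md e1 e2 :: real
  assumes "\<bar>G - G0 - S - T - X / 2\<bar> \<le> c3" "\<bar>X - X0\<bar> \<le> 2 * md" "md + c3 \<le> e1 + e2"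
  shows "G0 + S + T + X0 / 2 - e1 - e2 \<le> G"
  using assms by linarith

text \<open>If \<open>\<delta> = b H\<^sub>x D - a H\<^sub>y D'\<close> vanishes, the second-order term is nonnegative by
\<open>correlated_quadratic\<close>. In general it is at least a negative multiple of \<open>h * norm
\<delta>\<close>. Moving \<open>u\<close> by \<open>h b w\<close> and \<open>v\<close> by \<open>- h a w\<close> does
not change \<open>a u + b v\<close> and increases the first-order term by \<open>h (\<delta> \<bullet> w)\<close>, so
a vector \<open>w\<close> parallel to \<open>\<delta>\<close> whose length \<open>n\<close> does not depend on
\<open>h\<close> compensates the loss.\<close>

lemma one_step:
  assumes L0: "0 \<le> L"
  shows "\<exists>C\<ge>0. \<forall>f g q h. f \<in> borel_measurable borel \<longrightarrow> g \<in> borel_measurable borel \<longrightarrow> q \<in> borel_measurable borel \<longrightarrow>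
    C11 L f \<longrightarrow> C11 L g \<longrightarrow> (\<forall>x. f x \<in> {i0..i1}) \<longrightarrow> (\<forall>x. g x \<in> {j0..j1}) \<longrightarrow> (\<exists>B. \<forall>x. q x \<in> {-B..B}) \<longrightarrow>
    (\<forall>u v. H (f u) (g v) \<le> q (a *\<^sub>R u + b *\<^sub>R v)) \<longrightarrow> 0 < h \<longrightarrow> h \<le> 1 \<longrightarrow>
    (\<forall>u v. H (heat h f u) (heat h g v) - C * (h * sqrt h) \<le> heat h q (a *\<^sub>R u + b *\<^sub>R v))"
proof -
  let ?N = "\<gamma> \<Otimes>\<^sub>M \<gamma>"
  obtain c1 s1 c2 s2 where rot: "c1\<^sup>2 + s1\<^sup>2 = 1" "c2\<^sup>2 + s2\<^sup>2 = 1" and tri: "a * c1 + b * c2 = 1" "a * s1 = b * s2"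
    using triangle_angles[OF a_pos b_pos triangle] by blast
  have rot2: "c2\<^sup>2 + (- s2)\<^sup>2 = 1" using rot by simp
  have K: "1 \<le> K" "0 < K" "0 \<le> K" using K_ge_1 by auto
  define m where "m k = (\<integral>z. wt z ^ k \<partial>?N)" for k
  have m0: "0 \<le> m k" for k unfolding m_def using wt_ge_1 by (intro integral_nonneg_AE AE_I2 zero_le_power) (meson order_trans zero_le_one)
  have iw: "integrable ?N (\<lambda>z. wt z ^ 3)" "integrable ?N (\<lambda>z. (wt z)\<^sup>2)" "integrable ?N wt"
    using integrable_wt[of 3] integrable_wt[of 2] integrable_wt[of 1] by auto
  have m1: "m 1 = (\<integral>z. wt z \<partial>?N)" by (simp add: m_def)
  define \<mu> where "\<mu> = (\<integral>x. norm x \<partial>\<gamma>)"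
  have \<mu>0: "0 \<le> \<mu>" unfolding \<mu>_def by (rule integral_nonneg_AE) simp
  define Ca where "Ca = L * (1 + \<mu>) + L + b * K\<^sup>2 * L / a"
  have CaL: "L * (1 + \<mu>) \<le> Ca" "L \<le> Ca" "b * K\<^sup>2 * L / a \<le> Ca" "0 \<le> Ca"
    using L0 \<mu>0 a_pos b_pos by (auto simp: Ca_def)
  \<comment> \<open>The length of the drift vector \<open>w\<close>: the coefficient of \<open>h * norm \<delta>\<close> in the integrated error.\<close>
  define n where "n = 2 * K\<^sup>2 * Ca * m 2 / a"
  have n0: "0 \<le> n" using CaL m0[of 2] a_pos by (simp add: n_def)
  have ab0: "0 \<le> (a + b) * n" using a_pos b_pos n0 by simp
  obtain C where C0: "0 \<le> C" and C: "\<And>f l u v. f \<in> borel_measurable borel \<Longrightarrow> C11 L f \<Longrightarrow> (\<And>x. f x \<in> {l..u}) \<Longrightarrow>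
    (\<exists>D. norm D \<le> L \<and> (\<forall>h \<omega> \<alpha> \<beta>. 0 < h \<longrightarrow> h \<le> 1 \<longrightarrow> norm \<omega> \<le> (a + b) * n \<longrightarrow> \<alpha>\<^sup>2 + \<beta>\<^sup>2 = 1 \<longrightarrow>
      integrable ?N (increment h f v \<omega> \<alpha> \<beta>) \<and>
      \<bar>(\<integral>z. increment h f v \<omega> \<alpha> \<beta> z \<partial>?N) - h * (D \<bullet> \<omega>)\<bar> \<le> C * ((h * sqrt h) * m 1) \<and>
      (\<forall>z. \<bar>increment h f v \<omega> \<alpha> \<beta> z - sqrt h * (D \<bullet> rot \<alpha> \<beta> z)\<bar> \<le> h * C * (wt z)\<^sup>2 \<and>
           \<bar>increment h f v \<omega> \<alpha> \<beta> z\<bar> \<le> sqrt h * (L * (1 + \<mu>)) * wt z + h * C * wt z)))"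
    using increment_estimates[OF ab0 L0] unfolding \<mu>_def m1 by blast
  define \<Delta>1 where "\<Delta>1 = ((a + b) * (K * L)) * (K / a)"
  define C5 where "C5 = 2 * K * (2 * Ca * C + 2 * C\<^sup>2 + C * \<Delta>1) + 8 * K * (Ca + C) ^ 3"
  define C' where "C' = 2 * (K * (C * m 1)) + C5 * m 3"
  have \<Delta>10: "0 \<le> \<Delta>1" using a_pos b_pos K L0 by (simp add: \<Delta>1_def)
  have C50: "0 \<le> C5" using C0 CaL K \<Delta>10 by (simp add: C5_def)
  have C'0: "0 \<le> C'" using C0 C50 K m0 by (simp add: C'_def)
  have "H (heat h f u) (heat h g v) - C' * (h * sqrt h) \<le> heat h q (a *\<^sub>R u + b *\<^sub>R v)"
    if f[measurable]: "f \<in> borel_measurable borel" and g[measurable]: "g \<in> borel_measurable borel" and q[measurable]: "q \<in> borel_measurable borel"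
      and f11: "C11 L f" and g11: "C11 L g" and fI: "\<And>x. f x \<in> {i0..i1}" and gJ: "\<And>x. g x \<in> {j0..j1}"
      and qB: "\<And>x. q x \<in> {-B..B}" and Hq: "\<And>u v. H (f u) (g v) \<le> q (a *\<^sub>R u + b *\<^sub>R v)" and h: "0 < h" "h \<le> 1"
    for f g q h u v B
  proof -
    define \<theta> where "\<theta> = sqrt h"
    have \<theta>: "0 < \<theta>" "\<theta> \<le> 1" "h = \<theta>\<^sup>2" "0 \<le> \<theta>" using h by (auto simp: \<theta>_def)
    have h0: "0 \<le> h" using h by simp
    define p where "p = heat h f u"
    define r where "r = heat h g v"
    have pr: "p \<in> {i0..i1}" "r \<in> {j0..j1}" unfolding p_def r_def by (rule heat_in_Icc f g fI gJ)+
    note bd = bounds[OF pr]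
    note az = away_from_0[OF pr]
    define hx where "hx = Hx p r"
    define hy where "hy = Hy p r"
    have hxy: "\<bar>hx\<bar> \<le> K" "\<bar>hy\<bar> \<le> K" "hx \<noteq> 0" "hy \<noteq> 0" using bd az by (auto simp: hx_def hy_def)
    have inv: "1 / \<bar>hy\<bar> \<le> K"
    proof -
      have "\<tau> * hy \<le> \<bar>hy\<bar>" using sgn_cases(2) by (auto simp: abs_if)
      then have "K * (\<tau> * hy) \<le> K * \<bar>hy\<bar>" using K by (intro mult_left_mono) auto
      then have "1 \<le> K * \<bar>hy\<bar>" using az by (simp add: hy_def)
      then show ?thesis using hxy by (simp add: field_simps)
    qed
    obtain D where D: "norm D \<le> L" and De: "\<And>\<omega> \<alpha> \<beta>. norm \<omega> \<le> (a + b) * n \<Longrightarrow> \<alpha>\<^sup>2 + \<beta>\<^sup>2 = 1 \<Longrightarrow>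
      integrable ?N (increment h f u \<omega> \<alpha> \<beta>) \<and>
      \<bar>(\<integral>z. increment h f u \<omega> \<alpha> \<beta> z \<partial>?N) - h * (D \<bullet> \<omega>)\<bar> \<le> C * ((h * \<theta>) * m 1) \<and>
      (\<forall>z. \<bar>increment h f u \<omega> \<alpha> \<beta> z - \<theta> * (D \<bullet> rot \<alpha> \<beta> z)\<bar> \<le> h * C * (wt z)\<^sup>2 \<and>
           \<bar>increment h f u \<omega> \<alpha> \<beta> z\<bar> \<le> \<theta> * (L * (1 + \<mu>)) * wt z + h * C * wt z)"
      using C[OF f f11 fI, of u] h unfolding \<theta>_def by blast
    obtain D' where D': "norm D' \<le> L" and De': "\<And>\<omega> \<alpha> \<beta>. norm \<omega> \<le> (a + b) * n \<Longrightarrow> \<alpha>\<^sup>2 + \<beta>\<^sup>2 = 1 \<Longrightarrow>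
      integrable ?N (increment h g v \<omega> \<alpha> \<beta>) \<and>
      \<bar>(\<integral>z. increment h g v \<omega> \<alpha> \<beta> z \<partial>?N) - h * (D' \<bullet> \<omega>)\<bar> \<le> C * ((h * \<theta>) * m 1) \<and>
      (\<forall>z. \<bar>increment h g v \<omega> \<alpha> \<beta> z - \<theta> * (D' \<bullet> rot \<alpha> \<beta> z)\<bar> \<le> h * C * (wt z)\<^sup>2 \<and>
           \<bar>increment h g v \<omega> \<alpha> \<beta> z\<bar> \<le> \<theta> * (L * (1 + \<mu>)) * wt z + h * C * wt z)"
      using C[OF g g11 gJ, of v] h unfolding \<theta>_def by blast
    define \<delta> where "\<delta> = (b * hx) *\<^sub>R D - (a * hy) *\<^sub>R D'"
    define w where "w = n *\<^sub>R sgn \<delta>"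
    have nw: "norm w \<le> n" using n0 by (simp add: w_def norm_sgn)
    have \<delta>w: "\<delta> \<bullet> w = n * norm \<delta>"
      by (cases "\<delta> = 0") (simp_all add: w_def sgn_div_norm power2_norm_eq_inner[symmetric] power2_eq_square)
    have n\<delta>: "norm \<delta> \<le> (a + b) * (K * L)"
    proof -
      have "norm \<delta> \<le> b * (\<bar>hx\<bar> * norm D) + a * (\<bar>hy\<bar> * norm D')"
        using norm_triangle_ineq4[of "(b * hx) *\<^sub>R D" "(a * hy) *\<^sub>R D'"] a_pos b_pos by (simp add: \<delta>_def abs_mult)
      also have "\<dots> \<le> b * (K * L) + a * (K * L)" using a_pos b_pos hxy D D' K by (intro add_mono mult_left_mono mult_mono) auto
      finally show ?thesis by (simp add: algebra_simps)
    qed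
    have nb: "norm (b *\<^sub>R w) \<le> (a + b) * n" "norm (- a *\<^sub>R w) \<le> (a + b) * n"
      using nw n0 a_pos b_pos by (auto intro!: mult_mono)
    define s where "s = increment h f u (b *\<^sub>R w) c1 s1"
    define t where "t = increment h g v (- a *\<^sub>R w) c2 (- s2)"
    note S = De[OF nb(1) rot(1), folded s_def]
    note T = De'[OF nb(2) rot2, folded t_def]
    define \<xi> where "\<xi> = rot c1 s1"
    define \<eta> where "\<eta> = rot c2 (- s2)"
    have \<xi>: "norm (\<xi> z) \<le> wt z" and \<eta>: "norm (\<eta> z) \<le> wt z" for z
      using norm_rot[OF rot(1)] norm_rot[OF rot2] by (auto simp: \<xi>_def \<eta>_def)
    \<comment> \<open>The common direction of both gradients if \<open>\<delta> = 0\<close>; \<open>s0\<close> and \<open>t0\<close> are the leading parts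
    of \<open>s\<close> and \<open>t\<close> with the gradient of \<open>g\<close> corrected to match that of \<open>f\<close>.\<close>
    define e where "e = (hx / a) *\<^sub>R D"
    define s0 where "s0 z = \<theta> * (a / hx * (e \<bullet> \<xi> z))" for z
    define t0 where "t0 z = \<theta> * (b / hy * (e \<bullet> \<eta> z))" for z
    have s0: "s0 z = \<theta> * (D \<bullet> \<xi> z)" for z using a_pos hxy by (simp add: s0_def e_def)
    have t0: "t0 z = \<theta> * (D' \<bullet> \<eta> z) + \<theta> * ((\<delta> \<bullet> \<eta> z) / (a * hy))" for z
      using a_pos hxy by (simp add: t0_def e_def \<delta>_def inner_diff_left field_simps)
    define \<Delta> where "\<Delta> = norm \<delta> * (K / a)"
    have \<Delta>: "0 \<le> \<Delta>" "\<Delta> \<le> \<Delta>1" unfolding \<Delta>_def \<Delta>1_def using K a_pos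
      by (simp, intro mult_right_mono n\<delta>) simp
    define M where "M z = \<theta> * Ca * wt z + h * C * wt z" for z
    define ds where "ds z = h * C * (wt z)\<^sup>2" for z
    define dt where "dt z = h * C * (wt z)\<^sup>2 + \<theta> * \<Delta> * wt z" for z
    have w0: "0 \<le> wt z" for z using wt_ge_1[of z] by simp
    have hCw: "0 \<le> h * C * wt z" for z using h0 C0 w0 by simp
    have ca: "\<theta> * x * wt z \<le> \<theta> * Ca * wt z" if "x \<le> Ca" for x z using that \<theta> w0 by (intro mult_right_mono mult_left_mono) auto
    have sM: "\<bar>s z\<bar> \<le> M z" and tM: "\<bar>t z\<bar> \<le> M z" for z
      using S T ca[OF CaL(1), of z] unfolding M_def by (meson add_mono order_refl order_trans)+
    have s0M: "\<bar>s0 z\<bar> \<le> M z" for z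
    proof -
      have "\<bar>D \<bullet> \<xi> z\<bar> \<le> norm D * norm (\<xi> z)" by (rule Cauchy_Schwarz_ineq2)
      also have "\<dots> \<le> L * wt z" using D \<xi> L0 by (intro mult_mono) auto
      finally have "\<theta> * \<bar>D \<bullet> \<xi> z\<bar> \<le> \<theta> * (L * wt z)" using \<theta> by (intro mult_left_mono) auto
      then have "\<bar>s0 z\<bar> \<le> \<theta> * L * wt z" using \<theta> by (simp add: s0 abs_mult)
      then show ?thesis using ca[OF CaL(2), of z] hCw[of z] unfolding M_def by linarith
    qed
    have t0M: "\<bar>t0 z\<bar> \<le> M z" for z
    proof -
      have "\<bar>e \<bullet> \<eta> z\<bar> \<le> norm e * norm (\<eta> z)" by (rule Cauchy_Schwarz_ineq2)
      also have "\<dots> \<le> (K / a * L) * wt z"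
      proof (rule mult_mono)
        have "\<bar>hx\<bar> / a * norm D \<le> K / a * L" using hxy D a_pos K by (intro mult_mono divide_right_mono) auto
        then show "norm e \<le> K / a * L" using a_pos by (simp add: e_def)
      qed (use \<eta> K L0 a_pos in auto)
      finally have "(b * (1 / \<bar>hy\<bar>)) * \<bar>e \<bullet> \<eta> z\<bar> \<le> (b * K) * ((K / a * L) * wt z)"
        using inv b_pos K by (intro mult_mono mult_left_mono) auto
      then have "\<theta> * ((b * (1 / \<bar>hy\<bar>)) * \<bar>e \<bullet> \<eta> z\<bar>) \<le> \<theta> * ((b * K) * ((K / a * L) * wt z))"
        using \<theta> by (intro mult_left_mono) auto
      also have "\<dots> = \<theta> * (b * K\<^sup>2 * L / a) * wt z" by (simp add: power2_eq_square)
      finally have "\<bar>t0 z\<bar> \<le> \<theta> * (b * K\<^sup>2 * L / a) * wt z" using \<theta> b_pos by (simp add: t0_def abs_mult)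
      then show ?thesis using ca[OF CaL(3), of z] hCw[of z] unfolding M_def by linarith
    qed
    have sds: "\<bar>s z - s0 z\<bar> \<le> ds z" for z using S unfolding s0 ds_def \<xi>_def by blast
    have tdt: "\<bar>t z - t0 z\<bar> \<le> dt z" for z
    proof -
      have "\<bar>\<delta> \<bullet> \<eta> z\<bar> \<le> norm \<delta> * norm (\<eta> z)" by (rule Cauchy_Schwarz_ineq2)
      also have "\<dots> \<le> norm \<delta> * wt z" using \<eta> by (intro mult_left_mono) auto
      finally have "\<bar>\<delta> \<bullet> \<eta> z\<bar> * (1 / \<bar>hy\<bar> / a) \<le> (norm \<delta> * wt z) * (K / a)"
        using inv a_pos w0 by (intro mult_mono divide_right_mono) auto
      then have "\<theta> * (\<bar>\<delta> \<bullet> \<eta> z\<bar> * (1 / \<bar>hy\<bar> / a)) \<le> \<theta> * ((norm \<delta> * wt z) * (K / a))" using \<theta> by (intro mult_left_mono) auto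
      moreover have "\<bar>\<theta> * ((\<delta> \<bullet> \<eta> z) / (a * hy))\<bar> = \<theta> * (\<bar>\<delta> \<bullet> \<eta> z\<bar> * (1 / \<bar>hy\<bar> / a))"
        using \<theta> a_pos by (simp add: abs_mult mult.commute)
      moreover have "\<theta> * ((norm \<delta> * wt z) * (K / a)) = \<theta> * \<Delta> * wt z" by (simp add: \<Delta>_def)
      ultimately have "\<bar>\<theta> * ((\<delta> \<bullet> \<eta> z) / (a * hy))\<bar> \<le> \<theta> * \<Delta> * wt z" by (simp only:)
      moreover have "\<bar>t z - \<theta> * (D' \<bullet> \<eta> z)\<bar> \<le> h * C * (wt z)\<^sup>2" using T unfolding \<eta>_def by blast
      ultimately show ?thesis unfolding t0 dt_def by linarith
    qed
    define Q0 where "Q0 z = Hxx p r * (a / hx * (e \<bullet> \<xi> z))\<^sup>2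
      + 2 * Hxy p r * (a / hx * (e \<bullet> \<xi> z)) * (b / hy * (e \<bullet> \<eta> z)) + Hyy p r * (b / hy * (e \<bullet> \<eta> z))\<^sup>2" for z
    have Q0: "integrable ?N Q0" "0 \<le> (\<integral>z. Q0 z \<partial>?N)"
      using correlated_quadratic[OF rot tri pr, of e] unfolding Q0_def[abs_def] hx_def hy_def \<xi>_def \<eta>_def by blast+
    have point: "H p r + hx * s z + hy * t z + h / 2 * Q0 z - C5 * (h * \<theta>) * wt z ^ 3 - 2 * K * Ca * \<Delta> * h * (wt z)\<^sup>2
      \<le> q (a *\<^sub>R u + b *\<^sub>R v + \<theta> *\<^sub>R fst z)" for z
    proof -
      have st: "p + s z = f (u + \<theta> *\<^sub>R \<xi> z + h *\<^sub>R (b *\<^sub>R w))" "r + t z = g (v + \<theta> *\<^sub>R \<eta> z + h *\<^sub>R (- a *\<^sub>R w))"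
        by (simp_all add: s_def t_def increment_def p_def r_def \<theta>_def \<xi>_def \<eta>_def)
      have z: "a *\<^sub>R (u + \<theta> *\<^sub>R \<xi> z + h *\<^sub>R (b *\<^sub>R w)) + b *\<^sub>R (v + \<theta> *\<^sub>R \<eta> z + h *\<^sub>R (- a *\<^sub>R w)) = a *\<^sub>R u + b *\<^sub>R v + \<theta> *\<^sub>R fst z"
      proof -
        have "a *\<^sub>R \<xi> z + b *\<^sub>R \<eta> z = (a * c1 + b * c2) *\<^sub>R fst z + (a * s1 - b * s2) *\<^sub>R snd z"
          by (simp add: \<xi>_def \<eta>_def rot_def scaleR_add_right scaleR_diff_right scaleR_add_left scaleR_diff_left)
        then have fz: "a *\<^sub>R \<xi> z + b *\<^sub>R \<eta> z = fst z" using tri by simp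
        have "a *\<^sub>R (u + \<theta> *\<^sub>R \<xi> z + h *\<^sub>R (b *\<^sub>R w)) + b *\<^sub>R (v + \<theta> *\<^sub>R \<eta> z + h *\<^sub>R (- a *\<^sub>R w))
          = a *\<^sub>R u + b *\<^sub>R v + \<theta> *\<^sub>R (a *\<^sub>R \<xi> z + b *\<^sub>R \<eta> z)"
          by (simp add: scaleR_add_right scaleR_diff_right mult_ac)
        then show ?thesis unfolding fz .
      qed
      have I: "p + s z \<in> {i0..i1}" "r + t z \<in> {j0..j1}" unfolding st by (rule fI gJ)+
      have 1: "\<bar>H (p + s z) (r + t z) - H p r - hx * s z - hy * t z
          - (Hxx p r * (s z)\<^sup>2 + 2 * Hxy p r * s z * t z + Hyy p r * (t z)\<^sup>2) / 2\<bar> \<le> K * (\<bar>s z\<bar> + \<bar>t z\<bar>) ^ 3"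
        using taylor2[OF pr(1) I(1) pr(2) I(2)] by (simp add: hx_def hy_def)
      have "\<bar>(Hxx p r * (s z)\<^sup>2 + 2 * Hxy p r * s z * t z + Hyy p r * (t z)\<^sup>2)
          - (Hxx p r * (s0 z)\<^sup>2 + 2 * Hxy p r * s0 z * t0 z + Hyy p r * (t0 z)\<^sup>2)\<bar> \<le> 4 * K * (M z * (ds z + dt z))"
        using bd by (intro quadratic_difference sM tM s0M t0M sds tdt) auto
      moreover have "Hxx p r * (s0 z)\<^sup>2 + 2 * Hxy p r * s0 z * t0 z + Hyy p r * (t0 z)\<^sup>2 = h * Q0 z"
        unfolding s0_def t0_def Q0_def \<theta>(3) by (simp add: power_mult_distrib power2_eq_square algebra_simps)
      ultimately have 2: "\<bar>(Hxx p r * (s z)\<^sup>2 + 2 * Hxy p r * s z * t z + Hyy p r * (t z)\<^sup>2) - h * Q0 z\<bar>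
          \<le> 2 * (2 * K * (M z * (ds z + dt z)))" by simp
      have 3: "2 * K * (M z * (ds z + dt z)) + K * (\<bar>s z\<bar> + \<bar>t z\<bar>) ^ 3
          \<le> C5 * ((h * \<theta>) * wt z ^ 3) + 2 * K * Ca * \<Delta> * (h * (wt z)\<^sup>2)"
        unfolding C5_def M_def
        by (rule step_error_bound[OF \<theta>(4,2,3) wt_ge_1 CaL(4) C0 K(3) \<Delta> sM[unfolded M_def] tM[unfolded M_def]]) (simp_all add: ds_def dt_def)
      have "H p r + hx * s z + hy * t z + (h * Q0 z) / 2 - C5 * ((h * \<theta>) * wt z ^ 3) - 2 * K * Ca * \<Delta> * (h * (wt z)\<^sup>2)
        \<le> H (p + s z) (r + t z)" by (rule taylor_bookkeeping[OF 1 2 3])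
      also have "\<dots> \<le> q (a *\<^sub>R u + b *\<^sub>R v + \<theta> *\<^sub>R fst z)" unfolding st z[symmetric] by (rule Hq)
      finally show ?thesis by (simp add: mult.assoc)
    qed
    have si: "integrable ?N s" and it: "integrable ?N t" using S T by blast+
    let ?E = "\<lambda>z. H p r + hx * s z + hy * t z + h / 2 * Q0 z - C5 * (h * \<theta>) * wt z ^ 3 - 2 * K * Ca * \<Delta> * h * (wt z)\<^sup>2"
    have iE: "integrable ?N ?E" using si it Q0(1) iw by simp
    have EE: "(\<integral>z. ?E z \<partial>?N) = H p r + hx * (\<integral>z. s z \<partial>?N) + hy * (\<integral>z. t z \<partial>?N) + h / 2 * (\<integral>z. Q0 z \<partial>?N)
      - C5 * (h * \<theta>) * m 3 - 2 * K * Ca * \<Delta> * h * m 2"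
      using si it Q0(1) iw pair.prob_space by (simp add: m_def)
    have qm: "(\<lambda>z. q (a *\<^sub>R u + b *\<^sub>R v + \<theta> *\<^sub>R fst z)) \<in> borel_measurable ?N" by measurable
    have iq: "integrable ?N (\<lambda>z. q (a *\<^sub>R u + b *\<^sub>R v + \<theta> *\<^sub>R fst z))"
      by (rule pair.integral_in_Icc(1)[OF qm qB])
    have "(\<integral>z. q (a *\<^sub>R u + b *\<^sub>R v + \<theta> *\<^sub>R fst z) \<partial>?N) = heat h q (a *\<^sub>R u + b *\<^sub>R v)"
      using integral_rot(1)[of 1 0 "\<lambda>x. q (a *\<^sub>R u + b *\<^sub>R v + \<theta> *\<^sub>R x)"] by (simp add: heat_def \<theta>_def rot_def)
    then have le: "(\<integral>z. ?E z \<partial>?N) \<le> heat h q (a *\<^sub>R u + b *\<^sub>R v)"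
      using integral_mono[OF iE iq point] by simp
    have drift: "h * (n * norm \<delta>) - 2 * (K * (C * ((h * \<theta>) * m 1))) \<le> hx * (\<integral>z. s z \<partial>?N) + hy * (\<integral>z. t z \<partial>?N)"
    proof -
      define X where "X = C * ((h * \<theta>) * m 1)"
      have b1: "\<bar>hx * ((\<integral>z. s z \<partial>?N) - h * (D \<bullet> (b *\<^sub>R w)))\<bar> \<le> K * X"
        unfolding abs_mult X_def using S hxy K by (intro mult_mono) auto
      have b2: "\<bar>hy * ((\<integral>z. t z \<partial>?N) - h * (D' \<bullet> (- a *\<^sub>R w)))\<bar> \<le> K * X"
        unfolding abs_mult X_def using T hxy K by (intro mult_mono) auto
      have "hx * (h * (D \<bullet> (b *\<^sub>R w))) + hy * (h * (D' \<bullet> (- a *\<^sub>R w))) = h * (\<delta> \<bullet> w)"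
        by (simp add: \<delta>_def inner_diff_left algebra_simps)
      then show ?thesis using b1 b2 unfolding \<delta>w X_def[symmetric] right_diff_distrib by linarith
    qed
    have "2 * K * Ca * \<Delta> * h * m 2 = h * (n * norm \<delta>)"
      by (simp add: n_def \<Delta>_def power2_eq_square)
    moreover have "0 \<le> h / 2 * (\<integral>z. Q0 z \<partial>?N)" using Q0(2) h0 by simp
    moreover have "C' * (h * sqrt h) = 2 * (K * (C * ((h * \<theta>) * m 1))) + C5 * (h * \<theta>) * m 3"
      by (simp add: C'_def \<theta>_def algebra_simps)
    ultimately show ?thesis using le drift unfolding EE p_def[symmetric] r_def[symmetric] by linarith
  qed
  then show ?thesis using C'0 by (intro exI[of _ C']) blast
qed

lemma heat_add_const:
  assumes [measurable]: "q \<in> borel_measurable borel" and qB: "\<And>x. q x \<in> {l..u}"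
  shows "heat h (\<lambda>x. q x + k) v = heat h q v + k"
proof -
  have "integrable \<gamma> (\<lambda>x. q (v + sqrt h *\<^sub>R x))" by (rule integrable_Icc_shift[OF _ qB]) simp
  then show ?thesis unfolding heat_def using prob_space by simp
qed

text \<open>After \<open>k\<close> steps of length \<open>h\<close> the functions are \<open>heat (k h) f\<close> and \<open>heat
(k h) g\<close>, regular with the same \<open>L\<close>, and the accumulated error \<open>k \<epsilon>\<close> is
added to the averaged \<open>q\<close>. At time \<open>1\<close> the total error is \<open>C * sqrt h\<close>.\<close>

lemma heat_flow_inequality:
  assumes f[measurable]: "f \<in> borel_measurable borel" and g[measurable]: "g \<in> borel_measurable borel" and q[measurable]: "q \<in> borel_measurable borel"
    and f11: "\<And>t. 0 \<le> t \<Longrightarrow> C11 L (heat t f)" and g11: "\<And>t. 0 \<le> t \<Longrightarrow> C11 L (heat t g)" and L0: "0 \<le> L"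
    and fI: "\<And>x. f x \<in> {i0..i1}" and gJ: "\<And>x. g x \<in> {j0..j1}" and qB: "\<And>x. q x \<in> {-B..B}"
    and Hq: "\<And>u v. H (f u) (g v) \<le> q (a *\<^sub>R u + b *\<^sub>R v)"
  shows "H (heat 1 f u) (heat 1 g v) \<le> heat 1 q (a *\<^sub>R u + b *\<^sub>R v)"
proof -
  obtain C where C0: "0 \<le> C" and step: "\<And>f g q h u v. f \<in> borel_measurable borel \<Longrightarrow> g \<in> borel_measurable borel \<Longrightarrow> q \<in> borel_measurable borel \<Longrightarrow>
    C11 L f \<Longrightarrow> C11 L g \<Longrightarrow> (\<And>x. f x \<in> {i0..i1}) \<Longrightarrow> (\<And>x. g x \<in> {j0..j1}) \<Longrightarrow> (\<exists>B. \<forall>x. q x \<in> {-B..B}) \<Longrightarrow>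
    (\<And>u v. H (f u) (g v) \<le> q (a *\<^sub>R u + b *\<^sub>R v)) \<Longrightarrow> 0 < h \<Longrightarrow> h \<le> 1 \<Longrightarrow>
    H (heat h f u) (heat h g v) - C * (h * sqrt h) \<le> heat h q (a *\<^sub>R u + b *\<^sub>R v)"
    using one_step[OF L0] by blast
  have bound: "H (heat 1 f u) (heat 1 g v) \<le> heat 1 q (a *\<^sub>R u + b *\<^sub>R v) + C * sqrt (inverse (real (Suc N)))" for N
  proof -
    define h where "h = inverse (real (Suc N))"
    have h: "0 < h" "h \<le> 1" "real (Suc N) * h = 1" by (simp_all add: h_def inverse_le_1_iff)
    define \<epsilon> where "\<epsilon> = C * (h * sqrt h)"
    have \<epsilon>0: "0 \<le> \<epsilon>" using C0 h by (simp add: \<epsilon>_def)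
    have "H (heat (real k * h) f u) (heat (real k * h) g v) \<le> heat (real k * h) q (a *\<^sub>R u + b *\<^sub>R v) + real k * \<epsilon>" for k u v
    proof (induction k arbitrary: u v)
      case 0
      then show ?case using Hq by simp
    next
      case (Suc k)
      let ?t = "real k * h"
      have t0: "0 \<le> ?t" "0 \<le> h" using h by auto
      have t: "h + ?t = real (Suc k) * h" by (simp add: algebra_simps)
      have sg: "heat h (heat ?t f) = heat (real (Suc k) * h) f" "heat h (heat ?t g) = heat (real (Suc k) * h) g" "heat h (heat ?t q) = heat (real (Suc k) * h) q"
        using heat_semigroup[OF t0(2,1) f fI] heat_semigroup[OF t0(2,1) g gJ] heat_semigroup[OF t0(2,1) q qB] unfolding t by auto
      have qk: "heat ?t q x \<in> {-B..B}" for x by (rule heat_in_Icc[OF q qB])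
      have "H (heat h (heat ?t f) u) (heat h (heat ?t g) v) - C * (h * sqrt h) \<le> heat h (\<lambda>x. heat ?t q x + real k * \<epsilon>) (a *\<^sub>R u + b *\<^sub>R v)"
      proof (rule step)
        have "heat ?t q x + real k * \<epsilon> \<in> {- (B + real k * \<epsilon>)..B + real k * \<epsilon>}" for x
        proof -
          have "0 \<le> real k * \<epsilon>" using \<epsilon>0 by simp
          then show ?thesis using qk[of x] unfolding atLeastAtMost_iff by linarith
        qed
        then show "\<exists>B. \<forall>x. heat ?t q x + real k * \<epsilon> \<in> {- B..B}" by blast
      qed (use f11[OF t0(1)] g11[OF t0(1)] heat_in_Icc[OF f fI] heat_in_Icc[OF g gJ] Suc h in simp_all)
      also have "\<dots> = heat h (heat ?t q) (a *\<^sub>R u + b *\<^sub>R v) + real k * \<epsilon>"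
        by (rule heat_add_const[OF _ qk]) simp
      finally show ?case unfolding sg \<epsilon>_def[symmetric] by (simp add: algebra_simps)
    qed
    from this[of "Suc N" u v] show ?thesis
      unfolding h(3) by (simp only: \<epsilon>_def mult.assoc[symmetric] mult.commute[of "real (Suc N)" C]) (simp only: mult.assoc h(3) mult_1_right mult_1_left h_def[symmetric] mult.assoc[of "real (Suc N)" h "sqrt h", symmetric])
  qed
  have "(\<lambda>N. heat 1 q (a *\<^sub>R u + b *\<^sub>R v) + C * sqrt (inverse (real (Suc N)))) \<longlonglongrightarrow> heat 1 q (a *\<^sub>R u + b *\<^sub>R v) + C * sqrt 0"
    by (intro tendsto_intros LIMSEQ_inverse_real_of_nat)
  then show ?thesis using bound by (intro LIMSEQ_le_const) auto
qed

end

section \<open>Regularisation of Borel functions\<close>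

lemma AE_lborel_affine:
  fixes P :: "'b::euclidean_space \<Rightarrow> bool"
  assumes k: "k \<noteq> 0" and [measurable]: "Measurable.pred borel P" and P: "AE x in lborel. P x"
  shows "AE x in lborel. P (t + k *\<^sub>R x)"
  using k P
  by (subst lborel_affine[where t = "- (1 / k) *\<^sub>R t" and c = "1 / k"])
     (simp_all add: AE_density AE_distr_iff scaleR_add_right scaleR_diff_right)

context centered_gaussian
begin

text \<open>Here \<open>k\<close> may be negative: the arguments \<open>u - (r / a) x\<close> and \<open>v + (r / b) x\<close> of
\<open>f\<close> and \<open>g\<close> must be displaced in opposite directions to stay on the line through \<open>a u
+ b v\<close>.\<close>

definition avg :: "real \<Rightarrow> (real ^ 'n \<Rightarrow> real) \<Rightarrow> real ^ 'n \<Rightarrow> real" where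
  "avg k f v = (\<integral>x. f (v + k *\<^sub>R x) \<partial>\<gamma>)"

definition osc :: "real \<Rightarrow> (real ^ 'n \<Rightarrow> real) \<Rightarrow> real ^ 'n \<Rightarrow> real" where
  "osc k f v = (\<integral>x. \<bar>f (v + k *\<^sub>R x) - avg k f v\<bar> \<partial>\<gamma>)"

text \<open>The local mean is shifted by four local oscillations against the sign \<open>s\<close> and truncated to the range of
\<open>f\<close>. By Markov's inequality \<open>f\<close> lies on the favourable side of this value with probability
at least \<open>3 / 4\<close>, and if \<open>f\<close> is almost constant near \<open>v\<close> the value is close to
that of \<open>f\<close>.\<close>

definition typical_bound :: "real \<Rightarrow> real \<Rightarrow> real \<Rightarrow> real \<Rightarrow> (real ^ 'n \<Rightarrow> real) \<Rightarrow> real ^ 'n \<Rightarrow> real" where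
  "typical_bound l u s k f v = max l (min u (avg k f v - 4 * s * osc k f v))"

lemma avg_eq_heat: "f \<in> borel_measurable borel \<Longrightarrow> avg k f = heat (k\<^sup>2) f"
proof
  fix v assume [measurable]: "f \<in> borel_measurable borel"
  show "avg k f v = heat (k\<^sup>2) f v"
  proof (cases "0 \<le> k")
    case True
    then show ?thesis by (simp add: avg_def heat_def)
  next
    case False
    have "(\<integral>x. f (v + (- k) *\<^sub>R (- x)) \<partial>\<gamma>) = (\<integral>x. f (v + (- k) *\<^sub>R x) \<partial>\<gamma>)"
      by (rule integral_reflect) measurable
    then show ?thesis using False by (simp add: avg_def heat_def)
  qed
qed

lemma avg_measurable[measurable]: "f \<in> borel_measurable borel \<Longrightarrow> avg k f \<in> borel_measurable borel"
  by (simp add: avg_eq_heat)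

lemma osc_measurable[measurable]:
  assumes [measurable]: "f \<in> borel_measurable borel"
  shows "osc k f \<in> borel_measurable borel"
  unfolding osc_def[abs_def] by measurable

lemma typical_bound_measurable[measurable]:
  assumes [measurable]: "f \<in> borel_measurable borel"
  shows "typical_bound l u s k f \<in> borel_measurable borel"
  unfolding typical_bound_def[abs_def] by measurable

lemma typical_bound_in_Icc: "l \<le> u \<Longrightarrow> typical_bound l u s k f v \<in> {l..u}"
  by (auto simp: typical_bound_def)

text \<open>A point where \<open>f\<close> is on the wrong side deviates from the mean by more than \<open>4 V\<close>, where
\<open>V\<close> is the mean deviation; the truncation does no harm because \<open>f\<close> has values in
\<open>{l..u}\<close>. For \<open>V = 0\<close> the function is constant almost everywhere and Markov's inequality is
replaced by a null set.\<close>

lemma typical_bound_exceeded: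
  assumes [measurable]: "f \<in> borel_measurable borel" and fI: "\<And>x. f x \<in> {l..u}" and s: "s \<in> {-1, 1}"
  shows "prob {x. s * f (v + k *\<^sub>R x) < s * typical_bound l u s k f v} \<le> 1 / 4"
proof -
  define m where "m = avg k f v"
  define V where "V = osc k f v"
  define F where "F x = \<bar>f (v + k *\<^sub>R x) - m\<bar>" for x
  have F[measurable]: "F \<in> borel_measurable borel" unfolding F_def by measurable
  have iF: "integrable \<gamma> F"
    using integrable_Icc_shift[OF assms(1) fI, of v k] unfolding F_def by simp
  have V: "V = (\<integral>x. F x \<partial>\<gamma>)" by (simp add: V_def osc_def F_def m_def)
  have F0: "0 \<le> F x" for x by (simp add: F_def)
  have V0: "0 \<le> V" unfolding V by (rule integral_nonneg_AE) (simp add: F0)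
  have sub: "{x. s * f (v + k *\<^sub>R x) < s * typical_bound l u s k f v} \<subseteq> {x. 4 * V < F x}"
  proof safe
    fix x assume *: "s * f (v + k *\<^sub>R x) < s * typical_bound l u s k f v"
    show "4 * V < F x"
      using s fI[of "v + k *\<^sub>R x"] * unfolding typical_bound_def V_def[symmetric] m_def[symmetric] F_def
      by (auto simp: max_def min_def split: if_splits)
  qed
  have "prob {x. s * f (v + k *\<^sub>R x) < s * typical_bound l u s k f v} \<le> prob {x. 4 * V < F x}"
    using sub by (intro finite_measure_mono) auto
  also have "\<dots> \<le> 1 / 4"
  proof (cases "V = 0")
    case True
    then have "AE x in \<gamma>. F x = 0" using iF F0 unfolding V by (subst (asm) integral_nonneg_eq_0_iff_AE) auto
    then have "AE x in \<gamma>. \<not> 4 * V < F x" by eventually_elim (use True in simp)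
    then have "prob {x \<in> space \<gamma>. 4 * V < F x} = 0" by (intro prob_eq_0_AE) auto
    then show ?thesis by simp
  next
    case False
    then have pos: "0 < 4 * V" using V0 by simp
    have "prob {x. 4 * V < F x} \<le> prob {x \<in> space \<gamma>. 4 * V \<le> F x}" by (intro finite_measure_mono) auto
    also have "\<dots> \<le> V / (4 * V)"
      unfolding V by (rule integral_Markov_inequality_measure[OF iF, of UNIV]) (use F0 pos V in auto)
    also have "\<dots> = 1 / 4" using pos by simp
    finally show ?thesis .
  qed
  finally show ?thesis .
qed

text \<open>Both mean and oscillation are Gaussian averages of bounded functions and hence Lipschitz. For the oscillation the mean
is first frozen, which changes it by at most the change of the mean.\<close>

lemma typical_bound_lipschitz:
  fixes l u k :: real
  assumes k: "k \<noteq> 0"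
  shows "\<exists>\<Lambda>\<ge>0. \<forall>f s. f \<in> borel_measurable borel \<longrightarrow> (\<forall>x. f x \<in> {l..u}) \<longrightarrow> s \<in> {-1, 1} \<longrightarrow>
    (\<forall>v e. \<bar>typical_bound l u s k f (v + e) - typical_bound l u s k f v\<bar> \<le> \<Lambda> * norm e)"
proof -
  define B where "B = 2 * (\<bar>l\<bar> + \<bar>u\<bar>)"
  have B0: "0 \<le> B" by (simp add: B_def)
  obtain L where L0: "0 \<le> L" and L: "\<And>f. f \<in> borel_measurable borel \<Longrightarrow> (\<And>x. \<bar>f x\<bar> \<le> B) \<Longrightarrow> C11 L (heat (k\<^sup>2) f)"
    using heat_C11[OF B0, of "k\<^sup>2"] k by auto
  have lip: "\<bar>avg k f (v + e) - avg k f v\<bar> \<le> L * norm e" if f: "f \<in> borel_measurable borel" "\<And>x. \<bar>f x\<bar> \<le> B" for f v e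
    using L[OF f] unfolding avg_eq_heat[OF f(1)] C11_def by blast
  have "\<bar>typical_bound l u s k f (v + e) - typical_bound l u s k f v\<bar> \<le> (9 * L) * norm e"
    if f[measurable]: "f \<in> borel_measurable borel" and fI: "\<And>x. f x \<in> {l..u}" and s: "s \<in> {-1, 1}" for f s v e
  proof -
    have fB: "\<bar>f x\<bar> \<le> B" for x using fI[of x] by (auto simp: B_def)
    have A: "\<bar>avg k f (v + e) - avg k f v\<bar> \<le> L * norm e" by (rule lip[OF f fB])
    define m where "m = avg k f v"
    define m' where "m' = avg k f (v + e)"
    have mI: "m \<in> {l..u}" unfolding m_def avg_eq_heat[OF f] by (rule heat_in_Icc[OF f fI])
    define G where "G x = \<bar>f x - m\<bar>" for x
    have G[measurable]: "G \<in> borel_measurable borel" unfolding G_def by measurable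
    have GB: "\<bar>G x\<bar> \<le> B" for x using fI[of x] mI by (auto simp: B_def G_def)
    have "\<bar>avg k G (v + e) - avg k G v\<bar> \<le> L * norm e" by (rule lip[OF G GB])
    moreover have "avg k G v = osc k f v" by (simp add: avg_def G_def osc_def m_def)
    moreover have "\<bar>osc k f (v + e) - avg k G (v + e)\<bar> \<le> L * norm e"
    proof -
      have i: "integrable \<gamma> (\<lambda>x. f (v + e + k *\<^sub>R x))" by (rule integrable_Icc_shift[OF f fI])
      have "osc k f (v + e) - avg k G (v + e) = (\<integral>x. \<bar>f (v + e + k *\<^sub>R x) - m'\<bar> - \<bar>f (v + e + k *\<^sub>R x) - m\<bar> \<partial>\<gamma>)"
        unfolding osc_def avg_def[of k G] G_def m'_def[symmetric]
        using i by (intro Bochner_Integration.integral_diff[symmetric] integrable_abs Bochner_Integration.integrable_diff) auto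
      moreover have "\<bar>\<integral>x. \<bar>f (v + e + k *\<^sub>R x) - m'\<bar> - \<bar>f (v + e + k *\<^sub>R x) - m\<bar> \<partial>\<gamma>\<bar> \<le> (\<integral>x. \<bar>m' - m\<bar> \<partial>\<gamma>)"
        using i by (intro integral_abs_bound_integral integrable_abs Bochner_Integration.integrable_diff) auto
      ultimately show ?thesis using A prob_space by (simp add: m_def m'_def)
    qed
    ultimately have V: "\<bar>osc k f (v + e) - osc k f v\<bar> \<le> 2 * (L * norm e)" by linarith
    have "\<bar>typical_bound l u s k f (v + e) - typical_bound l u s k f v\<bar>
      \<le> \<bar>(avg k f (v + e) - 4 * s * osc k f (v + e)) - (avg k f v - 4 * s * osc k f v)\<bar>"
      unfolding typical_bound_def by (simp add: max_def min_def)
    also have "\<dots> \<le> 9 * (L * norm e)" using s A V by auto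
    finally show ?thesis by simp
  qed
  then show ?thesis using L0 by (intro exI[of _ "9 * L"]) auto
qed

definition shift_modulus :: "real \<Rightarrow> (real ^ 'n \<Rightarrow> real) \<Rightarrow> real" where
  "shift_modulus k f = (\<integral>z. \<bar>f (fst z + k *\<^sub>R snd z) - f (fst z)\<bar> \<partial>(\<gamma> \<Otimes>\<^sub>M \<gamma>))"

lemma typical_bound_close:
  assumes f[measurable]: "f \<in> borel_measurable borel" and fI: "\<And>x. f x \<in> {l..u}" and s: "s \<in> {-1, 1}"
  shows "\<bar>(\<integral>v. typical_bound l u s k f v \<partial>\<gamma>) - (\<integral>v. f v \<partial>\<gamma>)\<bar> \<le> 9 * shift_modulus k f"
proof -
  let ?N = "\<gamma> \<Otimes>\<^sub>M \<gamma>"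
  have lu: "l \<le> u" using fI[of undefined] by simp
  define w where "w v = (\<integral>x. \<bar>f (v + k *\<^sub>R x) - f v\<bar> \<partial>\<gamma>)" for v
  have ish: "integrable \<gamma> (\<lambda>x. f (v + k *\<^sub>R x))" for v by (rule integrable_Icc_shift[OF f fI])
  have point: "\<bar>typical_bound l u s k f v - f v\<bar> \<le> 9 * w v" for v
  proof -
    define m where "m = avg k f v"
    have "m - f v = (\<integral>x. f (v + k *\<^sub>R x) - f v \<partial>\<gamma>)" using ish[of v] prob_space by (simp add: m_def avg_def)
    moreover have "\<bar>\<integral>x. f (v + k *\<^sub>R x) - f v \<partial>\<gamma>\<bar> \<le> w v" unfolding w_def by (rule integral_abs_bound)
    ultimately have A: "\<bar>m - f v\<bar> \<le> w v" by simp
    have "osc k f v \<le> (\<integral>x. \<bar>f (v + k *\<^sub>R x) - f v\<bar> + \<bar>m - f v\<bar> \<partial>\<gamma>)"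
      unfolding osc_def m_def[symmetric] using ish[of v] by (intro integral_mono) auto
    also have "\<dots> = w v + \<bar>m - f v\<bar>" using ish[of v] prob_space by (simp add: w_def)
    finally have V: "osc k f v \<le> 2 * w v" using A by simp
    have V0: "0 \<le> osc k f v" unfolding osc_def by (rule integral_nonneg_AE) simp
    have "\<bar>typical_bound l u s k f v - f v\<bar> \<le> \<bar>(m - 4 * s * osc k f v) - f v\<bar>"
      using fI[of v] unfolding typical_bound_def m_def by (auto simp: max_def min_def)
    also have "\<dots> \<le> 9 * w v" using s A V V0 by auto
    finally show ?thesis .
  qed
  have bd: "f x - f y \<in> {- (u - l)..u - l}" for x y using fI[of x] fI[of y] by auto
  have zm: "(\<lambda>z. \<bar>f (fst z + k *\<^sub>R snd z) - f (fst z)\<bar>) \<in> borel_measurable ?N" by measurable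
  have iz: "integrable ?N (\<lambda>z. \<bar>f (fst z + k *\<^sub>R snd z) - f (fst z)\<bar>)"
    by (rule pair.integral_in_Icc(1)[OF zm, of 0 "u - l"]) (use bd in \<open>auto simp: abs_le_iff\<close>)
  have w_eq: "(\<integral>v. w v \<partial>\<gamma>) = shift_modulus k f"
    using pair.integral_fst'[OF iz] by (simp add: w_def shift_modulus_def)
  have iw: "integrable \<gamma> w" using pair.integrable_fst'[OF iz] by (simp add: w_def[abs_def])
  have it: "integrable \<gamma> (typical_bound l u s k f)"
    by (rule integrable_Icc(1)[of _ l u]) (use typical_bound_in_Icc[OF lu] in simp_all)
  have if': "integrable \<gamma> f" by (rule integrable_Icc(1)[OF f fI])
  have "(\<integral>v. typical_bound l u s k f v \<partial>\<gamma>) - (\<integral>v. f v \<partial>\<gamma>) = (\<integral>v. typical_bound l u s k f v - f v \<partial>\<gamma>)"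
    using it if' by simp
  moreover have "\<bar>\<integral>v. typical_bound l u s k f v - f v \<partial>\<gamma>\<bar> \<le> (\<integral>v. 9 * w v \<partial>\<gamma>)"
    using it if' iw point by (intro integral_abs_bound_integral) auto
  ultimately show ?thesis by (simp add: w_eq)
qed

text \<open>An unnormalised Gaussian density that dominates all rescalings \<open>\<rho> (x / s)\<close> with \<open>1 \<le> s
\<le> sqrt 2\<close>. It controls the law of \<open>x + k y\<close> for independent \<open>x\<close>, \<open>y\<close>
and small \<open>k\<close> by one fixed measure.\<close>

definition wide :: "real ^ 'n \<Rightarrow> real" where "wide x = \<rho> ((1 / sqrt 2) *\<^sub>R x)"

lemma wide_measurable[measurable]: "wide \<in> borel_measurable borel"
  unfolding wide_def[abs_def] by measurable

lemma integrable_wide: "integrable lborel wide"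
proof -
  have "(\<integral>\<^sup>+x. ennreal (wide x) \<partial>lborel) = ennreal (\<bar>sqrt 2\<bar> ^ DIM(real ^ 'n)) * (\<integral>\<^sup>+x. ennreal (wide (0 + sqrt 2 *\<^sub>R x)) \<partial>lborel)"
    by (rule nn_integral_lborel_affine) simp_all
  also have "\<dots> < \<infinity>" by (simp add: wide_def nn_integral_\<rho> ennreal_mult_less_top)
  finally show ?thesis using \<rho>_pos by (intro integrableI_nonneg) (auto simp: wide_def less_imp_le)
qed

lemma integral_scaled_le_wide:
  assumes [measurable]: "\<psi> \<in> borel_measurable borel" and \<psi>: "\<And>x. \<psi> x \<in> {0..B}" and s: "1 \<le> s" "s \<le> sqrt 2"
  shows "(\<integral>x. \<psi> (s *\<^sub>R x) \<partial>\<gamma>) \<le> (\<integral>x. \<psi> x * wide x \<partial>lborel)"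
proof -
  have s0: "0 < s" using s by simp
  have \<rho>w: "\<rho> ((1 / s) *\<^sub>R x) \<le> wide x" for x
  proof -
    have Q0: "0 \<le> x \<bullet> (A *v x)" using A_pos[of x] by (cases "x = 0") auto
    have "s\<^sup>2 \<le> (sqrt 2)\<^sup>2" using s by (intro power_mono) auto
    then have "x \<bullet> (A *v x) / 2 \<le> x \<bullet> (A *v x) / s\<^sup>2" using Q0 s0 by (intro divide_left_mono) auto
    moreover have "(t *\<^sub>R x) \<bullet> (A *v (t *\<^sub>R x)) = t\<^sup>2 * (x \<bullet> (A *v x))" for t
      using quad_affine[of t x 0 0] by simp
    ultimately show ?thesis unfolding wide_def \<rho>_def by (simp add: power_divide)
  qed
  have w0: "0 \<le> wide x" for x using \<rho>_pos by (simp add: wide_def less_imp_le)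
  have iw: "integrable lborel (\<lambda>x. \<psi> x * wide x)"
  proof (rule Bochner_Integration.integrable_bound[of _ "\<lambda>x. B * wide x"])
    show "AE x in lborel. norm (\<psi> x * wide x) \<le> norm (B * wide x)"
      using \<psi> w0 by (auto simp: abs_mult intro!: AE_I2 mult_right_mono) (meson \<psi> abs_ge_self abs_of_nonneg atLeastAtMost_iff order_trans)
  qed (use integrable_wide in simp_all)
  have "ennreal (\<integral>x. \<psi> (s *\<^sub>R x) \<partial>\<gamma>) = (\<integral>\<^sup>+x. ennreal (\<psi> (s *\<^sub>R x)) \<partial>\<gamma>)"
  proof (rule nn_integral_eq_integral[symmetric])
    show "integrable \<gamma> (\<lambda>x. \<psi> (s *\<^sub>R x))" using integrable_Icc_shift[OF assms(1) \<psi>, of 0 s] by simp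
  qed (use \<psi> in simp)
  also have "\<dots> = (\<integral>\<^sup>+x. ennreal (\<rho> x) * ennreal (\<psi> (s *\<^sub>R x)) \<partial>lborel)" by (rule nn_integral_gamma) measurable
  also have "\<dots> = ennreal (\<bar>1 / s\<bar> ^ DIM(real ^ 'n)) * (\<integral>\<^sup>+x. ennreal (\<rho> ((1 / s) *\<^sub>R x)) * ennreal (\<psi> x) \<partial>lborel)"
    using s0 by (subst nn_integral_lborel_affine[where k = "1 / s" and t = 0]) simp_all
  also have "\<dots> \<le> 1 * (\<integral>\<^sup>+x. ennreal (\<psi> x * wide x) \<partial>lborel)"
  proof (rule mult_mono)
    have "\<bar>1 / s\<bar> ^ DIM(real ^ 'n) \<le> 1" using s by (intro power_le_one) auto
    then show "ennreal (\<bar>1 / s\<bar> ^ DIM(real ^ 'n)) \<le> 1" by (metis ennreal_leI ennreal_1)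
    show "(\<integral>\<^sup>+x. ennreal (\<rho> ((1 / s) *\<^sub>R x)) * ennreal (\<psi> x) \<partial>lborel) \<le> (\<integral>\<^sup>+x. ennreal (\<psi> x * wide x) \<partial>lborel)"
    proof (rule nn_integral_mono)
      fix x
      have "\<rho> ((1 / s) *\<^sub>R x) * \<psi> x \<le> wide x * \<psi> x" using \<rho>w \<psi> by (intro mult_right_mono) auto
      then show "ennreal (\<rho> ((1 / s) *\<^sub>R x)) * ennreal (\<psi> x) \<le> ennreal (\<psi> x * wide x)"
        using \<psi>[of x] \<rho>_pos by (simp add: ennreal_mult[symmetric] less_imp_le mult.commute ennreal_leI)
    qed
  qed simp_all
  also have "\<dots> = ennreal (\<integral>x. \<psi> x * wide x \<partial>lborel)"
    using iw \<psi> w0 by (subst nn_integral_eq_integral) (auto intro!: AE_I2 mult_nonneg_nonneg)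
  finally show ?thesis
    using \<psi> w0 by (subst (asm) ennreal_le_iff) (auto intro!: integral_nonneg_AE AE_I2 mult_nonneg_nonneg)
qed

text \<open>Borel functions are almost everywhere limits of continuous ones; after truncation, dominated convergence applies.\<close>

lemma continuous_approximation:
  assumes f[measurable]: "f \<in> borel_measurable borel" and fI: "\<And>x. f x \<in> {l..u}" and \<epsilon>: "0 < \<epsilon>"
  shows "\<exists>\<phi>. continuous_on UNIV \<phi> \<and> (\<forall>x. \<phi> x \<in> {l..u}) \<and> (\<integral>x. \<bar>f x - \<phi> x\<bar> * wide x \<partial>lborel) \<le> \<epsilon>"
proof -
  have lu: "l \<le> u" using fI[of undefined] by simp
  have "f \<in> borel_measurable lebesgue" by (rule measurable_completion) simp
  then have "f measurable_on UNIV" by (intro lebesgue_measurable_imp_measurable_on_real) auto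
  then obtain N g where N: "negligible N" and g: "\<And>n. continuous_on UNIV (g n)" and lim: "\<And>x. x \<notin> N \<Longrightarrow> (\<lambda>n. g n x) \<longlonglongrightarrow> f x"
    unfolding measurable_on_def by auto
  define \<phi> where "\<phi> n x = max l (min u (g n x))" for n x
  have cont: "continuous_on UNIV (\<phi> n)" for n unfolding \<phi>_def by (intro continuous_intros g)
  then have [measurable]: "\<phi> n \<in> borel_measurable borel" for n by (rule borel_measurable_continuous_onI)
  have \<phi>I: "\<phi> n x \<in> {l..u}" for n x using lu by (auto simp: \<phi>_def)
  have w0: "0 \<le> wide x" for x using \<rho>_pos by (simp add: wide_def less_imp_le)
  have "AE x in lebesgue. x \<notin> N" using N by (intro AE_not_in) (simp add: negligible_iff_null_sets)
  then have ae: "AE x in lebesgue. (\<lambda>n. \<bar>f x - \<phi> n x\<bar> * wide x) \<longlonglongrightarrow> 0"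
  proof eventually_elim
    case (elim x)
    have "(\<lambda>n. \<bar>f x - \<phi> n x\<bar> * wide x) \<longlonglongrightarrow> \<bar>f x - max l (min u (f x))\<bar> * wide x"
      unfolding \<phi>_def by (intro tendsto_intros lim elim)
    moreover have "max l (min u (f x)) = f x" using fI[of x] by auto
    ultimately show ?case by simp
  qed
  have "(\<lambda>n. \<integral>x. \<bar>f x - \<phi> n x\<bar> * wide x \<partial>lborel) \<longlonglongrightarrow> (\<integral>x. 0 \<partial>(lborel :: (real ^ 'n) measure))"
  proof (rule integral_dominated_convergence)
    show "AE x in lborel. (\<lambda>n. \<bar>f x - \<phi> n x\<bar> * wide x) \<longlonglongrightarrow> 0" using ae by (simp only: AE_completion_iff)
    show "integrable lborel (\<lambda>x. (u - l) * wide x)" using integrable_wide by simp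
    show "AE x in lborel. norm (\<bar>f x - \<phi> n x\<bar> * wide x) \<le> (u - l) * wide x" for n
    proof (rule AE_I2)
      fix x
      have "\<bar>f x - \<phi> n x\<bar> \<le> u - l" using fI[of x] \<phi>I[of n x] by auto
      then show "norm (\<bar>f x - \<phi> n x\<bar> * wide x) \<le> (u - l) * wide x" using w0 by (auto simp: abs_mult intro: mult_right_mono)
    qed
  qed simp_all
  then have "(\<lambda>n. \<integral>x. \<bar>f x - \<phi> n x\<bar> * wide x \<partial>lborel) \<longlonglongrightarrow> 0" by simp
  then have "\<forall>\<^sub>F n in sequentially. (\<integral>x. \<bar>f x - \<phi> n x\<bar> * wide x \<partial>lborel) < \<epsilon>" by (rule order_tendstoD(2)) fact
  then obtain n where "(\<integral>x. \<bar>f x - \<phi> n x\<bar> * wide x \<partial>lborel) < \<epsilon>" by (auto simp: eventually_sequentially)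
  then show ?thesis using cont \<phi>I by (intro exI[of _ "\<phi> n"]) auto
qed

text \<open>Continuity of translations in mean. For a continuous approximant \<open>\<phi>\<close> it is dominated convergence;
the approximation error at the translated point \<open>x + k y\<close> is controlled by \<open>wide\<close>, because
\<open>x + k y\<close> is distributed like \<open>sqrt (1 + k\<^sup>2) x\<close>.\<close>

lemma shift_modulus_tendsto_0:
  assumes f[measurable]: "f \<in> borel_measurable borel" and fI: "\<And>x. f x \<in> {l..u}" and k: "k \<longlonglongrightarrow> 0"
  shows "(\<lambda>n. shift_modulus (k n) f) \<longlonglongrightarrow> 0"
proof (rule LIMSEQ_I)
  let ?N = "\<gamma> \<Otimes>\<^sub>M \<gamma>"
  fix \<epsilon> :: real assume \<epsilon>: "0 < \<epsilon>"
  define \<delta> where "\<delta> = \<epsilon> / 4"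
  have \<delta>: "0 < \<delta>" using \<epsilon> by (simp add: \<delta>_def)
  obtain \<phi> where cont: "continuous_on UNIV \<phi>" and \<phi>I: "\<And>x. \<phi> x \<in> {l..u}" and \<phi>: "(\<integral>x. \<bar>f x - \<phi> x\<bar> * wide x \<partial>lborel) \<le> \<delta>"
    using continuous_approximation[OF f fI \<delta>] by blast
  have \<phi>m[measurable]: "\<phi> \<in> borel_measurable borel" using cont by (rule borel_measurable_continuous_onI)
  define \<psi> where "\<psi> x = \<bar>f x - \<phi> x\<bar>" for x
  have \<psi>m[measurable]: "\<psi> \<in> borel_measurable borel" unfolding \<psi>_def by measurable
  have \<psi>I: "\<psi> x \<in> {0..u - l}" for x using fI[of x] \<phi>I[of x] by (auto simp: \<psi>_def)
  have \<psi>_small: "(\<integral>x. \<psi> (s *\<^sub>R x) \<partial>\<gamma>) \<le> \<delta>" if "1 \<le> s" "s \<le> sqrt 2" for s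
    using integral_scaled_le_wide[OF \<psi>m \<psi>I that] \<phi> by (simp add: \<psi>_def)
  define d where "d n z = \<bar>\<phi> (fst z + k n *\<^sub>R snd z) - \<phi> (fst z)\<bar>" for n and z :: "(real ^ 'n) \<times> (real ^ 'n)"
  have dm: "d n \<in> borel_measurable ?N" for n unfolding d_def by measurable
  have dI: "d n z \<in> {0..u - l}" for n z using \<phi>I[of "fst z + k n *\<^sub>R snd z"] \<phi>I[of "fst z"] by (auto simp: d_def)
  have "(\<lambda>n. \<integral>z. d n z \<partial>?N) \<longlonglongrightarrow> (\<integral>z. 0 \<partial>?N)"
  proof (rule integral_dominated_convergence)
    show "integrable ?N (\<lambda>z. u - l)" by simp
    show "AE z in ?N. (\<lambda>n. d n z) \<longlonglongrightarrow> 0"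
    proof (rule AE_I2)
      fix z :: "(real ^ 'n) \<times> (real ^ 'n)"
      have "(\<lambda>n. fst z + k n *\<^sub>R snd z) \<longlonglongrightarrow> fst z + 0 *\<^sub>R snd z" by (intro tendsto_intros k)
      then have "(\<lambda>n. \<phi> (fst z + k n *\<^sub>R snd z)) \<longlonglongrightarrow> \<phi> (fst z)"
        using continuous_on_tendsto_compose[OF cont] by simp
      then have "(\<lambda>n. \<bar>\<phi> (fst z + k n *\<^sub>R snd z) - \<phi> (fst z)\<bar>) \<longlonglongrightarrow> \<bar>\<phi> (fst z) - \<phi> (fst z)\<bar>" by (intro tendsto_intros)
      then show "(\<lambda>n. d n z) \<longlonglongrightarrow> 0" by (simp add: d_def)
    qed
    show "AE z in ?N. norm (d n z) \<le> u - l" for n using dI[of n] by auto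
  qed (use dm in auto)
  then have ev1: "\<forall>\<^sub>F n in sequentially. (\<integral>z. d n z \<partial>?N) < \<delta>" using \<delta> by (intro order_tendstoD(2)[of _ 0]) auto
  have "(\<lambda>n. \<bar>k n\<bar>) \<longlonglongrightarrow> 0" using k by (rule tendsto_rabs_zero)
  then have ev2: "\<forall>\<^sub>F n in sequentially. \<bar>k n\<bar> < 1" by (rule order_tendstoD(2)) simp
  have "\<forall>\<^sub>F n in sequentially. norm (shift_modulus (k n) f - 0) < \<epsilon>"
    using ev1 ev2
  proof eventually_elim
    case (elim n)
    define s where "s = sqrt (1 + (k n)\<^sup>2)"
    have k1: "(k n)\<^sup>2 \<le> 1" using elim(2) by (simp add: abs_square_le_1)
    have s: "1 \<le> s" "s \<le> sqrt 2" "s\<^sup>2 = 1 + (k n)\<^sup>2" using k1 by (auto simp: s_def)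
    have ab: "(1 / s)\<^sup>2 + (k n / s)\<^sup>2 = 1" 
    proof -
      have "(1 / s)\<^sup>2 + (k n / s)\<^sup>2 = (1 + (k n)\<^sup>2) / s\<^sup>2" by (simp add: power_divide add_divide_distrib)
      then show ?thesis using s(1) by (simp flip: s(3))
    qed
    have eq: "fst z + k n *\<^sub>R snd z = s *\<^sub>R rot (1 / s) (k n / s) z" for z
      using s by (simp add: rot_def scaleR_add_right)
    have "(\<integral>z. \<psi> (fst z + k n *\<^sub>R snd z) \<partial>?N) = (\<integral>x. \<psi> (s *\<^sub>R x) \<partial>\<gamma>)"
      unfolding eq by (rule integral_rot(1)[OF ab]) measurable
    then have t1: "(\<integral>z. \<psi> (fst z + k n *\<^sub>R snd z) \<partial>?N) \<le> \<delta>" using \<psi>_small[OF s(1,2)] by simp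
    have "(\<integral>z. \<psi> (fst z) \<partial>?N) = (\<integral>x. \<psi> (1 *\<^sub>R x) \<partial>\<gamma>)" using integral_rot(1)[of 1 0 \<psi>] by (simp add: rot_def)
    then have t3: "(\<integral>z. \<psi> (fst z) \<partial>?N) \<le> \<delta>" using \<psi>_small[of 1] by simp
    have m1: "(\<lambda>z. \<psi> (fst z + k n *\<^sub>R snd z)) \<in> borel_measurable ?N" and m3: "(\<lambda>z. \<psi> (fst z)) \<in> borel_measurable ?N"
      and m0: "(\<lambda>z. \<bar>f (fst z + k n *\<^sub>R snd z) - f (fst z)\<bar>) \<in> borel_measurable ?N" by measurable
    have bd: "\<bar>f x - f y\<bar> \<in> {0..u - l}" for x y using fI[of x] fI[of y] by auto
    note i1 = pair.integral_in_Icc(1)[OF m1 \<psi>I] and i3 = pair.integral_in_Icc(1)[OF m3 \<psi>I]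
      and i2 = pair.integral_in_Icc(1)[OF dm dI] and i0 = pair.integral_in_Icc(1)[OF m0 bd]
    have "shift_modulus (k n) f \<le> (\<integral>z. \<psi> (fst z + k n *\<^sub>R snd z) + d n z + \<psi> (fst z) \<partial>?N)"
      unfolding shift_modulus_def using i0 i1 i2 i3 by (intro integral_mono) (auto simp: \<psi>_def d_def)
    also have "\<dots> = (\<integral>z. \<psi> (fst z + k n *\<^sub>R snd z) \<partial>?N) + (\<integral>z. d n z \<partial>?N) + (\<integral>z. \<psi> (fst z) \<partial>?N)"
      using i1 i2 i3 by simp
    also have "\<dots> < 4 * \<delta>" using t1 t3 elim(1) \<delta> by linarith
    also have "\<dots> = \<epsilon>" by (simp add: \<delta>_def)
    finally have "shift_modulus (k n) f < \<epsilon>" .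
    moreover have "0 \<le> shift_modulus (k n) f" unfolding shift_modulus_def by (rule integral_nonneg_AE) simp
    ultimately show ?case by simp
  qed
  then show "\<exists>no. \<forall>n\<ge>no. norm (shift_modulus (k n) f - 0) < \<epsilon>" by (simp add: eventually_sequentially)
qed

end

section \<open>Sufficiency\<close>

context gaussian_setting
begin

text \<open>A short run of the heat flow makes Lipschitz functions regular and changes them, and hence the inequality, by a
uniformly small amount.\<close>

lemma lipschitz_functions_inequality:
  assumes f[measurable]: "f \<in> borel_measurable borel" and g[measurable]: "g \<in> borel_measurable borel" and q[measurable]: "q \<in> borel_measurable borel"
    and fI: "\<And>x. f x \<in> {i0..i1}" and gJ: "\<And>x. g x \<in> {j0..j1}" and qB: "\<And>x. q x \<in> {-B..B}"
    and f_lip: "\<And>u e. \<bar>f (u + e) - f u\<bar> \<le> \<Lambda> * norm e" and g_lip: "\<And>u e. \<bar>g (u + e) - g u\<bar> \<le> \<Lambda> * norm e" and \<Lambda>0: "0 \<le> \<Lambda>"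
    and Hq: "\<And>u v. H (f u) (g v) \<le> q (a *\<^sub>R u + b *\<^sub>R v)"
  shows "H (\<integral>x. f x \<partial>\<gamma>) (\<integral>x. g x \<partial>\<gamma>) \<le> (\<integral>x. q x \<partial>\<gamma>)"
proof -
  define \<mu> where "\<mu> = (\<integral>x. norm x \<partial>\<gamma>)"
  have \<mu>0: "0 \<le> \<mu>" unfolding \<mu>_def by (rule integral_nonneg_AE) simp
  have i1: "integrable \<gamma> (\<lambda>x. norm x)" using moments[of 1] by simp
  have K: "0 \<le> K" "0 < K" using K_ge_1 by auto
  have close: "\<bar>heat \<delta> \<phi> v - \<phi> v\<bar> \<le> \<Lambda> * \<mu> * sqrt \<delta>"
    if \<phi>[measurable]: "\<phi> \<in> borel_measurable borel" and \<phi>I: "\<And>x. \<phi> x \<in> {l..u}" and lip: "\<And>u e. \<bar>\<phi> (u + e) - \<phi> u\<bar> \<le> \<Lambda> * norm e" and \<delta>: "0 < \<delta>"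
    for \<phi> l u \<delta> v
  proof -
    have i: "integrable \<gamma> (\<lambda>x. \<phi> (v + sqrt \<delta> *\<^sub>R x))" by (rule integrable_Icc_shift[OF \<phi> \<phi>I])
    have "heat \<delta> \<phi> v - \<phi> v = (\<integral>x. \<phi> (v + sqrt \<delta> *\<^sub>R x) - \<phi> v \<partial>\<gamma>)" using i prob_space by (simp add: heat_def)
    moreover have "\<bar>\<integral>x. \<phi> (v + sqrt \<delta> *\<^sub>R x) - \<phi> v \<partial>\<gamma>\<bar> \<le> (\<integral>x. \<Lambda> * sqrt \<delta> * norm x \<partial>\<gamma>)"
    proof (rule integral_abs_bound_integral)
      show "integrable \<gamma> (\<lambda>x. \<phi> (v + sqrt \<delta> *\<^sub>R x) - \<phi> v)" using i by simp
      show "integrable \<gamma> (\<lambda>x. \<Lambda> * sqrt \<delta> * norm x)" using i1 by simp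
      show "\<bar>\<phi> (v + sqrt \<delta> *\<^sub>R x) - \<phi> v\<bar> \<le> \<Lambda> * sqrt \<delta> * norm x" for x using lip[of v "sqrt \<delta> *\<^sub>R x"] \<delta> by simp
    qed
    ultimately show ?thesis by (simp add: \<mu>_def mult_ac)
  qed
  have heat1: "heat 1 \<phi> 0 = (\<integral>x. \<phi> x \<partial>\<gamma>)" for \<phi> by (simp add: heat_def)
  define c' where "c' = 4 * (K * (\<Lambda> * \<mu>))"
  have c'0: "0 \<le> c'" using K \<Lambda>0 \<mu>0 by (simp add: c'_def)
  have main: "H (\<integral>x. f x \<partial>\<gamma>) (\<integral>x. g x \<partial>\<gamma>) \<le> (\<integral>x. q x \<partial>\<gamma>) + c' * sqrt \<delta>" if \<delta>: "0 < \<delta>" for \<delta>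
  proof -
    define \<eta> where "\<eta> = \<Lambda> * \<mu> * sqrt \<delta>"
    have \<eta>0: "0 \<le> \<eta>" using \<Lambda>0 \<mu>0 \<delta> by (simp add: \<eta>_def)
    define B' where "B' = \<bar>i0\<bar> + \<bar>i1\<bar> + \<bar>j0\<bar> + \<bar>j1\<bar>"
    have B'0: "0 \<le> B'" by (simp add: B'_def)
    obtain L where L0: "0 \<le> L" and L: "\<And>f. f \<in> borel_measurable borel \<Longrightarrow> (\<And>x. \<bar>f x\<bar> \<le> B') \<Longrightarrow> C11 L (heat \<delta> f)"
      using heat_C11[OF B'0 \<delta>] by blast
    define f' where "f' = heat \<delta> f"
    define g' where "g' = heat \<delta> g"
    have fm[measurable]: "f' \<in> borel_measurable borel" and gm[measurable]: "g' \<in> borel_measurable borel" by (simp_all add: f'_def g'_def)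
    have f'I: "f' x \<in> {i0..i1}" and g'J: "g' x \<in> {j0..j1}" for x unfolding f'_def g'_def by (rule heat_in_Icc f g fI gJ)+
    have fc: "\<bar>f' v - f v\<bar> \<le> \<eta>" and gc: "\<bar>g' v - g v\<bar> \<le> \<eta>" for v
      unfolding f'_def g'_def \<eta>_def by (rule close[OF f fI f_lip \<delta>] close[OF g gJ g_lip \<delta>])+
    have C11: "C11 L (heat t f')" "C11 L (heat t g')" if t: "0 \<le> t" for t
    proof -
      have \<delta>0: "0 \<le> \<delta>" using \<delta> by simp
      have "heat t f' = heat \<delta> (heat t f)" "heat t g' = heat \<delta> (heat t g)"
        unfolding f'_def g'_def using heat_semigroup[OF t \<delta>0 f fI] heat_semigroup[OF \<delta>0 t f fI]
          heat_semigroup[OF t \<delta>0 g gJ] heat_semigroup[OF \<delta>0 t g gJ] by (simp_all add: add.commute)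
      moreover have "\<bar>heat t f x\<bar> \<le> B'" "\<bar>heat t g x\<bar> \<le> B'" for x
        using heat_in_Icc[OF f fI, of t x] heat_in_Icc[OF g gJ, of t x] by (auto simp: B'_def)
      ultimately show "C11 L (heat t f')" "C11 L (heat t g')" using L by simp_all
    qed
    define k where "k = 2 * (K * \<eta>)"
    have k0: "0 \<le> k" using K \<eta>0 by (simp add: k_def)
    have H_close: "H x y \<le> H x' y' + k" if "x \<in> {i0..i1}" "x' \<in> {i0..i1}" "y \<in> {j0..j1}" "y' \<in> {j0..j1}" "\<bar>x - x'\<bar> \<le> \<eta>" "\<bar>y - y'\<bar> \<le> \<eta>" for x x' y y'
    proof -
      have "\<bar>H x y - H x' y'\<bar> \<le> K * (\<bar>x - x'\<bar> + \<bar>y - y'\<bar>)" using that by (intro lipschitz)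
      also have "\<dots> \<le> K * (\<eta> + \<eta>)" using that K by (intro mult_left_mono add_mono) auto
      finally show ?thesis by (simp add: k_def)
    qed
    have hk: "H (f' u) (g' v) \<le> q (a *\<^sub>R u + b *\<^sub>R v) + k" for u v
      using H_close[OF f'I fI g'J gJ fc gc, of u v] Hq[of u v] by simp
    have qk: "q x + k \<in> {- (B + k)..B + k}" for x using qB[of x] k0 by auto
    have "H (heat 1 f' 0) (heat 1 g' 0) \<le> heat 1 (\<lambda>x. q x + k) (a *\<^sub>R 0 + b *\<^sub>R 0)"
      by (rule heat_flow_inequality[OF fm gm _ C11 L0 f'I g'J qk hk]) measurable
    then have 1: "H (\<integral>x. f' x \<partial>\<gamma>) (\<integral>x. g' x \<partial>\<gamma>) \<le> (\<integral>x. q x \<partial>\<gamma>) + k"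
      unfolding heat_add_const[OF q qB] heat1 by (simp add: heat1)
    have "\<bar>heat 1 f 0 - heat 1 f' 0\<bar> \<le> \<eta>" "\<bar>heat 1 g 0 - heat 1 g' 0\<bar> \<le> \<eta>"
      by (rule heat_close[OF f fm fI f'I] heat_close[OF g gm gJ g'J]; use fc gc in \<open>simp add: abs_minus_commute\<close>)+
    then have 2: "H (\<integral>x. f x \<partial>\<gamma>) (\<integral>x. g x \<partial>\<gamma>) \<le> H (\<integral>x. f' x \<partial>\<gamma>) (\<integral>x. g' x \<partial>\<gamma>) + k"
      unfolding heat1 by (intro H_close integrable_Icc(2) f g fm gm fI gJ f'I g'J)
    have "2 * k = c' * sqrt \<delta>" by (simp add: k_def c'_def \<eta>_def)
    then show ?thesis using 1 2 by linarith
  qed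
  show ?thesis
  proof (rule field_le_epsilon)
    fix \<epsilon> :: real assume \<epsilon>: "0 < \<epsilon>"
    define t where "t = \<epsilon> / (c' + 1)"
    have t: "0 < t" using \<epsilon> c'0 by (simp add: t_def)
    have "c' * t \<le> (c' + 1) * t" using t by (intro mult_right_mono) auto
    also have "\<dots> = \<epsilon>" using c'0 by (simp add: t_def)
    finally have "c' * sqrt (t\<^sup>2) \<le> \<epsilon>" using t by simp
    then show "H (\<integral>x. f x \<partial>\<gamma>) (\<integral>x. g x \<partial>\<gamma>) \<le> (\<integral>x. q x \<partial>\<gamma>) + \<epsilon>" using main[of "t\<^sup>2"] t by simp
  qed
qed

text \<open>Each function misses its typical bound with probability at most \<open>1 / 4\<close>, so some displacement
\<open>x\<close> is good for both functions and for the almost everywhere inequality; there monotonicity of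
\<open>H\<close> applies.\<close>

lemma typical_bounds_inequality:
  assumes f[measurable]: "f \<in> borel_measurable borel" and g[measurable]: "g \<in> borel_measurable borel"
    and fI: "\<And>x. f x \<in> {i0..i1}" and gJ: "\<And>x. g x \<in> {j0..j1}"
    and AE: "AE x in lborel. H (f (u + k *\<^sub>R x)) (g (v + l *\<^sub>R x)) \<le> y"
  shows "H (typical_bound i0 i1 \<sigma> k f u) (typical_bound j0 j1 \<tau> l g v) \<le> y"
proof -
  let ?P = "{x. \<sigma> * f (u + k *\<^sub>R x) < \<sigma> * typical_bound i0 i1 \<sigma> k f u}"
  let ?Q = "{x. \<tau> * g (v + l *\<^sub>R x) < \<tau> * typical_bound j0 j1 \<tau> l g v}"
  have P: "prob ?P \<le> 1 / 4" and Q: "prob ?Q \<le> 1 / 4"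
    by (rule typical_bound_exceeded[OF f fI sgn_cases(1)] typical_bound_exceeded[OF g gJ sgn_cases(2)])+
  have ms: "?P \<in> events" "?Q \<in> events" by simp_all
  have AE\<gamma>: "AE x in \<gamma>. H (f (u + k *\<^sub>R x)) (g (v + l *\<^sub>R x)) \<le> y"
    unfolding gamma_density using AE by (subst AE_density) auto
  have "\<exists>x. x \<notin> ?P \<union> ?Q \<and> H (f (u + k *\<^sub>R x)) (g (v + l *\<^sub>R x)) \<le> y"
  proof (rule ccontr)
    assume "\<not> ?thesis"
    then have "AE x in \<gamma>. x \<in> ?P \<union> ?Q" using AE\<gamma> by (auto elim!: eventually_mono)
    then have "prob (?P \<union> ?Q) = 1" using ms by (intro prob_eq_1[THEN iffD2]) auto
    moreover have "prob (?P \<union> ?Q) \<le> prob ?P + prob ?Q" using ms by (rule measure_Un_le)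
    ultimately show False using P Q by linarith
  qed
  then obtain x where x: "\<sigma> * typical_bound i0 i1 \<sigma> k f u \<le> \<sigma> * f (u + k *\<^sub>R x)" "\<tau> * typical_bound j0 j1 \<tau> l g v \<le> \<tau> * g (v + l *\<^sub>R x)"
    and Hy: "H (f (u + k *\<^sub>R x)) (g (v + l *\<^sub>R x)) \<le> y" by (auto simp: not_less)
  have tI: "typical_bound i0 i1 \<sigma> k f u \<in> {i0..i1}" and tJ: "typical_bound j0 j1 \<tau> l g v \<in> {j0..j1}"
    using i_less j_less by (intro typical_bound_in_Icc; simp)+
  have "H (typical_bound i0 i1 \<sigma> k f u) (typical_bound j0 j1 \<tau> l g v) \<le> H (f (u + k *\<^sub>R x)) (typical_bound j0 j1 \<tau> l g v)"
    by (rule mono_x[OF tI fI tJ x(1)])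
  also have "\<dots> \<le> H (f (u + k *\<^sub>R x)) (g (v + l *\<^sub>R x))" by (rule mono_y[OF fI tJ gJ x(2)])
  finally show ?thesis using Hy by simp
qed

lemma borel_functions_inequality:
  assumes f[measurable]: "f \<in> borel_measurable borel" and g[measurable]: "g \<in> borel_measurable borel" and q[measurable]: "q \<in> borel_measurable borel"
    and fI: "\<And>x. f x \<in> {i0..i1}" and gJ: "\<And>x. g x \<in> {j0..j1}" and qB: "\<And>x. q x \<in> {-B..B}"
    and Hq: "\<And>u v r. 0 < r \<Longrightarrow> AE x in lborel. H (f (u + (- r / a) *\<^sub>R x)) (g (v + (r / b) *\<^sub>R x)) \<le> q (a *\<^sub>R u + b *\<^sub>R v)"
  shows "H (\<integral>x. f x \<partial>\<gamma>) (\<integral>x. g x \<partial>\<gamma>) \<le> (\<integral>x. q x \<partial>\<gamma>)"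
proof -
  define r where "r n = inverse (real (Suc n))" for n
  have r0: "0 < r n" for n by (simp add: r_def)
  have r: "r \<longlonglongrightarrow> 0" unfolding r_def by (rule LIMSEQ_inverse_real_of_nat)
  define k where "k n = - r n / a" for n
  define l where "l n = r n / b" for n
  have k0: "k n \<noteq> 0" and l0: "l n \<noteq> 0" for n using r0[of n] a_pos b_pos by (auto simp: k_def l_def)
  have "k \<longlonglongrightarrow> - 0 / a" "l \<longlonglongrightarrow> 0 / b" unfolding k_def[abs_def] l_def[abs_def] using a_pos b_pos by (intro tendsto_intros r; simp)+
  then have kl: "k \<longlonglongrightarrow> 0" "l \<longlonglongrightarrow> 0" by simp_all
  have K: "0 \<le> K" using K_ge_1 by simp
  let ?E = "\<lambda>n. 9 * shift_modulus (k n) f + 9 * shift_modulus (l n) g"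
  have bound: "H (\<integral>x. f x \<partial>\<gamma>) (\<integral>x. g x \<partial>\<gamma>) \<le> (\<integral>x. q x \<partial>\<gamma>) + K * ?E n" for n
  proof -
    define f' where "f' = typical_bound i0 i1 \<sigma> (k n) f"
    define g' where "g' = typical_bound j0 j1 \<tau> (l n) g"
    have fm[measurable]: "f' \<in> borel_measurable borel" and gm[measurable]: "g' \<in> borel_measurable borel" by (simp_all add: f'_def g'_def)
    have f'I: "f' x \<in> {i0..i1}" and g'J: "g' x \<in> {j0..j1}" for x
      unfolding f'_def g'_def using i_less j_less by (intro typical_bound_in_Icc; simp)+
    obtain \<Lambda>1 where L1: "0 \<le> \<Lambda>1" "\<And>u e. \<bar>f' (u + e) - f' u\<bar> \<le> \<Lambda>1 * norm e"
      using typical_bound_lipschitz[OF k0, of i0 i1 n] f fI sgn_cases(1) unfolding f'_def by blast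
    obtain \<Lambda>2 where L2: "0 \<le> \<Lambda>2" "\<And>u e. \<bar>g' (u + e) - g' u\<bar> \<le> \<Lambda>2 * norm e"
      using typical_bound_lipschitz[OF l0, of j0 j1 n] g gJ sgn_cases(2) unfolding g'_def by blast
    define \<Lambda> where "\<Lambda> = max \<Lambda>1 \<Lambda>2"
    have \<Lambda>0: "0 \<le> \<Lambda>" using L1 by (simp add: \<Lambda>_def)
    have lip: "\<bar>f' (u + e) - f' u\<bar> \<le> \<Lambda> * norm e" "\<bar>g' (u + e) - g' u\<bar> \<le> \<Lambda> * norm e" for u e
      by (rule order_trans[OF L1(2)] order_trans[OF L2(2)], intro mult_right_mono, simp_all add: \<Lambda>_def)+
    have "H (f' u) (g' v) \<le> q (a *\<^sub>R u + b *\<^sub>R v)" for u v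
      unfolding f'_def g'_def by (rule typical_bounds_inequality[OF f g fI gJ]) (unfold k_def l_def, rule Hq[OF r0])
    then have 1: "H (\<integral>x. f' x \<partial>\<gamma>) (\<integral>x. g' x \<partial>\<gamma>) \<le> (\<integral>x. q x \<partial>\<gamma>)"
      by (rule lipschitz_functions_inequality[OF fm gm q f'I g'J qB lip \<Lambda>0])
    have "\<bar>(\<integral>x. f' x \<partial>\<gamma>) - (\<integral>x. f x \<partial>\<gamma>)\<bar> \<le> 9 * shift_modulus (k n) f" "\<bar>(\<integral>x. g' x \<partial>\<gamma>) - (\<integral>x. g x \<partial>\<gamma>)\<bar> \<le> 9 * shift_modulus (l n) g"
      unfolding f'_def g'_def by (rule typical_bound_close[OF f fI sgn_cases(1)] typical_bound_close[OF g gJ sgn_cases(2)])+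
    then have "K * (\<bar>(\<integral>x. f' x \<partial>\<gamma>) - (\<integral>x. f x \<partial>\<gamma>)\<bar> + \<bar>(\<integral>x. g' x \<partial>\<gamma>) - (\<integral>x. g x \<partial>\<gamma>)\<bar>) \<le> K * ?E n"
      using K by (intro mult_left_mono add_mono)
    moreover have "\<bar>H (\<integral>x. f' x \<partial>\<gamma>) (\<integral>x. g' x \<partial>\<gamma>) - H (\<integral>x. f x \<partial>\<gamma>) (\<integral>x. g x \<partial>\<gamma>)\<bar>
      \<le> K * (\<bar>(\<integral>x. f' x \<partial>\<gamma>) - (\<integral>x. f x \<partial>\<gamma>)\<bar> + \<bar>(\<integral>x. g' x \<partial>\<gamma>) - (\<integral>x. g x \<partial>\<gamma>)\<bar>)"
      by (intro lipschitz integrable_Icc(2) f g fm gm fI gJ f'I g'J)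
    ultimately show ?thesis using 1 by linarith
  qed
  have "(\<lambda>n. (\<integral>x. q x \<partial>\<gamma>) + K * ?E n) \<longlonglongrightarrow> (\<integral>x. q x \<partial>\<gamma>) + K * (9 * 0 + 9 * 0)"
    by (intro tendsto_intros shift_modulus_tendsto_0[OF f fI kl(1)] shift_modulus_tendsto_0[OF g gJ kl(2)])
  then show ?thesis using bound by (intro LIMSEQ_le_const) auto
qed

end

text \<open>Completing the square puts the centre at the solution \<open>m\<close> of \<open>A m = \<beta> / 2\<close>, which
exists because \<open>A\<close> is positive definite and hence injective. The centred measure is symmetric, so
\<open>m\<close> is the mean.\<close>

lemma gaussian_measure_centering:
  fixes M :: "(real ^ 'n) measure"
  assumes G: "gaussian_measure M" and int: "integrable M (\<lambda>x. norm x ^ 3)"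
  obtains A c m where "centered_gaussian A c (distr M borel (\<lambda>x. x - m))"
    and "(\<integral>x. x \<partial>M) = m"
proof -
  obtain A :: "real ^ 'n ^ 'n" and \<beta> c where P: "prob_space M" and sym: "transpose A = A" and pos: "\<And>x. x \<noteq> 0 \<Longrightarrow> 0 < x \<bullet> (A *v x)"
    and M: "M = density lborel (\<lambda>x. ennreal (exp (- (x \<bullet> (A *v x)) + \<beta> \<bullet> x + c)))"
    using G unfolding gaussian_measure_def by blast
  interpret M: prob_space M by fact
  have sM[measurable_cong]: "sets M = sets borel" by (simp add: M)
  have "inj ((*v) A)"
  proof (rule injI)
    fix x y assume "A *v x = A *v y"
    then have "(x - y) \<bullet> (A *v (x - y)) = 0" by (simp add: matrix_vector_mult_diff_distrib)
    then show "x = y" using pos[of "x - y"] by auto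
  qed
  then have "surj ((*v) A)" by (intro linear_inj_imp_surj matrix_vector_mul_linear)
  then obtain m where m: "A *v m = (1 / 2) *\<^sub>R \<beta>" by (metis surjD)
  have symA: "x \<bullet> (A *v y) = y \<bullet> (A *v x)" for x y
    by (metis dot_lmul_matrix inner_commute sym transpose_matrix_vector)
  define c' where "c' = - (m \<bullet> (A *v m)) + \<beta> \<bullet> m + c"
  define h where "h x = exp (- (x \<bullet> (A *v x)) + \<beta> \<bullet> x + c)" for x
  have [measurable]: "h \<in> borel_measurable borel"
    unfolding h_def by (intro borel_measurable_continuous_onI continuous_intros linear_continuous_on_compose matrix_vector_mul_linear)
  have Mh: "M = density lborel (\<lambda>x. ennreal (h x))" by (simp only: M h_def)
  have h: "h (m + x) = exp (- (x \<bullet> (A *v x)) + c')" for x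
  proof -
    have "(m + x) \<bullet> (A *v (m + x)) = m \<bullet> (A *v m) + 2 * (x \<bullet> (A *v m)) + x \<bullet> (A *v x)"
      using symA[of x m] by (simp add: matrix_vector_right_distrib inner_add_left inner_add_right)
    moreover have "2 * (x \<bullet> (A *v m)) = \<beta> \<bullet> x" by (simp add: m inner_commute)
    ultimately show ?thesis by (simp add: h_def c'_def inner_add_right)
  qed
  define \<gamma> where "\<gamma> = distr M borel (\<lambda>x. x - m)"
  have \<gamma>: "\<gamma> = density lborel (\<lambda>x. ennreal (exp (- (x \<bullet> (A *v x)) + c')))"
  proof -
    have "distr (density (distr lborel borel ((+) m)) (\<lambda>x. ennreal (h x))) borel (\<lambda>x. x - m) = density lborel ((\<lambda>x. ennreal (h x)) \<circ> (+) m)"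
      using distr_density_distr[of "(+) m" lborel borel "\<lambda>x. x - m" "\<lambda>x. ennreal (h x)"] by (simp cong: distr_cong)
    then show ?thesis unfolding lborel_distr_plus by (simp add: \<gamma>_def Mh h o_def)
  qed
  have i3: "integrable M (\<lambda>x. norm (x - m) ^ 3)"
  proof (rule Bochner_Integration.integrable_bound)
    show "integrable M (\<lambda>x. 8 * (norm x ^ 3 + norm m ^ 3))" using int by simp
    show "AE x in M. norm (norm (x - m) ^ 3) \<le> norm (8 * (norm x ^ 3 + norm m ^ 3))"
    proof (rule AE_I2)
      fix x :: "real ^ 'n"
      define y where "y = max (norm x) (norm m)"
      have "norm (x - m) \<le> 2 * y" using norm_triangle_ineq4[of x m] by (simp add: y_def max_def)
      then have "norm (x - m) ^ 3 \<le> (2 * y) ^ 3" by (rule power_mono) simp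
      also have "\<dots> = 8 * y ^ 3" by (simp add: power_mult_distrib)
      also have "\<dots> \<le> 8 * (norm x ^ 3 + norm m ^ 3)" by (simp add: y_def max_def)
      finally show "norm (norm (x - m) ^ 3) \<le> norm (8 * (norm x ^ 3 + norm m ^ 3))" by simp
    qed
  qed measurable
  have cg: "centered_gaussian A c' \<gamma>"
  proof (rule centered_gaussian.intro)
    show "prob_space \<gamma>" unfolding \<gamma>_def by (rule M.prob_space_distr) measurable
    show "integrable \<gamma> (\<lambda>x. norm x ^ 3)" unfolding \<gamma>_def by (subst integrable_distr_eq) (use i3 in simp_all)
  qed (use sym pos \<gamma> in auto)
  interpret C: centered_gaussian A c' \<gamma> by (rule cg)
  have in\<gamma>: "integrable \<gamma> (\<lambda>x. x)"
  proof -
    have "integrable \<gamma> (\<lambda>x. norm x)" using C.moments[of 1] by simp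
    then show ?thesis by (subst (asm) integrable_norm_iff) simp_all
  qed
  have "(\<integral>x. x \<partial>\<gamma>) \<bullet> e = 0" for e using in\<gamma> C.mean_zero[of e] by simp
  then have z: "(\<integral>x. x \<partial>\<gamma>) = 0" by (metis inner_eq_zero_iff)
  have i: "integrable M (\<lambda>x. x - m)" using in\<gamma> unfolding \<gamma>_def by (subst (asm) integrable_distr_eq) simp_all
  have "(\<integral>x. x - m \<partial>M) = 0" using z unfolding \<gamma>_def by (subst (asm) integral_distr) simp_all
  moreover have "integrable M (\<lambda>x. x)" using Bochner_Integration.integrable_add[OF i M.integrable_const[of m]] by simp
  ultimately have "(\<integral>x. x \<partial>M) = m" by (simp add: M.prob_space)
  with cg that show thesis unfolding \<gamma>_def by blast
qed

text \<open>The triangle condition forces \<open>a + b \<ge> 1\<close>. So either \<open>a + b = 1\<close>, or the mean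
\<open>m\<close> vanishes; in both cases \<open>(a + b) m = m\<close>, and translating all functions by
\<open>m\<close> respects the lines \<open>a u + b v = z\<close>.\<close>

theorem esssup_inequality_sufficient:
  fixes M :: "(real ^ 'n) measure"
  assumes rect: "smooth_rectangle i0 i1 j0 j1 H Hx Hy Hxx Hxy Hyy K \<sigma> \<tau>"
    and ab: "0 < a" "0 < b"
    and G: "gaussian_measure M" and int: "integrable M (\<lambda>x. norm x ^ 3)"
    and cond1: "\<And>x y. x \<in> {i0..i1} \<Longrightarrow> y \<in> {j0..j1} \<Longrightarrow>
      0 \<le> a\<^sup>2 * (Hxx x y / (Hx x y)\<^sup>2) + (1 - a\<^sup>2 - b\<^sup>2) * (Hxy x y / (Hx x y * Hy x y)) + b\<^sup>2 * (Hyy x y / (Hy x y)\<^sup>2)"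
    and cond2: "\<bar>1 - a\<^sup>2 - b\<^sup>2\<bar> \<le> 2 * a * b"
    and cond3: "a + b > 1 \<Longrightarrow> (\<integral>x. x \<partial>M) = 0"
  shows "esssup_inequality a b {i0..i1} {j0..j1} H M"
proof -
  interpret R: smooth_rectangle i0 i1 j0 j1 H Hx Hy Hxx Hxy Hyy K \<sigma> \<tau> by fact
  obtain A c m where C: "centered_gaussian A c (distr M borel (\<lambda>x. x - m))" and m: "(\<integral>x. x \<partial>M) = m"
    using gaussian_measure_centering[OF G int] by blast
  define \<gamma> where "\<gamma> = distr M borel (\<lambda>x. x - m)"
  interpret gaussian_setting i0 i1 j0 j1 H Hx Hy Hxx Hxy Hyy K \<sigma> \<tau> A c \<gamma> a b
    by (intro gaussian_setting.intro gaussian_setting_axioms.intro rect ab cond1 cond2) (use C in \<open>simp_all add: \<gamma>_def\<close>)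
  have sM[measurable_cong]: "sets M = sets borel" using G by (auto simp: gaussian_measure_def)
  have abm: "(a + b) *\<^sub>R m = m"
  proof (cases "a + b > 1")
    case True
    then show ?thesis using cond3 m by simp
  next
    case False
    have "1\<^sup>2 \<le> (a + b)\<^sup>2" using cond2 by (simp add: power2_sum)
    then have "1 \<le> a + b" by (rule power2_le_imp_le) (use ab in simp)
    then have "a + b = 1" using False by simp
    then show ?thesis by simp
  qed
  have dist: "(\<integral>x. \<phi> (x + m) \<partial>\<gamma>) = (\<integral>x. \<phi> x \<partial>M)" if "\<phi> \<in> borel_measurable borel" for \<phi> :: "real ^ 'n \<Rightarrow> real"
    unfolding \<gamma>_def using that by (subst integral_distr) simp_all
  show ?thesis
    unfolding esssup_inequality_iff
  proof (intro ballI impI, elim conjE)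
    fix f g :: "real ^ 'n \<Rightarrow> real"
    assume f[measurable]: "f \<in> borel_measurable borel" and g[measurable]: "g \<in> borel_measurable borel"
      and "\<forall>x. f x \<in> {i0..i1}" "\<forall>x. g x \<in> {j0..j1}"
    then have fI: "\<And>x. f x \<in> {i0..i1}" and gJ: "\<And>x. g x \<in> {j0..j1}" by auto
    let ?q = "sup_convolution a b H f g"
    note q = R.sup_convolution[OF f g fI gJ, where a = a and b = b]
    obtain B where B: "\<And>x. \<bar>?q x\<bar> \<le> B" using q(2) by blast
    have qB: "?q x \<in> {-B..B}" for x using B[of x] by (simp add: abs_le_iff)
    have qm[measurable]: "?q \<in> borel_measurable borel" by (rule q(1))
    have "H (\<integral>x. f (x + m) \<partial>\<gamma>) (\<integral>x. g (x + m) \<partial>\<gamma>) \<le> (\<integral>x. ?q (x + m) \<partial>\<gamma>)"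
    proof (rule borel_functions_inequality[OF _ _ _ fI gJ qB])
      fix u v :: "real ^ 'n" and r :: real assume r: "0 < r"
      define x where "x = a *\<^sub>R u + b *\<^sub>R v + m"
      have pm: "Measurable.pred borel (\<lambda>y. H (f ((1 / a) *\<^sub>R (x - y))) (g ((1 / b) *\<^sub>R y)) \<le> ?q x)"
      proof -
        have [measurable]: "(\<lambda>y. H (f ((1 / a) *\<^sub>R (x - y))) (g ((1 / b) *\<^sub>R y))) \<in> borel_measurable borel"
          using fI gJ by (intro R.H_measurable) measurable
        show ?thesis by measurable
      qed
      have "AE \<zeta> in lborel. H (f ((1 / a) *\<^sub>R (x - (b *\<^sub>R (v + m) + r *\<^sub>R \<zeta>)))) (g ((1 / b) *\<^sub>R (b *\<^sub>R (v + m) + r *\<^sub>R \<zeta>))) \<le> ?q x"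
        by (rule AE_lborel_affine[OF _ pm q(3)]) (use r in simp)
      moreover have "(1 / a) *\<^sub>R (x - (b *\<^sub>R (v + m) + r *\<^sub>R \<zeta>)) = u + (- r / a) *\<^sub>R \<zeta> + m" for \<zeta>
      proof -
        have "a *\<^sub>R m = m - b *\<^sub>R m" using abm by (simp add: scaleR_add_left algebra_simps)
        then have "x - (b *\<^sub>R (v + m) + r *\<^sub>R \<zeta>) = a *\<^sub>R (u + (- r / a) *\<^sub>R \<zeta> + m)"
          using ab by (simp add: x_def scaleR_add_right scaleR_diff_right)
        then show ?thesis using ab by simp
      qed
      moreover have "(1 / b) *\<^sub>R (b *\<^sub>R (v + m) + r *\<^sub>R \<zeta>) = v + (r / b) *\<^sub>R \<zeta> + m" for \<zeta>
        using ab by (simp add: scaleR_add_right)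
      ultimately show "AE \<zeta> in lborel. H (f (u + (- r / a) *\<^sub>R \<zeta> + m)) (g (v + (r / b) *\<^sub>R \<zeta> + m)) \<le> ?q (a *\<^sub>R u + b *\<^sub>R v + m)"
        unfolding x_def by simp
    qed measurable
    then show "H (\<integral>x. f x \<partial>M) (\<integral>x. g x \<partial>M) \<le> (\<integral>x. ?q x \<partial>M)"
      by (simp only: dist f g qm)
  qed
qed

section \<open>The characterisation\<close>

theorem theorem1:
  fixes a b i0 i1 j0 j1 :: real
    and I J :: "real set"
    and H :: "real \<Rightarrow> real \<Rightarrow> real"
    and M :: "(real ^ 'n) measure"
  assumes "i0 < i1" and "I = {i0..i1}"
    and "j0 < j1" and "J = {j0..j1}"
    and "a > 0" and "b > 0"
    and "C_k_on 3 I J H"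
    and "\<And>x y. x \<in> I \<Longrightarrow> y \<in> J \<Longrightarrow> partial_x I H x y \<noteq> 0"
    and "\<And>x y. x \<in> I \<Longrightarrow> y \<in> J \<Longrightarrow> partial_y J H x y \<noteq> 0"
    and "prob_space M" and "sets M = sets borel"
    and "absolutely_continuous lborel M"
    and "integrable M (\<lambda>x. norm x ^ 5)"
  shows
    "(esssup_inequality a b I J H M \<longrightarrow>
        differential_condition a b I J H \<and>
        \<bar>1 - a\<^sup>2 - b\<^sup>2\<bar> \<le> 2 * a * b \<and>
        (a + b > 1 \<longrightarrow> (\<integral>x. x \<partial>M) = 0)) \<and>
     (gaussian_measure M \<longrightarrow>
        differential_condition a b I J H \<and>
        \<bar>1 - a\<^sup>2 - b\<^sup>2\<bar> \<le> 2 * a * b \<and>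
        (a + b > 1 \<longrightarrow> (\<integral>x. x \<partial>M) = 0) \<longrightarrow>
        esssup_inequality a b I J H M)"
proof -
  obtain K \<sigma> \<tau> where rect: "smooth_rectangle i0 i1 j0 j1 H (partial_x I H) (partial_y J H)
      (partial_x I (partial_x I H)) (partial_y J (partial_x I H)) (partial_y J (partial_y J H)) K \<sigma> \<tau>"
    using C3_imp_smooth_rectangle[of i0 i1 j0 j1 H] assms(1-9) by auto
  have C3: "C_k_on (Suc (Suc (Suc 0))) {i0..i1} {j0..j1} H" using assms(2,4,7) by (simp add: numeral_3_eq_3)
  note C2 = C_k_on_Suc_D(1,2)[OF C3]
  note C1 = C_k_on_Suc_D(1,2)[OF C2(1)] C_k_on_Suc_D(2)[OF C2(2)]
  note cont = C2[THEN C_k_on_continuous] C1[THEN C_k_on_continuous]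
  have int: "integrable M (\<lambda>x. norm x ^ 3)"
  proof (rule Bochner_Integration.integrable_bound)
    interpret prob_space M by fact
    show "integrable M (\<lambda>x. 1 + norm x ^ 5)" using assms(13) by simp
    have "norm x ^ 3 \<le> 1 + norm x ^ 5" for x :: "real ^ 'n"
    proof (cases "norm x \<le> 1")
      case True
      then have "norm x ^ 3 \<le> 1" by (simp add: power_le_one)
      then show ?thesis by (rule order_trans) simp
    next
      case False
      then have "norm x ^ 3 \<le> norm x ^ 5" by (intro power_increasing) auto
      then show ?thesis by simp
    qed
    then show "AE x in M. norm (norm x ^ 3) \<le> norm (1 + norm x ^ 5)" by simp
  qed (use assms(11) in \<open>simp cong: measurable_cong_sets\<close>)
  have necessary: "differential_condition a b I J H \<and> \<bar>1 - a\<^sup>2 - b\<^sup>2\<bar> \<le> 2 * a * b \<and> (a + b > 1 \<longrightarrow> (\<integral>x. x \<partial>M) = 0)"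
    if E: "esssup_inequality a b I J H M"
    using esssup_inequality_necessary[OF rect[unfolded assms(2,4)] cont[unfolded assms(2,4)] assms(5,6) E[unfolded assms(2,4)] assms(10,11,12) int]
    unfolding differential_condition_def assms(2,4) by blast
  have sufficient: "esssup_inequality a b I J H M"
    if "gaussian_measure M" and "differential_condition a b I J H" and "\<bar>1 - a\<^sup>2 - b\<^sup>2\<bar> \<le> 2 * a * b"
      and "a + b > 1 \<longrightarrow> (\<integral>x. x \<partial>M) = 0"
    using that esssup_inequality_sufficient[OF rect[unfolded assms(2,4)] assms(5,6) that(1) int]
    unfolding differential_condition_def assms(2,4) by blast
  show ?thesis using necessary sufficient by blast
qed

end
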